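(* Let $A$ be a fixed self-adjoint operator on a separable Hilbert space $\mathcal{H}$. Let $\mathcal{I}_2$ be the space of self-adjoint Hilbert-Schmidt operators on $\mathcal{H}$ with the Hilbert-Schmidt norm. Then there is a dense $G_\delta$ subset $\mathcal{G}\subset\mathcal{I}_2$ such that for every $C\in\mathcal{G}$ the set of vectors $$\{\psi\mid d\mu^{\psi}_{A+C}\text{ is purely singular continuous}\}\ \cup\ \{\psi\mid (A+C)\psi=E\psi \text{ for some } E\in\operatorname{spec}_{\mathrm{disc}}(A+C)\}$$ spans $\mathcal{H}$, i.e. its closed linear span is $\mathcal{H}$.
   Context: $A$ may be unbounded. For a self-adjoint operator $D$ on $\mathcal{H}$ and $\psi\in\mathcal{H}$, $d\mu_D^\psi$ is the spectral measure given by $(\psi,e^{isD}\psi)=\int e^{isE}\,d\mu_D^\psi(E)$; it is purely singular continuous if it has no pure point part and no absolutely continuous part. $\operatorname{spec}_{\mathrm{disc}}(D)$ is the discrete spectrum of $D$: the set of isolated points of the spectrum that are eigenvalues of finite multiplicity. *)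

theory Defs
  imports "HOL-Probability.Probability"
begin

section \<open>Complex Hilbert spaces\<close>

text \<open>The inner product is conjugate-linear in the first argument.\<close>

class chilbert_space = banach +
  fixes scaleC :: "complex \<Rightarrow> 'a \<Rightarrow> 'a"  (infixr \<open>*\<^sub>C\<close> 75)
    and cinner :: "'a \<Rightarrow> 'a \<Rightarrow> complex"
  assumes scaleC_add_right: "c *\<^sub>C (x + y) = c *\<^sub>C x + c *\<^sub>C y"
    and scaleC_add_left: "(c + d) *\<^sub>C x = c *\<^sub>C x + d *\<^sub>C x"
    and scaleC_scaleC: "c *\<^sub>C d *\<^sub>C x = (c * d) *\<^sub>C x"
    and scaleC_one: "1 *\<^sub>C x = x"
    and scaleR_scaleC: "scaleR r x = complex_of_real r *\<^sub>C x"
    and cinner_commute: "cinner x y = cnj (cinner y x)"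
    and cinner_add_right: "cinner x (y + z) = cinner x y + cinner x z"
    and cinner_scaleC_right: "cinner x (c *\<^sub>C y) = c * cinner x y"
    and cinner_norm: "cinner x x = complex_of_real ((norm x)\<^sup>2)"

global_interpretation cvec: vector_space "scaleC :: complex \<Rightarrow> 'a \<Rightarrow> 'a::chilbert_space"
  by unfold_locales
     (auto simp: scaleC_add_right scaleC_add_left scaleC_scaleC scaleC_one)

abbreviation clinear :: "('a::chilbert_space \<Rightarrow> 'a) \<Rightarrow> bool"
  where "clinear \<equiv> Vector_Spaces.linear scaleC scaleC"

definition corthonormal :: "'a::chilbert_space set \<Rightarrow> bool"
  where "corthonormal B \<longleftrightarrow> (\<forall>e\<in>B. \<forall>f\<in>B. cinner e f = (if e = f then 1 else 0))"

definition orthonormal_basis :: "'a::chilbert_space set \<Rightarrow> bool"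
  where "orthonormal_basis B \<longleftrightarrow>
    corthonormal B \<and> (\<forall>B'. corthonormal B' \<and> B \<subseteq> B' \<longrightarrow> B' = B)"


section \<open>Unbounded operators\<close>

text \<open>An operator with domain is a partial function; equality of operators is equality of
  graphs, so it includes equality of domains.\<close>

definition densely_defined_operator :: "('a::chilbert_space \<rightharpoonup> 'a) \<Rightarrow> bool"
  where "densely_defined_operator A \<longleftrightarrow>
    cvec.subspace (dom A) \<and> closure (dom A) = UNIV \<and>
    (\<forall>x\<in>dom A. \<forall>y\<in>dom A. the (A (x + y)) = the (A x) + the (A y)) \<and>
    (\<forall>c. \<forall>x\<in>dom A. the (A (c *\<^sub>C x)) = c *\<^sub>C the (A x))"

definition adjoint_of :: "('a::chilbert_space \<rightharpoonup> 'a) \<Rightarrow> ('a \<rightharpoonup> 'a)"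
  where "adjoint_of A = (\<lambda>y.
    if \<exists>z. \<forall>x\<in>dom A. cinner y (the (A x)) = cinner z x
    then Some (THE z. \<forall>x\<in>dom A. cinner y (the (A x)) = cinner z x)
    else None)"

definition self_adjoint :: "('a::chilbert_space \<rightharpoonup> 'a) \<Rightarrow> bool"
  where "self_adjoint A \<longleftrightarrow> densely_defined_operator A \<and> adjoint_of A = A"

definition perturb :: "('a::chilbert_space \<rightharpoonup> 'a) \<Rightarrow> ('a \<Rightarrow> 'a) \<Rightarrow> ('a \<rightharpoonup> 'a)"
  where "perturb A C = (\<lambda>x. map_option (\<lambda>y. y + C x) (A x))"

definition resolvent_set :: "('a::chilbert_space \<rightharpoonup> 'a) \<Rightarrow> complex set"
  where "resolvent_set A = {z.
    bij_betw (\<lambda>x. the (A x) - z *\<^sub>C x) (dom A) UNIV \<and>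
    (\<exists>K. \<forall>x\<in>dom A. norm x \<le> K * norm (the (A x) - z *\<^sub>C x))}"

definition spectrum :: "('a::chilbert_space \<rightharpoonup> 'a) \<Rightarrow> complex set"
  where "spectrum A = - resolvent_set A"

definition eigenspace :: "('a::chilbert_space \<rightharpoonup> 'a) \<Rightarrow> complex \<Rightarrow> 'a set"
  where "eigenspace A z = {x. A x = Some (z *\<^sub>C x)}"

definition disc_spectrum :: "('a::chilbert_space \<rightharpoonup> 'a) \<Rightarrow> complex set"
  where "disc_spectrum A = {z. z isolated_in spectrum A \<and>
    (\<exists>x\<in>eigenspace A z. x \<noteq> 0) \<and>
    (\<exists>F. finite F \<and> eigenspace A z = cvec.span F)}"


section \<open>Spectral measures\<close>

definition unitary :: "('a::chilbert_space \<Rightarrow> 'a) \<Rightarrow> bool"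
  where "unitary T \<longleftrightarrow> clinear T \<and> surj T \<and> (\<forall>x y. cinner (T x) (T y) = cinner x y)"

definition unitary_group :: "(real \<Rightarrow> 'a::chilbert_space \<Rightarrow> 'a) \<Rightarrow> bool"
  where "unitary_group U \<longleftrightarrow>
    (\<forall>s. unitary (U s)) \<and> U 0 = id \<and> (\<forall>s t. U (s + t) = U s \<circ> U t) \<and>
    (\<forall>x. continuous_on UNIV (\<lambda>s. U s x))"

text \<open>For unbounded \<open>A\<close> the group \<open>s \<mapsto> e\<^sup>i\<^sup>s\<^sup>A\<close> is understood in the sense of Stone's theorem: it
  is the strongly continuous unitary group whose infinitesimal generator is exactly \<open>A\<close>,
  domain included.\<close>

definition exp_i :: "('a::chilbert_space \<rightharpoonup> 'a) \<Rightarrow> real \<Rightarrow> 'a \<Rightarrow> 'a"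
  where "exp_i A = (THE U. unitary_group U \<and>
    (\<forall>x y. A x = Some y \<longleftrightarrow> ((\<lambda>s. U s x) has_vector_derivative \<i> *\<^sub>C y) (at 0)))"

definition spectral_measure :: "('a::chilbert_space \<rightharpoonup> 'a) \<Rightarrow> 'a \<Rightarrow> real measure"
  where "spectral_measure A \<psi> = (THE \<mu>. finite_borel_measure \<mu> \<and>
    (\<forall>s. cinner \<psi> (exp_i A s \<psi>) = (CLINT E|\<mu>. iexp (s * E))))"

definition pure_point :: "real measure \<Rightarrow> bool"
  where "pure_point \<mu> \<longleftrightarrow> (\<exists>S. countable S \<and> emeasure \<mu> (UNIV - S) = 0)"

definition singular_continuous :: "real measure \<Rightarrow> bool"
  where "singular_continuous \<mu> \<longleftrightarrow> (\<forall>x. emeasure \<mu> {x} = 0) \<and>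
    (\<exists>N\<in>null_sets lborel. emeasure \<mu> (UNIV - N) = 0)"

definition lebesgue_decomposition ::
    "real measure \<Rightarrow> real measure \<Rightarrow> real measure \<Rightarrow> real measure \<Rightarrow> bool"
  where "lebesgue_decomposition \<mu> pp ac sc \<longleftrightarrow>
    sets pp = sets borel \<and> sets ac = sets borel \<and> sets sc = sets borel \<and>
    (\<forall>S\<in>sets borel. emeasure \<mu> S = emeasure pp S + emeasure ac S + emeasure sc S) \<and>
    pure_point pp \<and> absolutely_continuous lborel ac \<and> singular_continuous sc"

definition purely_singular_continuous :: "real measure \<Rightarrow> bool"
  where "purely_singular_continuous \<mu> \<longleftrightarrow>
    (\<exists>pp ac sc. lebesgue_decomposition \<mu> pp ac sc \<and> emeasure pp UNIV = 0 \<and> emeasure ac UNIV = 0)"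


section \<open>Self-adjoint Hilbert-Schmidt operators\<close>

text \<open>The Hilbert-Schmidt property and norm do not depend on the orthonormal basis, so one basis
  is fixed once and for all.\<close>

definition some_basis :: "'a::chilbert_space set"
  where "some_basis = (SOME B. orthonormal_basis B)"

definition hilbert_schmidt :: "('a::chilbert_space \<Rightarrow> 'a) \<Rightarrow> bool"
  where "hilbert_schmidt T \<longleftrightarrow>
    clinear T \<and> bounded_linear T \<and> (\<lambda>e. (norm (T e))\<^sup>2) summable_on some_basis"

definition hs_norm :: "('a::chilbert_space \<Rightarrow> 'a) \<Rightarrow> real"
  where "hs_norm T = sqrt (\<Sum>\<^sub>\<infinity>e\<in>some_basis. (norm (T e))\<^sup>2)"

definition sa_hilbert_schmidt :: "('a::chilbert_space \<Rightarrow> 'a) set"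
  where "sa_hilbert_schmidt = {T. hilbert_schmidt T \<and> self_adjoint (\<lambda>x. Some (T x))}"

definition hs_dist :: "('a::chilbert_space \<Rightarrow> 'a) \<Rightarrow> ('a \<Rightarrow> 'a) \<Rightarrow> real"
  where "hs_dist S T = hs_norm (\<lambda>x. S x - T x)"

definition hs_topology :: "('a::chilbert_space \<Rightarrow> 'a) topology"
  where "hs_topology = Metric_space.mtopology sa_hilbert_schmidt hs_dist"


subsection \<open>The Hilbert-Schmidt distance is a metric\<close>

lemma cinner_zero_right [simp]: "cinner x (0::'a::chilbert_space) = 0"
  using cinner_add_right[of x 0 0] by simp

lemma cinner_zero_left [simp]: "cinner (0::'a::chilbert_space) x = 0"
  by (subst cinner_commute) simp

lemma cinner_self_eq_0 [simp]: "cinner x x = 0 \<longleftrightarrow> (x::'a::chilbert_space) = 0"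
  by (simp add: cinner_norm)

lemma cinner_diff_right: "cinner x (y - z) = cinner x y - cinner x (z::'a::chilbert_space)"
  using cinner_add_right[of x "y - z" z] by simp

lemma cinner_diff_left: "cinner (x - y) z = cinner x z - cinner y (z::'a::chilbert_space)"
  by (metis cinner_commute cinner_diff_right complex_cnj_diff)

lemma orthonormal_basis_exists: "\<exists>B::'a::chilbert_space set. orthonormal_basis B"
proof -
  have "\<exists>M\<in>Collect corthonormal. \<forall>X\<in>Collect corthonormal. M \<subseteq> X \<longrightarrow> X = (M::'a set)"
  proof (rule subset_Zorn')
    fix \<C> :: "'a set set" assume C: "subset.chain (Collect corthonormal) \<C>"
    have "corthonormal (\<Union>\<C>)"
      unfolding corthonormal_def
    proof (intro ballI)
      fix e f assume "e \<in> \<Union>\<C>" "f \<in> \<Union>\<C>"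
      then obtain X where "X \<in> \<C>" "e \<in> X" "f \<in> X"
        using C unfolding subset_chain_def by (metis UnionE subsetD)
      then show "cinner e f = (if e = f then 1 else 0)"
        using C unfolding subset_chain_def corthonormal_def by auto
    qed
    then show "\<Union>\<C> \<in> Collect corthonormal" by simp
  qed
  then show ?thesis unfolding orthonormal_basis_def by auto
qed

lemma some_basis: "orthonormal_basis some_basis"
  unfolding some_basis_def using orthonormal_basis_exists by (rule someI_ex)

lemma orthonormal_basis_total:
  assumes B: "orthonormal_basis B" and x: "\<And>e. e \<in> B \<Longrightarrow> cinner e x = 0"
  shows "x = (0::'a::chilbert_space)"
proof (rule ccontr)
  assume nz: "x \<noteq> 0"
  define u where "u = complex_of_real (1 / norm x) *\<^sub>C x"
  have ue: "cinner e u = 0" "cinner u e = 0" if "e \<in> B" for e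
    using x[OF that] cinner_commute[of u e] by (simp_all add: u_def cinner_scaleC_right)
  have uu: "cinner u u = 1"
  proof -
    have "u = (1 / norm x) *\<^sub>R x" by (simp only: u_def scaleR_scaleC)
    then have "norm u = 1" using nz by simp
    then show ?thesis using cinner_norm[of u] by simp
  qed
  have "corthonormal (insert u B)"
    using B ue uu unfolding orthonormal_basis_def corthonormal_def by auto
  then have "u \<in> B" using B unfolding orthonormal_basis_def by blast
  then show False using ue uu by fastforce
qed

lemma self_adjoint_total:
  assumes "self_adjoint (\<lambda>x. Some (T x))"
  shows "cinner y (T x) = cinner (T y) (x::'a::chilbert_space)"
proof -
  let ?P = "\<lambda>z. \<forall>x. cinner y (T x) = cinner z x"
  have eq: "adjoint_of (\<lambda>x. Some (T x)) y = Some (T y)"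
    using assms unfolding self_adjoint_def by simp
  have ex: "\<exists>z. ?P z" and the: "(THE z. ?P z) = T y"
    using eq by (auto simp: adjoint_of_def dom_def split: if_splits)
  have "z = z'" if "?P z" "?P z'" for z z'
  proof -
    have "cinner (z - z') (z - z') = 0"
      using that by (metis cinner_diff_left diff_self)
    then show ?thesis by simp
  qed
  then have "\<exists>!z. ?P z" using ex by blast
  then show ?thesis using theI'[of ?P] the by auto
qed

lemma hilbert_schmidt_diff_summable:
  fixes P Q :: "'a::chilbert_space \<Rightarrow> 'a"
  assumes "hilbert_schmidt P" "hilbert_schmidt Q"
  shows "(\<lambda>e. (norm (P e - Q e))\<^sup>2) summable_on some_basis"
proof (rule summable_on_comparison_test)
  show "(\<lambda>e. 2 * (norm (P e))\<^sup>2 + 2 * (norm (Q e))\<^sup>2) summable_on some_basis"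
    using assms unfolding hilbert_schmidt_def
    by (intro summable_on_add summable_on_cmult_right) auto
  show "(norm (P e - Q e))\<^sup>2 \<le> 2 * (norm (P e))\<^sup>2 + 2 * (norm (Q e))\<^sup>2" for e
  proof -
    have "(norm (P e - Q e))\<^sup>2 \<le> (norm (P e) + norm (Q e))\<^sup>2"
      by (intro power_mono norm_triangle_ineq4) auto
    also have "\<dots> \<le> 2 * (norm (P e))\<^sup>2 + 2 * (norm (Q e))\<^sup>2"
      using zero_le_power2[of "norm (P e) - norm (Q e)"]
      by (simp add: power2_eq_square algebra_simps)
    finally show ?thesis .
  qed
qed auto

lemma hs_dist_triangle:
  fixes R S T :: "'a::chilbert_space \<Rightarrow> 'a"
  assumes "hilbert_schmidt R" "hilbert_schmidt S" "hilbert_schmidt T"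
  shows "hs_dist R T \<le> hs_dist R S + hs_dist S T"
proof -
  have fin: "L2_set (\<lambda>e. norm (P e - Q e)) F \<le> hs_dist P Q"
    if "hilbert_schmidt P" "hilbert_schmidt Q" "finite F" "F \<subseteq> some_basis"
    for P Q :: "'a \<Rightarrow> 'a" and F
    unfolding L2_set_def hs_dist_def hs_norm_def
    by (intro real_sqrt_le_mono finite_sum_le_infsum hilbert_schmidt_diff_summable that) auto
  have nn: "0 \<le> hs_dist P Q" for P Q :: "'a \<Rightarrow> 'a"
    unfolding hs_dist_def hs_norm_def by (intro real_sqrt_ge_zero infsum_nonneg) auto
  have "(\<Sum>\<^sub>\<infinity>e\<in>some_basis. (norm (R e - T e))\<^sup>2) \<le> (hs_dist R S + hs_dist S T)\<^sup>2"
  proof (rule infsum_le_finite_sums[OF hilbert_schmidt_diff_summable[OF assms(1,3)]])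
    fix F :: "'a set" assume F: "finite F" "F \<subseteq> some_basis"
    have "L2_set (\<lambda>e. norm (R e - T e)) F
        \<le> L2_set (\<lambda>e. norm (R e - S e) + norm (S e - T e)) F"
      by (intro L2_set_mono) (auto intro: norm_triangle_le norm_diff_triangle_le)
    also have "\<dots> \<le> L2_set (\<lambda>e. norm (R e - S e)) F + L2_set (\<lambda>e. norm (S e - T e)) F"
      by (rule L2_set_triangle_ineq)
    also have "\<dots> \<le> hs_dist R S + hs_dist S T"
      by (intro add_mono fin assms F)
    finally have "(L2_set (\<lambda>e. norm (R e - T e)) F)\<^sup>2 \<le> (hs_dist R S + hs_dist S T)\<^sup>2"
      by (intro power_mono) auto
    then show "(\<Sum>e\<in>F. (norm (R e - T e))\<^sup>2) \<le> (hs_dist R S + hs_dist S T)\<^sup>2"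
      unfolding L2_set_def by (simp add: sum_nonneg)
  qed
  then show ?thesis
    unfolding hs_dist_def[of R T] hs_norm_def by (intro real_le_lsqrt add_nonneg_nonneg nn)
qed

lemma hs_dist_eq_0:
  fixes S T :: "'a::chilbert_space \<Rightarrow> 'a"
  assumes S: "S \<in> sa_hilbert_schmidt" and T: "T \<in> sa_hilbert_schmidt" and 0: "hs_dist S T = 0"
  shows "S = T"
proof
  fix x
  have "(\<lambda>e. (norm (S e - T e))\<^sup>2) summable_on some_basis"
    using S T hilbert_schmidt_diff_summable unfolding sa_hilbert_schmidt_def by blast
  then have "S e = T e" if "e \<in> some_basis" for e
    using 0 that nonneg_infsum_le_0D[of "\<lambda>e. (norm (S e - T e))\<^sup>2" some_basis e]
    by (simp add: hs_dist_def hs_norm_def)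
  moreover have "cinner e (S x) = cinner (S e) x" "cinner e (T x) = cinner (T e) x" for e
    using S T self_adjoint_total unfolding sa_hilbert_schmidt_def by blast+
  ultimately have "S x - T x = 0"
    by (intro orthonormal_basis_total[OF some_basis]) (simp add: cinner_diff_right)
  then show "S x = T x" by simp
qed

lemma Metric_space_hs:
  "Metric_space (sa_hilbert_schmidt :: ('a::chilbert_space \<Rightarrow> 'a) set) hs_dist"
proof
  fix R S T :: "'a \<Rightarrow> 'a"
  show "0 \<le> hs_dist R S"
    unfolding hs_dist_def hs_norm_def by (intro real_sqrt_ge_zero infsum_nonneg) auto
  show "hs_dist R S = hs_dist S R"
    unfolding hs_dist_def hs_norm_def by (simp add: norm_minus_commute)
  assume R: "R \<in> sa_hilbert_schmidt" and S: "S \<in> sa_hilbert_schmidt"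
  show "hs_dist R S = 0 \<longleftrightarrow> R = S"
    using hs_dist_eq_0[OF R S] by (auto simp: hs_dist_def hs_norm_def)
  assume T: "T \<in> sa_hilbert_schmidt"
  show "hs_dist R T \<le> hs_dist R S + hs_dist S T"
    using R S T hs_dist_triangle unfolding sa_hilbert_schmidt_def by blast
qed

end

theory Submission
  imports Defs
begin

text \<open>For a vector \<open>\<phi>\<close> and \<open>\<epsilon> > 0\<close> consider the open condition on \<open>C\<close> that \<open>\<phi>\<close> is, up to
  \<open>\<epsilon>\<close>, a finite sum of vectors \<open>f\<^sub>a\<close> with \<open>(A + C - a) f\<^sub>a\<close> very small compared with the
  separation of the numbers \<open>a\<close>, where \<open>\<parallel>f\<^sub>a\<parallel> < \<epsilon>\<close> unless \<open>a\<close> is away from the essential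
  spectrum. It is dense: by the Weyl-von Neumann argument a small Hilbert-Schmidt
  perturbation turns the spectral pieces of \<open>\<phi>\<close> into eigenvectors, and an eigenvector with
  eigenvalue in the essential spectrum can first be spread evenly over many orthonormal
  approximate eigenvectors with slightly different labels. By Baire's theorem the condition
  holds for generic \<open>C\<close>, all \<open>\<epsilon>\<close> and a dense set of \<open>\<phi>\<close>. Then all spectral measures are
  carried by null sets, and no eigenvalue lies in the essential spectrum, which is the one
  of \<open>A\<close> by Weyl's theorem; so every eigenvalue is discrete, and a vector orthogonal to all
  eigenvectors has a singular continuous spectral measure.

  Spectral measures, the unitary group and spectral projections come from a functional
  calculus for the Cayley transform, whose spectral measures are weak limits of discrete
  Fejer sums.\<close>

section \<open>Geometry of complex Hilbert spaces\<close>

text \<open>The Hilbert-Schmidt norm enters through a count: an interval of length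
  \<open>2 r\<close> cut into pieces of length \<open>1 / n\<close> gives at most
  \<open>2 r n\<close> vectors with residual at most \<open>1 / n\<close>. The bound
  \<open>2 r / n\<close> for the sum of squares tends to 0, while the bound for the plain sum stays
  at \<open>2 r\<close>. The density argument produces exact eigenvectors, the opposite of the
  generic behaviour, so the open conditions must hold for such operators and still exclude them in
  the limit. One scale \<open>s\<close> does this twice. Residuals small compared with
  \<open>s\<close> put almost all spectral mass of \<open>\<phi>\<close> into intervals of total
  length at most \<open>2 \<epsilon>\<close>, which excludes an absolutely continuous part. Labels
  \<open>2 s\<close> apart leave at most one \<open>f a\<close> near a given eigenvalue, so an
  eigenvector overlaps with \<open>\<phi>\<close> by little more than the norm of that piece; this
  is why pieces near the essential spectrum must be short. Discrete eigenvalues are stable and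
  cannot be removed this way, hence the second set of the statement. Except for the residuals, all
  conditions refer to \<open>A\<close> alone, because the essential spectrum is the same for every
  \<open>C\<close>.\<close>

lemma cinner_add_left: "cinner (x + y) z = cinner x z + cinner y (z::'a::chilbert_space)"
  by (metis cinner_commute cinner_add_right complex_cnj_add)

lemma cinner_scaleC_left: "cinner (c *\<^sub>C x) y = cnj c * cinner x (y::'a::chilbert_space)"
  by (metis cinner_commute cinner_scaleC_right complex_cnj_mult)

lemma cinner_minus_right: "cinner x (- y) = - cinner x (y::'a::chilbert_space)"
  using cinner_diff_right[of x 0 y] by simp

lemma cinner_minus_left: "cinner (- x) y = - cinner x (y::'a::chilbert_space)"
  using cinner_diff_left[of 0 x y] by simp

lemma cinner_sum_right: "cinner x (\<Sum>i\<in>I. f i) = (\<Sum>i\<in>I. cinner x (f i ::'a::chilbert_space))"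
  by (induction I rule: infinite_finite_induct) (auto simp: cinner_add_right)

lemma cinner_sum_left: "cinner (\<Sum>i\<in>I. f i) x = (\<Sum>i\<in>I. cinner (f i ::'a::chilbert_space) x)"
  by (induction I rule: infinite_finite_induct) (auto simp: cinner_add_left)

lemmas cinner_simps = cinner_add_left cinner_add_right cinner_scaleC_left cinner_scaleC_right
  cinner_minus_left cinner_minus_right cinner_diff_left cinner_diff_right

lemma norm_sq_cinner: "(norm x)\<^sup>2 = Re (cinner x (x::'a::chilbert_space))"
  by (simp add: cinner_norm)

lemma norm_scaleC [simp]: "norm (c *\<^sub>C x) = cmod c * norm (x::'a::chilbert_space)"
proof -
  have "(norm (c *\<^sub>C x))\<^sup>2 = Re (cnj c * c * cinner x x)"
    by (simp add: norm_sq_cinner cinner_simps algebra_simps)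
  also have "\<dots> = (cmod c * norm x)\<^sup>2"
    by (simp add: cinner_norm power_mult_distrib complex_norm_square[symmetric]
        mult.commute[of "cnj c"]
        flip: of_real_power of_real_mult)
  finally show ?thesis by simp
qed

lemma norm_add_sq: "(norm (x + y))\<^sup>2 = (norm x)\<^sup>2 + 2 * Re (cinner x y)
    + (norm (y::'a::chilbert_space))\<^sup>2"
proof -
  have "Re (cinner y x) = Re (cinner x y)" by (subst cinner_commute) simp
  then show ?thesis by (simp add: norm_sq_cinner cinner_simps)
qed

lemma norm_diff_sq: "(norm (x - y))\<^sup>2 = (norm x)\<^sup>2 - 2 * Re (cinner x y)
    + (norm (y::'a::chilbert_space))\<^sup>2"
  using norm_add_sq[of x "- y"] by (simp add: cinner_simps)

lemma norm_add_sq_orth: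
  "cinner x y = 0 \<Longrightarrow> (norm (x + y))\<^sup>2 = (norm x)\<^sup>2 + (norm (y::'a::chilbert_space))\<^sup>2"
  by (simp add: norm_add_sq)

lemma parallelogram_law:
  "(norm (x + y))\<^sup>2 + (norm (x - y))\<^sup>2 = 2 * (norm x)\<^sup>2 + 2 * (norm (y::'a::chilbert_space))\<^sup>2"
  by (simp add: norm_add_sq norm_diff_sq)

lemma cinner_cauchy_schwarz: "cmod (cinner x y) \<le> norm x * norm (y::'a::chilbert_space)"
proof (cases "x = 0")
  case False
  define c where "c = cinner x y / complex_of_real ((norm x)\<^sup>2)"
  have nx: "complex_of_real ((norm x)\<^sup>2) \<noteq> 0" using False by simp
  have "cinner x (y - c *\<^sub>C x) = 0"
    using nx by (simp add: cinner_simps cinner_norm c_def del: of_real_power)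
  then have "cinner (c *\<^sub>C x) (y - c *\<^sub>C x) = 0" by (simp add: cinner_scaleC_left)
  then have "(norm y)\<^sup>2 = (norm (c *\<^sub>C x))\<^sup>2 + (norm (y - c *\<^sub>C x))\<^sup>2"
    using norm_add_sq_orth by force
  then have "(cmod c * norm x)\<^sup>2 \<le> (norm y)\<^sup>2" by simp
  then have "cmod c * norm x \<le> norm y" by (simp add: power2_le_iff_abs_le)
  moreover have "cmod c * norm x = cmod (cinner x y) / norm x"
    using False by (simp add: c_def norm_divide norm_mult power2_eq_square)
  ultimately have "cmod (cinner x y) / norm x \<le> norm y" by linarith
  then show ?thesis using False by (simp add: field_simps)
qed simp

lemma bounded_bilinear_cinner: "bounded_bilinear (cinner :: 'a::chilbert_space \<Rightarrow> 'a \<Rightarrow> complex)"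
proof
  show "\<exists>K. \<forall>a b. cmod (cinner a b) \<le> norm a * norm (b::'a) * K"
    using cinner_cauchy_schwarz by (intro exI[of _ 1]) auto
qed (auto simp: cinner_simps scaleR_scaleC scaleR_conv_of_real)

lemma bounded_bilinear_scaleC:
  "bounded_bilinear (scaleC :: complex \<Rightarrow> 'a \<Rightarrow> 'a::chilbert_space)"
proof
  show "\<exists>K. \<forall>a b. norm (a *\<^sub>C (b::'a)) \<le> norm a * norm b * K"
    by (intro exI[of _ 1]) auto
qed (auto simp: scaleC_add_right scaleC_add_left scaleR_scaleC scaleC_scaleC scaleR_conv_of_real
    mult.commute)

lemmas tendsto_cinner [tendsto_intros] = bounded_bilinear.tendsto[OF bounded_bilinear_cinner]
lemmas tendsto_scaleC [tendsto_intros] = bounded_bilinear.tendsto[OF bounded_bilinear_scaleC]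

lemma clinearI:
  assumes "\<And>x y. T (x + y) = T x + T y" "\<And>c x. T (c *\<^sub>C x) = c *\<^sub>C T (x::'a::chilbert_space)"
  shows "clinear T"
  by unfold_locales (use assms in \<open>auto simp: scaleC_add_right scaleC_add_left scaleC_scaleC
      scaleC_one\<close>)

lemma clinear_add: "clinear T \<Longrightarrow> T (x + y) = T x + T (y::'a::chilbert_space)"
  by (simp add: linear_iff_module_hom module_hom.add)

lemma clinear_scaleC: "clinear T \<Longrightarrow> T (c *\<^sub>C x) = c *\<^sub>C T (x::'a::chilbert_space)"
  by (simp add: linear_iff_module_hom module_hom.scale)

lemma clinear_0: "clinear T \<Longrightarrow> T 0 = (0::'a::chilbert_space)"
  using clinear_scaleC[of T 0 0] by simp

lemma clinear_diff: "clinear T \<Longrightarrow> T (x - y) = T x - T (y::'a::chilbert_space)"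
  using clinear_add[of T "x - y" y] by simp

lemma clinear_sum: "clinear T \<Longrightarrow> T (\<Sum>i\<in>I. f i) = (\<Sum>i\<in>I. T (f i ::'a::chilbert_space))"
  by (induction I rule: infinite_finite_induct) (auto simp: clinear_add clinear_0)

text \<open>Polarization: norms of sums determine the real part of the inner product, and
  multiplying \<open>x\<close> by the imaginary unit gives the imaginary part.\<close>

lemma clinear_isometry_cinner:
  fixes T S :: "'a::chilbert_space \<Rightarrow> 'a"
  assumes "clinear T" "\<And>x. norm (T x) = norm x"
  shows "cinner (T x) (T y) = cinner x y"
proof -
  have *: "Re (cinner (T u) (T v)) = Re (cinner u v)" for u v
  proof -
    have "norm (T u + T v) = norm (u + v)" by (metis assms clinear_add)
    then show ?thesis using norm_add_sq[of "T u" "T v"] norm_add_sq[of u v] assms(2) by simp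
  qed
  have "Im (cinner (T x) (T y)) = Im (cinner x y)"
    using *[of "\<i> *\<^sub>C x" y] by (simp add: clinear_scaleC[OF assms(1)] cinner_simps)
  then show ?thesis using * by (simp add: complex_eq_iff)
qed

lemma closure_sequenceE:
  assumes "x \<in> closure (M::'a::metric_space set)"
  obtains f where "\<And>n. f n \<in> M" "f \<longlonglongrightarrow> x"
  using assms closure_sequential[of x M] by metis

lemma closure_csubspace:
  assumes "cvec.subspace (M::'a::chilbert_space set)"
  shows "cvec.subspace (closure M)"
proof (rule cvec.subspaceI)
  show "0 \<in> closure M"
    using cvec.subspace_0[OF assms] closure_subset by blast
  show "x + y \<in> closure M" if xy: "x \<in> closure M" "y \<in> closure M" for x y
  proof -
    obtain f where "\<And>n. f n \<in> M" "f \<longlonglongrightarrow> x"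
      using closure_sequenceE[OF xy(1)] by blast
    moreover obtain g where "\<And>n. g n \<in> M" "g \<longlonglongrightarrow> y"
      using closure_sequenceE[OF xy(2)] by blast
    ultimately show ?thesis unfolding closure_sequential
      using cvec.subspace_add[OF assms] by (intro exI[of _ "\<lambda>n. f n
          + g n"]) (auto intro: tendsto_add)
  qed
  show "c *\<^sub>C x \<in> closure M" if x: "x \<in> closure M" for c x
  proof -
    obtain f where "\<And>n. f n \<in> M" "f \<longlonglongrightarrow> x"
      using closure_sequenceE[OF x] by blast
    then show ?thesis unfolding closure_sequential
      using cvec.subspace_scale[OF assms]
      by (intro exI[of _ "\<lambda>n. c *\<^sub>C f n"]) (auto intro: tendsto_intros)
  qed
qed

text \<open>A minimizing sequence for the distance from \<open>x\<close> to \<open>M\<close> is Cauchy by the parallelogram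
  law.\<close>

lemma orthogonal_projection_exists:
  assumes M: "cvec.subspace (M::'a::chilbert_space set)" and cl: "closed M"
  obtains m where "m \<in> M" "\<And>y. y \<in> M \<Longrightarrow> cinner y (x - m) = 0"
proof -
  define d where "d = Inf ((\<lambda>m. (norm (x - m))\<^sup>2) ` M)"
  have M0: "0 \<in> M" using cvec.subspace_0[OF M] .
  have bdd: "bdd_below ((\<lambda>m. (norm (x - m))\<^sup>2) ` M)" by (intro bdd_belowI[of _ 0]) auto
  have dle: "d \<le> (norm (x - m))\<^sup>2" if "m \<in> M" for m
    unfolding d_def using that bdd by (intro cInf_lower) auto
  have "\<exists>m\<in>M. (norm (x - m))\<^sup>2 < d + inverse (real (Suc n))" for n
    using cInf_lessD[of "(\<lambda>m. (norm (x - m))\<^sup>2) ` M" "d + inverse (real (Suc n))"] M0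
    unfolding d_def by auto
  then obtain m where mM: "\<And>n. m n \<in> M"
    and md: "\<And>n. (norm (x - m n))\<^sup>2 < d + inverse (real (Suc n))" by metis
  have half: "(1/2) *\<^sub>R (a + b) \<in> M" if "a \<in> M" "b \<in> M" for a b
    using that M by (simp add: scaleR_scaleC cvec.subspace_add cvec.subspace_scale)
  have diff: "(norm (m i - m j))\<^sup>2 \<le> 2 * inverse (real (Suc i)) + 2 * inverse (real (Suc j))"
      for i j
  proof -
    have "(norm ((x - m i) + (x - m j)))\<^sup>2 + (norm ((x - m i) - (x - m j)))\<^sup>2
        = 2 * (norm (x - m i))\<^sup>2 + 2 * (norm (x - m j))\<^sup>2"
      by (rule parallelogram_law)
    moreover have "(x - m i) + (x - m j) = 2 *\<^sub>R (x - (1/2) *\<^sub>R (m i + m j))"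
      by (simp add: algebra_simps scaleR_2)
    moreover have "(norm (x - (1/2) *\<^sub>R (m i + m j)))\<^sup>2 \<ge> d" using half mM dle by blast
    ultimately have "(norm (m j - m i))\<^sup>2 \<le> 2 * (norm (x - m i))\<^sup>2 + 2 * (norm (x - m j))\<^sup>2 - 4 * d"
      by (simp add: power_mult_distrib)
    then show ?thesis using md[of i] md[of j] by (simp add: norm_minus_commute)
  qed
  have "Cauchy m"
  proof (rule CauchyI)
    fix e :: real assume e: "e > 0"
    obtain N where N: "inverse (real (Suc N)) < e\<^sup>2 / 4"
      using reals_Archimedean[of "e\<^sup>2 / 4"] e by auto
    show "\<exists>N. \<forall>i\<ge>N. \<forall>j\<ge>N. norm (m i - m j) < e"
    proof (intro exI allI impI)
      fix i j assume ij: "i \<ge> N" "j \<ge> N"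
      have "inverse (real (Suc i)) \<le> inverse (real (Suc N))" "inverse (real (Suc j))
          \<le> inverse (real (Suc N))"
        using ij by (simp_all add: field_simps)
      then have "(norm (m i - m j))\<^sup>2 < e\<^sup>2" using diff[of i j] N by linarith
      then show "norm (m i - m j) < e" using e by (simp add: power2_less_imp_less)
    qed
  qed
  then obtain l where l: "m \<longlonglongrightarrow> l" using Cauchy_convergent convergent_def by blast
  have lM: "l \<in> M" using cl mM l closed_sequentially by blast
  have "(\<lambda>n. (norm (x - m n))\<^sup>2) \<longlonglongrightarrow> (norm (x - l))\<^sup>2" by (intro tendsto_intros l)
  moreover have "(\<lambda>n. d + inverse (real (Suc n))) \<longlonglongrightarrow> d + 0"
    by (intro tendsto_intros LIMSEQ_inverse_real_of_nat)
  ultimately have ld: "(norm (x - l))\<^sup>2 \<le> d"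
    using md by (intro LIMSEQ_le[where X="\<lambda>n. (norm (x - m n))\<^sup>2"]) (auto intro: less_imp_le)
  have "cinner y (x - l) = 0" if y: "y \<in> M" for y
  proof (rule ccontr)
    assume nz: "cinner y (x - l) \<noteq> 0"
    then have y0: "y \<noteq> 0" by auto
    define c where "c = cinner y (x - l) / complex_of_real ((norm y)\<^sup>2)"
    have "cinner y ((x - l) - c *\<^sub>C y) = 0"
      using y0 by (simp add: cinner_diff_right cinner_scaleC_right cinner_norm c_def
          del: of_real_power)
    then have "(norm (c *\<^sub>C y + ((x - l) - c *\<^sub>C y)))\<^sup>2 = (norm (c *\<^sub>C y))\<^sup>2
        + (norm ((x - l) - c *\<^sub>C y))\<^sup>2"
      by (intro norm_add_sq_orth) (simp add: cinner_scaleC_left)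
    moreover have "(norm (x - (l + c *\<^sub>C y)))\<^sup>2 \<ge> d"
      using y lM M by (intro dle) (simp add: cvec.subspace_add cvec.subspace_scale)
    moreover have "x - (l + c *\<^sub>C y) = (x - l) - c *\<^sub>C y" by simp
    ultimately have "(norm (c *\<^sub>C y))\<^sup>2 \<le> 0" using ld
      by (metis add.commute add_le_same_cancel1 diff_add_cancel order_trans)
    then show False using nz y0 by (simp add: c_def)
  qed
  with lM that show thesis by blast
qed

text \<open>The difference between \<open>x\<close> and its projection onto the closure of
  \<open>M\<close> is orthogonal to \<open>M\<close>. The density claim of the theorem is reached
  through this criterion.\<close>

lemma dense_subspaceI:
  assumes M: "cvec.subspace (M::'a::chilbert_space set)"
    and orth: "\<And>x. (\<And>y. y \<in> M \<Longrightarrow> cinner y x = 0) \<Longrightarrow> x = 0"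
  shows "closure M = UNIV"
proof -
  have "x \<in> closure M" for x
  proof -
    obtain m where m: "m \<in> closure M" "\<And>y. y \<in> closure M \<Longrightarrow> cinner y (x - m) = 0"
      using orthogonal_projection_exists[OF closure_csubspace[OF M]] by blast
    then have "x - m = 0" using orth closure_subset by blast
    then show ?thesis using m by simp
  qed
  then show ?thesis by blast
qed

lemma orth_dense_imp_zero:
  assumes "closure M = UNIV" "\<And>y. y \<in> M \<Longrightarrow> cinner y x = 0"
  shows "x = (0::'a::chilbert_space)"
proof -
  obtain f where f: "\<And>n. f n \<in> M" "f \<longlonglongrightarrow> x"
    using closure_sequenceE[of x M] assms(1) by auto
  have "(\<lambda>n. cinner (f n) x) \<longlonglongrightarrow> cinner x x" by (intro tendsto_intros f)
  then have "(\<lambda>n. 0::complex) \<longlonglongrightarrow> cinner x x" using assms(2) f by simp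
  then have "cinner x x = 0" using LIMSEQ_unique[OF _ tendsto_const] by blast
  then show ?thesis by simp
qed

subsection \<open>Orthonormal families\<close>

text \<open>By Pythagoras the Fourier sum over \<open>F\<close> beats every other vector of the
  span. Hence an approximation by finitely many basis vectors stays good for all larger finite
  subsets, as \<open>has_sum\<close> demands in \<open>basis_expansion\<close>.\<close>

lemma corthonormal_best_approx:
  fixes F :: "'a::chilbert_space set"
  assumes on: "corthonormal F" and F: "finite F" and p: "p \<in> cvec.span F"
  shows "norm (x - (\<Sum>e\<in>F. cinner e x *\<^sub>C e)) \<le> norm (x - p)"
proof -
  define q where "q = (\<Sum>e\<in>F. cinner e x *\<^sub>C e)"
  have "cinner f (x - q) = 0" if "f \<in> F" for f
  proof -
    have "cinner f q = (\<Sum>e\<in>F. if f = e then cinner e x else 0)"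
      unfolding q_def cinner_sum_right using on that
      by (intro sum.cong refl) (auto simp: corthonormal_def cinner_scaleC_right)
    then show ?thesis using F that by (simp add: cinner_diff_right)
  qed
  moreover have "cvec.subspace {y. cinner y (x - q) = 0}"
    by (rule cvec.subspaceI) (auto simp: cinner_add_left cinner_scaleC_left)
  ultimately have "cvec.span F \<subseteq> {y. cinner y (x - q) = 0}" by (intro cvec.span_minimal) auto
  moreover have "q - p \<in> cvec.span F" unfolding q_def
    by (intro cvec.span_diff cvec.span_sum cvec.span_scale p cvec.span_base)
  ultimately have "cinner (q - p) (x - q) = 0" by blast
  from norm_add_sq_orth[OF this]
  have "(norm (x - p))\<^sup>2 = (norm (q - p))\<^sup>2 + (norm (x - q))\<^sup>2" by simp
  then have "(norm (x - q))\<^sup>2 \<le> (norm (x - p))\<^sup>2" by simp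
  then show ?thesis unfolding q_def[symmetric] by (rule power2_le_imp_le) simp
qed

lemma basis_expansion:
  fixes B :: "'a::chilbert_space set"
  assumes B: "orthonormal_basis B"
  shows "((\<lambda>e. cinner e x *\<^sub>C e) has_sum x) B"
  unfolding has_sum_def tendsto_iff eventually_finite_subsets_at_top
proof (intro allI impI)
  fix \<epsilon> :: real assume \<epsilon>: "\<epsilon> > 0"
  have "closure (cvec.span B) = UNIV"
    using orthonormal_basis_total[OF B] cvec.span_base by (intro dense_subspaceI) blast+
  then obtain p where p: "p \<in> cvec.span B" "dist p x < \<epsilon>"
    using \<epsilon> closure_approachable[of x "cvec.span B"] by auto
  then obtain X r where X: "finite X" "X \<subseteq> B" "p = (\<Sum>a\<in>X. r a *\<^sub>C a)"
    unfolding cvec.span_explicit by blast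
  then have pX: "p \<in> cvec.span X"
    by (auto intro: cvec.span_sum cvec.span_scale cvec.span_base)
  show "\<exists>X. finite X \<and> X \<subseteq> B \<and>
      (\<forall>Y. finite Y \<and> X \<subseteq> Y \<and> Y \<subseteq> B \<longrightarrow> dist (sum (\<lambda>e. cinner e x *\<^sub>C e) Y) x < \<epsilon>)"
  proof (rule exI[of _ X], intro conjI allI impI X(1,2))
    fix Y assume Y: "finite Y \<and> X \<subseteq> Y \<and> Y \<subseteq> B"
    then have "corthonormal Y" using B unfolding orthonormal_basis_def corthonormal_def by blast
    moreover have "p \<in> cvec.span Y" using pX Y cvec.span_mono by blast
    ultimately have "norm (x - (\<Sum>e\<in>Y. cinner e x *\<^sub>C e)) \<le> norm (x - p)"
      using Y by (intro corthonormal_best_approx) auto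
    then show "dist (\<Sum>e\<in>Y. cinner e x *\<^sub>C e) x < \<epsilon>"
      using p(2) by (simp add: dist_norm norm_minus_commute)
  qed
qed

lemma parseval_cinner:
  fixes B :: "'a::chilbert_space set"
  assumes B: "orthonormal_basis B"
  shows "((\<lambda>e. cinner y e * cinner e x) has_sum cinner y x) B"
proof -
  have "((\<lambda>e. cinner y (cinner e x *\<^sub>C e)) has_sum cinner y x) B"
    by (rule has_sum_bounded_linear[OF _ basis_expansion[OF B]])
       (rule bounded_bilinear.bounded_linear_right[OF bounded_bilinear_cinner])
  then show ?thesis by (simp add: cinner_scaleC_right mult.commute)
qed

lemma parseval:
  fixes B :: "'a::chilbert_space set"
  assumes B: "orthonormal_basis B"
  shows "((\<lambda>e. (cmod (cinner e x))\<^sup>2) has_sum (norm x)\<^sup>2) B"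
proof -
  have "((\<lambda>e. Re (cinner x e * cinner e x)) has_sum Re (cinner x x)) B"
    by (rule has_sum_bounded_linear[OF bounded_linear_Re parseval_cinner[OF B]])
  moreover have "Re (cinner x e * cinner e x) = (cmod (cinner e x))\<^sup>2" for e
    by (subst cinner_commute[of x e]) (simp add: complex_norm_square[symmetric] mult.commute
        flip: of_real_power)
  ultimately show ?thesis by (simp add: norm_sq_cinner)
qed

section \<open>Self-adjoint operators and their Cayley transform\<close>

text \<open>Density of the domain makes the representing vector unique, so the definite description
  in \<open>adjoint_of\<close> can be evaluated.\<close>

lemma adjoint_of_eq_SomeI:
  fixes A :: "'a::chilbert_space \<rightharpoonup> 'a"
  assumes "closure (dom A) = UNIV" "\<And>x. x \<in> dom A \<Longrightarrow> cinner y (the (A x)) = cinner z x"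
  shows "adjoint_of A y = Some z"
proof -
  have uniq: "z' = z" if "\<forall>x\<in>dom A. cinner y (the (A x)) = cinner z' x" for z'
  proof -
    have "cinner x (z' - z) = 0" if "x \<in> dom A" for x
      using assms(2)[OF that] \<open>\<forall>x\<in>dom A. cinner y (the (A x)) = cinner z' x\<close> that
      by (metis cinner_commute cinner_diff_right diff_self)
    then have "z' - z = 0" by (rule orth_dense_imp_zero[OF assms(1)])
    then show ?thesis by simp
  qed
  have "(THE z. \<forall>x\<in>dom A. cinner y (the (A x)) = cinner z x) = z"
    using assms(2) uniq by (intro the_equality) auto
  then show ?thesis unfolding adjoint_of_def using assms(2) by auto
qed

lemma adjoint_of_SomeD:
  fixes A :: "'a::chilbert_space \<rightharpoonup> 'a"
  assumes "closure (dom A) = UNIV" "adjoint_of A y = Some z" "x \<in> dom A"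
  shows "cinner y (the (A x)) = cinner z x"
proof -
  obtain w where w: "\<forall>x\<in>dom A. cinner y (the (A x)) = cinner w x"
    using assms(2) unfolding adjoint_of_def by (auto split: if_splits)
  have "adjoint_of A y = Some w" by (rule adjoint_of_eq_SomeI[OF assms(1)]) (use w in blast)
  then show ?thesis using w assms by auto
qed

locale self_adjoint_operator =
  fixes A :: "'a::chilbert_space \<rightharpoonup> 'a"
  assumes sa: "self_adjoint A"
begin

definition D :: "'a set" where "D = dom A"
definition op :: "'a \<Rightarrow> 'a" where "op x = the (A x)"

lemma D_subspace: "cvec.subspace D" and D_dense: "closure D = UNIV"
  and op_add: "x \<in> D \<Longrightarrow> y \<in> D \<Longrightarrow> op (x + y) = op x + op y"
  and op_scale: "x \<in> D \<Longrightarrow> op (c *\<^sub>C x) = c *\<^sub>C op x"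
  using sa unfolding self_adjoint_def densely_defined_operator_def D_def op_def by auto

lemma D_add [intro]: "x \<in> D \<Longrightarrow> y \<in> D \<Longrightarrow> x + y \<in> D"
  and D_scale [intro]: "x \<in> D \<Longrightarrow> c *\<^sub>C x \<in> D"
  and D_0 [intro, simp]: "0 \<in> D"
  and D_diff [intro]: "x \<in> D \<Longrightarrow> y \<in> D \<Longrightarrow> x - y \<in> D"
  and D_sum [intro]: "(\<And>i. i \<in> I \<Longrightarrow> f i \<in> D) \<Longrightarrow> (\<Sum>i\<in>I. f i) \<in> D"
  by (rule cvec.subspace_add[OF D_subspace] cvec.subspace_scale[OF D_subspace]
      cvec.subspace_0[OF D_subspace] cvec.subspace_diff[OF D_subspace] cvec.subspace_sum[OF
          D_subspace];
      assumption)+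

lemma A_eq_Some_iff: "A x = Some y \<longleftrightarrow> x \<in> D \<and> op x = y"
  unfolding D_def op_def by auto

lemma op_0 [simp]: "op 0 = 0"
  using op_scale[of 0 0] by simp

lemma op_diff: "x \<in> D \<Longrightarrow> y \<in> D \<Longrightarrow> op (x - y) = op x - op y"
  using op_add[of "x - y" y] D_diff[of x y] by (simp add: algebra_simps)

lemma op_sum: "(\<And>i. i \<in> I \<Longrightarrow> f i \<in> D) \<Longrightarrow> op (\<Sum>i\<in>I. f i) = (\<Sum>i\<in>I. op (f i))"
  by (induction I rule: infinite_finite_induct) (auto simp: op_add D_sum)

lemma op_symmetric: "x \<in> D \<Longrightarrow> y \<in> D \<Longrightarrow> cinner (op x) y = cinner x (op y)"
  using adjoint_of_SomeD[of A x "op x" y] sa D_dense unfolding self_adjoint_def D_def op_def by auto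

text \<open>The half of self-adjointness that goes beyond symmetry: the adjoint has no larger
  domain. Membership in \<open>D\<close> is always derived from it, directly or through
  \<open>R\<close>.\<close>

lemma op_maximal:
  assumes "\<And>x. x \<in> D \<Longrightarrow> cinner y (op x) = cinner z x"
  shows "y \<in> D \<and> op y = z"
proof -
  have "adjoint_of A y = Some z"
    by (rule adjoint_of_eq_SomeI) (use assms D_dense D_def op_def in auto)
  then have "A y = Some z" using sa unfolding self_adjoint_def by simp
  then show ?thesis by (simp add: A_eq_Some_iff)
qed

lemma op_closed:
  assumes x: "\<And>n. x n \<in> D" "x \<longlonglongrightarrow> l" and y: "(\<lambda>n. op (x n)) \<longlonglongrightarrow> m"
  shows "l \<in> D \<and> op l = m"
proof (rule op_maximal)
  fix z assume z: "z \<in> D"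
  have "(\<lambda>n. cinner (x n) (op z)) \<longlonglongrightarrow> cinner l (op z)" by (intro tendsto_intros x)
  moreover have "(\<lambda>n. cinner (op (x n)) z) \<longlonglongrightarrow> cinner m z" by (intro tendsto_intros y)
  ultimately show "cinner l (op z) = cinner m z"
    using op_symmetric[OF x(1) z] LIMSEQ_unique by fastforce
qed

text \<open>The cross term vanishes because \<open>op - r\<close> is symmetric and so has a real
  quadratic form. Closed range, injectivity of non-real shifts and the isometry of the Cayley
  transform all come from this identity.\<close>

lemma norm_op_shift_sq:
  assumes "x \<in> D"
  shows "(norm (op x - complex_of_real r *\<^sub>C x - (\<i> * complex_of_real t) *\<^sub>C x))\<^sup>2
    = (norm (op x - complex_of_real r *\<^sub>C x))\<^sup>2 + t\<^sup>2 * (norm x)\<^sup>2"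
proof -
  let ?y = "op x - complex_of_real r *\<^sub>C x"
  have "cinner ?y x = cinner x ?y"
    using op_symmetric[OF assms assms] by (simp add: cinner_simps)
  then have "Im (cinner ?y x) = 0"
    using cinner_commute[of ?y x] by (metis Reals_cnj_iff complex_is_Real_iff)
  then have "Re (cinner ?y ((\<i> * complex_of_real t) *\<^sub>C x)) = 0"
    by (simp add: cinner_scaleC_right)
  then show ?thesis by (simp add: norm_diff_sq norm_mult power_mult_distrib)
qed

text \<open>A vector orthogonal to the range would be an eigenvector of the adjoint, hence of
  \<open>A\<close>, with a non-real eigenvalue, which \<open>norm_op_shift_sq\<close> forbids; so
  the range is dense. The lower bound \<open>bb\<close> makes preimages of a convergent sequence
  Cauchy, and closedness of \<open>A\<close> finishes.\<close>

lemma op_shift_surj: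
  assumes t: "t \<noteq> 0"
  shows "\<exists>x\<in>D. op x - (\<i> * complex_of_real t) *\<^sub>C x = y"
proof -
  let ?c = "\<i> * complex_of_real t"
  let ?S = "(\<lambda>x. op x - ?c *\<^sub>C x) ` D"
  have bb: "\<bar>t\<bar> * norm x \<le> norm (op x - ?c *\<^sub>C x)" if "x \<in> D" for x
    by (rule power2_le_imp_le) (use norm_op_shift_sq[OF that, of 0 t]
        in \<open>auto simp: power_mult_distrib\<close>)
  have sub: "cvec.subspace ?S"
  proof (rule cvec.subspaceI)
    show "0 \<in> ?S" by (rule image_eqI[of _ _ 0]) auto
    show "u + v \<in> ?S" if uv: "u \<in> ?S" "v \<in> ?S" for u v
    proof -
      obtain a b where "a \<in> D" "b \<in> D" "u = op a - ?c *\<^sub>C a" "v = op b - ?c *\<^sub>C b" using uv by auto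
      then show ?thesis
        by (intro image_eqI[of _ _ "a + b"]) (auto simp: op_add scaleC_add_right)
    qed
    show "c *\<^sub>C u \<in> ?S" if u: "u \<in> ?S" for c u
    proof -
      obtain a where "a \<in> D" "u = op a - ?c *\<^sub>C a" using u by auto
      then show ?thesis
        by (intro image_eqI[of _ _ "c *\<^sub>C a"])
           (auto simp: op_scale cvec.scale_right_diff_distrib mult.commute)
    qed
  qed
  have "closure ?S = UNIV"
  proof (rule dense_subspaceI[OF sub])
    fix v assume v: "\<And>y. y \<in> ?S \<Longrightarrow> cinner y v = 0"
    have "cinner v (op x) = cinner (cnj ?c *\<^sub>C v) x" if "x \<in> D" for x
    proof -
      have "cinner (op x - ?c *\<^sub>C x) v = 0" using v that by blast
      then have "cinner v (op x - ?c *\<^sub>C x) = 0" using cinner_commute[of v] by simp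
      then show ?thesis by (simp add: cinner_simps)
    qed
    then have "v \<in> D" "op v = cnj ?c *\<^sub>C v" using op_maximal by blast+
    then have "(norm (0::'a))\<^sup>2 = (norm (op v))\<^sup>2 + (-t)\<^sup>2 * (norm v)\<^sup>2"
      using norm_op_shift_sq[of v 0 "-t"] by simp
    then have "t\<^sup>2 * (norm v)\<^sup>2 = 0"
      by (metis add_nonneg_eq_0_iff mult_nonneg_nonneg norm_zero power2_minus zero_le_power2
          zero_power2)
    then show "v = 0" using t by simp
  qed
  then have "y \<in> closure ?S" by simp
  then obtain f where f: "\<And>n. f n \<in> ?S" "f \<longlonglongrightarrow> y" using closure_sequenceE by blast
  then obtain x where x: "\<And>n. x n \<in> D" "\<And>n. f n = op (x n) - ?c *\<^sub>C x n" unfolding image_iff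
      by metis
  have "Cauchy x"
  proof (rule CauchyI)
    fix e :: real assume e: "e > 0"
    obtain N where N: "\<And>m n. m \<ge> N \<Longrightarrow> n \<ge> N \<Longrightarrow> norm (f m - f n) < \<bar>t\<bar> * e"
      using LIMSEQ_imp_Cauchy[OF f(2)] CauchyD[of f "\<bar>t\<bar> * e"] e t by auto
    have "norm (x m - x n) < e" if "m \<ge> N" "n \<ge> N" for m n
    proof -
      have "op (x m - x n) - ?c *\<^sub>C (x m - x n) = f m - f n"
        using x by (simp add: op_diff cvec.scale_right_diff_distrib)
      then have "\<bar>t\<bar> * norm (x m - x n) < \<bar>t\<bar> * e"
        using bb[of "x m - x n"] N[OF that] x(1) by (metis D_diff le_less_trans)
      then show ?thesis using t by (simp add: mult_less_cancel_left)
    qed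
    then show "\<exists>N. \<forall>m\<ge>N. \<forall>n\<ge>N. norm (x m - x n) < e" by blast
  qed
  then obtain l where l: "x \<longlonglongrightarrow> l" using Cauchy_convergent convergent_def by blast
  have "(\<lambda>n. f n + ?c *\<^sub>C x n) \<longlonglongrightarrow> y + ?c *\<^sub>C l" by (intro tendsto_intros f l)
  then have "(\<lambda>n. op (x n)) \<longlonglongrightarrow> y + ?c *\<^sub>C l" using x by simp
  then have "l \<in> D \<and> op l = y + ?c *\<^sub>C l" by (rule op_closed[OF x(1) l])
  then show ?thesis by (intro bexI[of _ l]) auto
qed

lemma op_shift_inj:
  assumes "t \<noteq> 0" "x \<in> D" "y \<in> D"
    "op x - (\<i> * complex_of_real t) *\<^sub>C x = op y - (\<i> * complex_of_real t) *\<^sub>C y"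
  shows "x = y"
proof -
  have "op (x - y) - (\<i> * complex_of_real t) *\<^sub>C (x - y) = 0"
    using assms by (simp add: op_diff cvec.scale_right_diff_distrib algebra_simps)
  then have "(norm (op (x - y)))\<^sup>2 + t\<^sup>2 * (norm (x - y))\<^sup>2 = 0"
    using norm_op_shift_sq[of "x - y" 0 t] assms by auto
  then show ?thesis using assms(1) by (simp add: add_nonneg_eq_0_iff)
qed

text \<open>The resolvent at \<open>-\<i>\<close> and the Cayley transform \<open>(A - \<i>)(A + \<i>)\<^sup>-\<^sup>1\<close>.\<close>

definition R :: "'a \<Rightarrow> 'a" where "R y = (SOME x. x \<in> D \<and> op x + \<i> *\<^sub>C x = y)"
definition V :: "'a \<Rightarrow> 'a" where "V y = y - (2 * \<i>) *\<^sub>C R y"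

lemma R_D [intro, simp]: "R y \<in> D" and op_R_aux: "op (R y) + \<i> *\<^sub>C R y = y"
proof -
  have "\<exists>x. x \<in> D \<and> op x + \<i> *\<^sub>C x = y"
    using op_shift_surj[of "-1" y] by auto
  from someI_ex[OF this] show "R y \<in> D" "op (R y) + \<i> *\<^sub>C R y = y" unfolding R_def by blast+
qed

lemma op_R: "op (R y) = y - \<i> *\<^sub>C R y"
  using op_R_aux[of y] by (simp add: algebra_simps)

lemma R_eqI: "x \<in> D \<Longrightarrow> op x + \<i> *\<^sub>C x = y \<Longrightarrow> R y = x"
  using op_shift_inj[of "-1" "R y" x] op_R_aux[of y] by simp

lemma R_op: "x \<in> D \<Longrightarrow> R (op x + \<i> *\<^sub>C x) = x"
  by (rule R_eqI) auto

lemma clinear_R: "clinear R"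
proof (rule clinearI)
  show "R (x + y) = R x + R y" for x y
    by (rule R_eqI) (auto simp: op_add op_R scaleC_add_right)
  show "R (c *\<^sub>C x) = c *\<^sub>C R x" for c x
    by (rule R_eqI) (auto simp: op_scale op_R cvec.scale_right_diff_distrib mult.commute)
qed

lemma clinear_V: "clinear V"
  using clinear_add[OF clinear_R] clinear_scaleC[OF clinear_R]
  by (intro clinearI) (auto simp: V_def scaleC_add_right cvec.scale_right_diff_distrib
      mult.commute algebra_simps)

lemma V_eq: "V y = op (R y) - \<i> *\<^sub>C R y"
proof -
  have "(2 * \<i>) *\<^sub>C R y = \<i> *\<^sub>C R y + \<i> *\<^sub>C R y" by (simp add: scaleC_add_left[symmetric])
  then show ?thesis by (simp add: V_def op_R)
qed

text \<open>\<open>V y\<close> and \<open>y\<close> are the images of \<open>R y\<close> under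
  \<open>A - \<i>\<close> and \<open>A + \<i>\<close>, whose norms agree by
  \<open>norm_op_shift_sq\<close> with \<open>t = 1\<close> and \<open>t = -1\<close>.\<close>

lemma norm_V: "norm (V y) = norm y"
proof -
  have "(norm (V y))\<^sup>2 = (norm (op (R y)))\<^sup>2 + (norm (R y))\<^sup>2"
    using norm_op_shift_sq[of "R y" 0 1] by (simp add: V_eq)
  also have "\<dots> = (norm (op (R y) + \<i> *\<^sub>C R y))\<^sup>2"
    using norm_op_shift_sq[of "R y" 0 "-1"] by simp
  also have "\<dots> = (norm y)\<^sup>2" by (simp add: op_R_aux)
  finally show ?thesis by simp
qed

lemma bij_V: "bij V"
proof (rule bijI)
  show "inj V"
  proof (rule injI)
    fix x y assume "V x = V y"
    then have "norm (x - y) = 0" by (metis clinear_V clinear_diff diff_self norm_V norm_zero)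
    then show "x = y" by simp
  qed
  show "surj V"
    unfolding surj_def
  proof
    fix y
    obtain x where x: "x \<in> D" "op x - \<i> *\<^sub>C x = y" using op_shift_surj[of 1 y] by auto
    then have "V (op x + \<i> *\<^sub>C x) = y" by (simp add: V_eq R_op)
    then show "\<exists>x. y = V x" by metis
  qed
qed

end

section \<open>Spectral measures of unitary operators\<close>

definition zpow :: "('a \<Rightarrow> 'a) \<Rightarrow> int \<Rightarrow> 'a \<Rightarrow> 'a"
  where "zpow V n = (if n \<ge> 0 then V ^^ nat n else inv V ^^ nat (- n))"

lemma zpow_0 [simp]: "zpow V 0 = id"
  by (simp add: zpow_def)

lemma zpow_1 [simp]: "zpow V 1 = V"
  by (simp add: zpow_def)

lemma zpow_Suc:
  assumes "bij V"
  shows "zpow V (n + 1) = V \<circ> zpow V n"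
proof (cases "n \<ge> 0")
  case True
  then have "nat (n + 1) = Suc (nat n)" by simp
  with True show ?thesis by (simp add: zpow_def)
next
  case False
  then obtain m where m: "n = - int (Suc m)" using negD[of n] by auto
  have "V (inv V x) = x" for x using assms by (simp add: bij_is_surj surj_f_inv_f)
  moreover have "nat (- n) = Suc m" "nat (- (n + 1)) = m" "\<not> n \<ge> 0" "n + 1 \<ge> 0 \<Longrightarrow> m = 0"
    using m by auto
  ultimately show ?thesis by (auto simp: zpow_def fun_eq_iff)
qed

lemma zpow_add:
  assumes "bij V"
  shows "zpow V (m + n) = zpow V m \<circ> zpow V n"
proof (induction m rule: int_induct[where k = 0])
  case (step1 i)
  have "zpow V (i + 1 + n) = V \<circ> zpow V (i + n)"
    using zpow_Suc[OF assms, of "i + n"] by (simp add: algebra_simps)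
  then show ?case using step1 zpow_Suc[OF assms, of i] by (simp add: comp_assoc)
next
  case (step2 i)
  have "V (zpow V (i - 1 + n) x) = V (zpow V (i - 1) (zpow V n x))" for x
  proof -
    have "V (zpow V (i - 1 + n) x) = zpow V (i + n) x"
      using zpow_Suc[OF assms, of "i - 1 + n"] by (simp add: algebra_simps)
    also have "\<dots> = zpow V i (zpow V n x)" using step2 by simp
    also have "\<dots> = V (zpow V (i - 1) (zpow V n x))" using zpow_Suc[OF assms, of "i - 1"] by simp
    finally show ?thesis .
  qed
  then show ?case using injD[OF bij_is_inj[OF assms]] by (intro ext) simp
qed simp

locale unitary_operator =
  fixes V :: "'a::chilbert_space \<Rightarrow> 'a"
  assumes lin: "clinear V" and bij: "bij V" and iso: "norm (V x) = norm x"
begin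

lemma lin_inv: "clinear (inv V)"
proof (rule clinearI)
  note surj = surj_f_inv_f[OF bij_is_surj[OF bij]] and inj = inv_f_f[OF bij_is_inj[OF bij]]
  show "inv V (x + y) = inv V x + inv V y" for x y
    by (metis inj surj clinear_add[OF lin])
  show "inv V (c *\<^sub>C x) = c *\<^sub>C inv V x" for c x
    by (metis inj surj clinear_scaleC[OF lin])
qed

lemma iso_inv: "norm (inv V x) = norm x"
  using iso[of "inv V x"] surj_f_inv_f[OF bij_is_surj[OF bij]] by simp

lemma lin_zpow: "clinear (zpow V n)"
proof -
  have "clinear (T ^^ k)" if T: "clinear T" for k and T :: "'a \<Rightarrow> 'a"
    by (induction k) (auto intro!: clinearI simp: clinear_add[OF T] clinear_scaleC[OF T]
        clinear_add clinear_scaleC)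
  then show ?thesis using lin lin_inv by (simp add: zpow_def)
qed

lemma iso_zpow: "norm (zpow V n x) = norm x"
proof -
  have "norm ((T ^^ k) x) = norm x" if "\<And>x. norm (T x) = norm x" for k and T :: "'a \<Rightarrow> 'a"
    by (induction k) (auto simp: that)
  then show ?thesis using iso iso_inv by (simp add: zpow_def)
qed

lemma cinner_zpow: "cinner (zpow V m x) (zpow V n y) = cinner x (zpow V (n - m) y)"
proof -
  have "zpow V n y = zpow V m (zpow V (n - m) y)" using zpow_add[OF bij, of m "n - m"] by simp
  then show ?thesis using clinear_isometry_cinner[OF lin_zpow iso_zpow] by simp
qed

lemma cinner_zpow_minus: "cinner x (zpow V (- n) x) = cnj (cinner x (zpow V n x))"
  using cinner_zpow[of n x 0 x] cinner_commute[of "zpow V n x" x] by simp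

end

text \<open>Orthogonality of the characters of the cyclic group of order \<open>L\<close>; the bound
  leaves 0 as the only multiple of \<open>L\<close>, and otherwise the geometric sum
  vanishes.\<close>

lemma sum_root_of_unity:
  assumes m: "\<bar>m\<bar> < int L"
  shows "(\<Sum>l<L. iexp (of_int m * (2 * pi * real l / real L))) = (if m = 0 then of_nat L else 0)"
proof (cases "m = 0")
  case False
  define z where "z = iexp (2 * pi * of_int m / real L)"
  have L: "L > 0" using m by (cases L) auto
  have z1: "z \<noteq> 1"
  proof
    assume "z = 1"
    then obtain k :: int where "2 * pi * of_int m / real L = of_int (2 * k) * pi"
      unfolding z_def exp_eq_1 by auto
    then have "of_int m = of_int k * real L" using L by (simp add: field_simps)
    then have "m = k * int L" by (metis of_int_eq_iff of_int_mult of_int_of_nat_eq)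
    with m False show False
      by (metis abs_mult abs_of_nat dvd_imp_le_int dvd_triv_right not_less)
  qed
  have "z ^ L = iexp (real L * (2 * pi * of_int m / real L))"
    unfolding z_def by (simp add: exp_of_nat_mult[symmetric] algebra_simps)
  also have "\<dots> = iexp (2 * pi * of_int m)" using L by simp
  also have "\<dots> = 1" by (subst exp_eq_1) (auto intro!: exI[of _ m])
  finally have zL: "z ^ L = 1" .
  have "iexp (of_int m * (2 * pi * real l / real L)) = z ^ l" for l
    unfolding z_def by (simp add: exp_of_nat_mult[symmetric] algebra_simps)
  then have "(\<Sum>l<L. iexp (of_int m * (2 * pi * real l / real L))) = (\<Sum>l<L. z ^ l)" by simp
  also have "\<dots> = 0" using z1 zL by (simp add: geometric_sum)
  finally show ?thesis using False by simp
qed simp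

context unitary_operator
begin

text \<open>A discrete Fejer kernel: the measure with mass \<open>\<parallel>\<Sum>\<^sub>j \<zeta>\<^sup>-\<^sup>j\<^sup>l V\<^sup>j \<psi>\<parallel>\<^sup>2 / (2 N\<^sup>2)\<close> at \<open>2
  \<pi> l / (2 N)\<close>, where \<open>\<zeta>\<close> is a primitive \<open>2 N\<close>-th root of unity, has Fourier coefficients
  \<open>(1 - n / N) (\<psi>, V\<^sup>n \<psi>)\<close> for \<open>0 \<le> n \<le> N\<close>.\<close>

lemma fejer_coefficient:
  fixes \<psi> :: 'a
  assumes N: "N > 0" and n: "n \<le> N"
  defines "\<theta> \<equiv> \<lambda>l. 2 * pi * real l / real (2 * N)"
  defines "w \<equiv> \<lambda>l. (norm (\<Sum>j<N. iexp (- real j * \<theta> l) *\<^sub>C zpow V (int j) \<psi>))\<^sup>2 / (2 * (real N)\<^sup>2)"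
  shows "(\<Sum>l<2*N. complex_of_real (w l) * iexp (real n * \<theta> l))
    = complex_of_real (1 - real n / real N) * cinner \<psi> (zpow V (int n) \<psi>)"
proof -
  define c where "c k = cinner \<psi> (zpow V k \<psi>)" for k
  have expand: "complex_of_real ((norm (\<Sum>j<N. iexp (- real j * \<theta> l) *\<^sub>C zpow V (int j) \<psi>))\<^sup>2) *
      iexp (real n * \<theta> l)
      = (\<Sum>j<N. \<Sum>k<N. iexp (of_int (int n + int j - int k) * \<theta> l) * c (int k - int j))" for l
  proof -
    have e: "cnj (iexp (- real j * \<theta> l)) * iexp (- real k * \<theta> l) * iexp (real n * \<theta> l)
        = iexp (of_int (int n + int j - int k) * \<theta> l)" for j k
      by (simp add: exp_cnj exp_add[symmetric] algebra_simps)
    have "complex_of_real ((norm (\<Sum>j<N. iexp (- real j * \<theta> l) *\<^sub>C zpow V (int j) \<psi>))\<^sup>2)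
      = (\<Sum>j<N. \<Sum>k<N. cnj (iexp (- real j * \<theta> l)) * (iexp (- real k * \<theta> l) * c (int k - int j)))"
      by (simp only: cinner_norm[symmetric] cinner_sum_left cinner_sum_right cinner_scaleC_left
          cinner_scaleC_right cinner_zpow c_def sum_distrib_left)
        (subst sum.swap, rule sum.cong[OF refl], rule sum.cong[OF refl], simp)
    then show ?thesis
      by (simp only: sum_distrib_right e[symmetric]) (simp add: mult_ac)
  qed
  have "(\<Sum>l<2*N. complex_of_real (w l) * iexp (real n * \<theta> l))
     = (\<Sum>l<2*N. (\<Sum>j<N. \<Sum>k<N. iexp (of_int (int n + int j - int k) * \<theta> l) * c (int k - int j))) /
         (2 * (of_nat N)\<^sup>2)"
    unfolding sum_divide_distrib expand[symmetric] w_def by (simp add: sum_divide_distrib)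
  also have "(\<Sum>l<2*N. (\<Sum>j<N. \<Sum>k<N. iexp (of_int (int n + int j - int k) * \<theta> l) * c (int k - int j)))
     = (\<Sum>j<N. \<Sum>k<N. (\<Sum>l<2*N. iexp (of_int (int n + int j - int k) * \<theta> l)) * c (int k - int j))"
    unfolding sum_distrib_right by (subst sum.swap) (rule sum.cong[OF refl], rule sum.swap)
  \<comment> \<open>With \<open>2 N\<close> nodes for \<open>N\<close> vectors there is no aliasing:
    the frequency \<open>n + j - k\<close> stays below \<open>2 N\<close> in absolute value, so only
    \<open>k = n + j\<close> survives.\<close>
  also have "\<dots> = (\<Sum>j<N. \<Sum>k<N. if k = n + j then of_nat (2 * N) * c (int n) else 0)"
  proof (intro sum.cong refl)
    fix j k assume "j \<in> {..<N}" "k \<in> {..<N}"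
    then have "\<bar>int n + int j - int k\<bar> < int (2 * N)" using n by auto
    from sum_root_of_unity[OF this]
    show "(\<Sum>l<2*N. iexp (of_int (int n + int j - int k) * \<theta> l)) * c (int k - int j)
      = (if k = n + j then of_nat (2 * N) * c (int n) else 0)"
      unfolding \<theta>_def by auto
  qed
  \<comment> \<open>The index \<open>n + j\<close> is below \<open>N\<close> for exactly
    \<open>N - n\<close> values of \<open>j\<close>; this is the triangular weight of the Fejer
    kernel.\<close>
  also have "\<dots> = (\<Sum>j<N. if j < N - n then of_nat (2 * N) * c (int n) else 0)"
    by (intro sum.cong refl) auto
  also have "\<dots> = (\<Sum>j<N - n. of_nat (2 * N) * c (int n))"
    by (rule sum.mono_neutral_cong_right) auto
  also have "\<dots> / (2 * (of_nat N)\<^sup>2) = complex_of_real (1 - real n / real N) * c (int n)"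
    using N n by (simp add: field_simps power2_eq_square of_nat_diff)
  finally show ?thesis unfolding c_def .
qed

text \<open>Herglotz's theorem for the positive definite sequence
  \<open>cinner \<psi> (zpow V n \<psi>)\<close>: the discrete Fejer measures are tight, a
  subsequence converges weakly, and the characteristic functions converge along it while the weights
  \<open>1 - n / N\<close> tend to 1.\<close>

lemma spectral_distribution_exists:
  fixes \<psi> :: 'a
  assumes \<psi>: "norm \<psi> = 1"
  shows "\<exists>M. real_distribution M \<and> (\<forall>n. char M (real n) = cinner \<psi> (zpow V (int n) \<psi>))"
proof -
  define \<theta> where "\<theta> m l = 2 * pi * real l / real (2 * Suc m)" for m l
  define w where "w m l = (norm (\<Sum>j<Suc m. iexp (- real j * \<theta> m l) *\<^sub>C zpow V (int j) \<psi>))\<^sup>2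
      / (2 * (real (Suc m))\<^sup>2)" for m l
  define P where "P m = point_measure {..<2 * Suc m} (\<lambda>l. ennreal (w m l))" for m
  define M where "M m = distr (P m) borel (\<theta> m)" for m
  have coeff: "(\<Sum>l<2 * Suc m. complex_of_real (w m l) * iexp (real n * \<theta> m l))
    = complex_of_real (1 - real n / real (Suc m)) * cinner \<psi> (zpow V (int n) \<psi>)" if "n \<le> Suc m"
        for m n
    using fejer_coefficient[of "Suc m" n \<psi>] that unfolding \<theta>_def w_def by simp
  have w0: "w m l \<ge> 0" for m l by (simp add: w_def)
  have one: "(\<Sum>l<2 * Suc m. w m l) = 1" for m
  proof -
    have "(\<Sum>l<2 * Suc m. complex_of_real (w m l)) = 1"
      using coeff[of 0 m] \<psi> by (simp add: cinner_norm)
    then show ?thesis by (metis of_real_eq_1_iff of_real_sum)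
  qed
  have spP: "space (P m) = {..<2 * Suc m}" for m by (simp add: P_def space_point_measure)
  have meas: "\<theta> m \<in> borel_measurable (P m)" for m by (simp add: P_def)
  have prP: "prob_space (P m)" for m
  proof (rule prob_spaceI)
    have "emeasure (P m) (space (P m)) = (\<Sum>l<2 * Suc m. ennreal (w m l))"
      unfolding spP unfolding P_def by (simp add: emeasure_point_measure_finite)
    also have "\<dots> = ennreal (\<Sum>l<2 * Suc m. w m l)" by (rule sum_ennreal) (rule w0)
    finally show "emeasure (P m) (space (P m)) = 1" by (simp only: one ennreal_1)
  qed
  have rd: "real_distribution (M m)" for m
    unfolding M_def by (rule prob_space.real_distribution_distr[OF prP meas])
  have chM: "char (M m) (real n) = complex_of_real (1 - real n / real (Suc m)) * cinner \<psi> (zpow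
      V (int n) \<psi>)"
    if "n \<le> Suc m" for m n
  proof -
    have "char (M m) (real n) = (CLINT l|P m. iexp (real n * \<theta> m l))"
      unfolding char_def M_def by (rule integral_distr[OF meas]) simp
    also have "\<dots> = (\<Sum>l<2 * Suc m. w m l *\<^sub>R iexp (real n * \<theta> m l))"
      unfolding P_def by (rule lebesgue_integral_point_measure_finite) (auto simp: w0)
    also have "\<dots> = (\<Sum>l<2 * Suc m. complex_of_real (w m l) * iexp (real n * \<theta> m l))"
      by (simp add: scaleR_conv_of_real)
    also have "\<dots> = complex_of_real (1 - real n / real (Suc m)) * cinner \<psi> (zpow V (int n) \<psi>)"
      by (rule coeff) (use that in auto)
    finally show ?thesis .
  qed
  have "tight M"
    unfolding tight_def
  proof (intro conjI allI impI rd)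
    fix \<epsilon> :: real assume "\<epsilon> > 0"
    \<comment> \<open>All nodes lie between 0 and \<open>2 * pi\<close>; the left end
      \<open>-1\<close> keeps the node 0 inside the half-open interval used by
      \<open>tight\<close>.\<close>
    have "measure (M m) {-1<..2*pi} = 1" for m
    proof -
      have "\<theta> m l \<in> {-1<..2*pi}" if "l < 2 * Suc m" for l
      proof -
        have "\<theta> m l \<ge> 0" by (simp add: \<theta>_def)
        moreover have "real l \<le> real (2 * Suc m)" using that by linarith
        then have "\<theta> m l \<le> 2 * pi" unfolding \<theta>_def by (simp add: divide_le_eq field_simps
            del: of_nat_Suc of_nat_mult)
        ultimately show ?thesis by auto
      qed
      then have "\<theta> m -` {-1<..2*pi} \<inter> space (P m) = space (P m)" unfolding spP by auto
      then show ?thesis unfolding M_def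
        using measure_distr[OF meas, of "{-1<..2*pi}"] prob_space.prob_space[OF prP] by simp
    qed
    then show "\<exists>a b. a < b \<and> (\<forall>m. 1 - \<epsilon> < measure (M m) {a<..b})"
      using \<open>\<epsilon> > 0\<close> by (intro exI[of _ "-1"] exI[of _ "2*pi"]) (auto intro: less_trans[of _ 0])
  qed
  from tight_imp_convergent_subsubsequence[OF this, of id]
  obtain r \<nu> where r: "strict_mono (r :: nat \<Rightarrow> nat)" "real_distribution \<nu>" "weak_conv_m (M \<circ> r) \<nu>"
    by (auto simp: strict_mono_def)
  have "char \<nu> (real n) = cinner \<psi> (zpow V (int n) \<psi>)" for n
  proof (rule LIMSEQ_unique)
    show "(\<lambda>m. char ((M \<circ> r) m) (real n)) \<longlonglongrightarrow> char \<nu> (real n)"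
      by (rule levy_continuity1) (use r rd in \<open>auto simp: o_def\<close>)
    have "(\<lambda>m. complex_of_real (1 - real n / real (Suc m)) * cinner \<psi> (zpow V (int n) \<psi>))
        \<longlonglongrightarrow> complex_of_real (1 - 0) * cinner \<psi> (zpow V (int n) \<psi>)"
      by (intro tendsto_intros LIMSEQ_Suc[OF lim_const_over_n])
    from LIMSEQ_subseq_LIMSEQ[OF this r(1)]
    have "(\<lambda>m. complex_of_real (1 - real n / real (Suc (r m))) * cinner \<psi> (zpow V (int n) \<psi>))
        \<longlonglongrightarrow> cinner \<psi> (zpow V (int n) \<psi>)" by (simp add: o_def)
    \<comment> \<open>The coefficient formula holds only for \<open>n\<close> up to the number of
      vectors summed, which the subsequence exceeds eventually.\<close>
    moreover have "\<forall>\<^sub>F m in sequentially. complex_of_real (1 - real n / real (Suc (r m))) *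
        cinner \<psi> (zpow V (int n) \<psi>)
        = char ((M \<circ> r) m) (real n)"
      using eventually_ge_at_top[of n]
    proof eventually_elim
      case (elim m)
      then have "n \<le> Suc (r m)" using seq_suble[OF r(1), of m] by linarith
      then show ?case using chM by simp
    qed
    ultimately show "(\<lambda>m. char ((M \<circ> r) m) (real n)) \<longlonglongrightarrow> cinner \<psi> (zpow V (int n) \<psi>)"
      by (rule Lim_transform_eventually)
  qed
  with r(2) show ?thesis by blast
qed

text \<open>Weak limits are taken among probability measures, so a nonzero \<open>\<psi>\<close> is
  normalized and the measure is rescaled by its squared norm. Negative powers follow by
  conjugation.\<close>

lemma spectral_measure_exists:
  fixes \<psi> :: 'a
  shows "\<exists>\<nu>. finite_borel_measure \<nu> \<and> (\<forall>n. (CLINT x|\<nu>. iexp (of_int n * x))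
      = cinner \<psi> (zpow V n \<psi>))"
proof (cases "\<psi> = 0")
  case True
  have "finite_borel_measure (null_measure borel)"
    by (intro finite_borel_measure.intro finite_borel_measure_axioms.intro finite_measureI) auto
  with True show ?thesis by (intro exI[of _ "null_measure borel"]) auto
next
  case False
  define c where "c = norm \<psi>"
  define u where "u = complex_of_real (1 / c) *\<^sub>C \<psi>"
  have c: "c > 0" using False by (simp add: c_def)
  have \<psi>u: "\<psi> = complex_of_real c *\<^sub>C u" using c by (simp add: u_def scaleC_scaleC scaleC_one)
  have "norm u = 1" using c by (simp add: u_def c_def norm_divide)
  then obtain M where M: "real_distribution M" "\<And>n. char M (real n) = cinner u (zpow V (int n) u)"
    using spectral_distribution_exists by blast
  interpret real_distribution M by fact
  define \<nu> where "\<nu> = density M (\<lambda>_. ennreal (c\<^sup>2))"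
  have int: "(CLINT x|\<nu>. f x) = complex_of_real (c\<^sup>2) * (CLINT x|M. f x)"
      if "f \<in> borel_measurable borel" for f
    unfolding \<nu>_def using that by (subst integral_density) (auto simp: scaleR_conv_of_real)
  have "finite_borel_measure \<nu>"
  proof (intro finite_borel_measure.intro finite_borel_measure_axioms.intro finite_measureI)
    show "sets \<nu> = sets borel" by (simp add: \<nu>_def)
    show "emeasure \<nu> (space \<nu>) \<noteq> \<infinity>"
      by (simp add: \<nu>_def emeasure_density nn_integral_cmult ennreal_mult_eq_top_iff)
  qed
  moreover have "(CLINT x|\<nu>. iexp (of_int n * x)) = cinner \<psi> (zpow V n \<psi>)" for n
  proof -
    have "(CLINT x|M. iexp (of_int n * x)) = cinner u (zpow V n u)"
    proof (cases "n \<ge> 0")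
      case True
      then show ?thesis using M(2)[of "nat n"] by (simp add: char_def)
    next
      case False
      then have n: "n = - int (nat (- n))" by simp
      have "(CLINT x|M. iexp (of_int n * x)) = (CLINT x|M. cnj (iexp (real (nat (- n)) * x)))"
        by (subst n) (simp add: exp_cnj)
      also have "\<dots> = cnj (char M (real (nat (-n))))" by (simp add: char_def integral_cnj)
      also have "\<dots> = cinner u (zpow V n u)"
        by (subst (2) n) (simp add: M(2) cinner_zpow_minus)
      finally show ?thesis .
    qed
    then have "(CLINT x|\<nu>. iexp (of_int n * x)) = complex_of_real (c\<^sup>2) * cinner u (zpow V n u)"
      by (subst int) auto
    also have "\<dots> = cinner \<psi> (zpow V n \<psi>)"
      by (subst (1 2) \<psi>u) (simp add: clinear_scaleC[OF lin_zpow] cinner_simps power2_eq_square)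
    finally show ?thesis .
  qed
  ultimately show ?thesis by blast
qed

end

section \<open>Functional calculus for self-adjoint operators\<close>

context finite_borel_measure
begin

lemma integrable_bounded:
  fixes f :: "real \<Rightarrow> 'b::{banach, second_countable_topology}"
  assumes "f \<in> borel_measurable borel" "\<And>x. norm (f x) \<le> K"
  shows "integrable M f"
proof -
  have "f \<in> borel_measurable M" using assms(1) by (simp add: M_is_borel cong: measurable_cong_sets)
  then show ?thesis by (rule integrable_const_bound[rotated]) (use assms(2) in auto)
qed

lemma integral_bounded_convergence:
  fixes F :: "nat \<Rightarrow> real \<Rightarrow> 'b::{banach, second_countable_topology}"
  assumes F: "\<And>n. F n \<in> borel_measurable borel" "\<And>n x. norm (F n x) \<le> K" "\<And>x. (\<lambda>n. F n x) \<longlonglongrightarrow> f x"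
  shows "(\<lambda>n. integral\<^sup>L M (F n)) \<longlonglongrightarrow> integral\<^sup>L M f"
proof (rule integral_dominated_convergence)
  have "f \<in> borel_measurable borel" by (rule borel_measurable_LIMSEQ_metric[OF F(1) F(3)])
  then show "f \<in> borel_measurable M" "\<And>n. F n \<in> borel_measurable M"
    using F(1) by (simp_all add: M_is_borel cong: measurable_cong_sets)
  show "integrable M (\<lambda>_. K)" by simp
qed (use F in auto)

end

section \<open>The Cayley map between the real line and the unit circle without 1\<close>

definition cayley :: "real \<Rightarrow> complex"
  where "cayley x = (complex_of_real x - \<i>) / (complex_of_real x + \<i>)"

lemma real_plus_i_neq_0 [simp]: "complex_of_real x + \<i> \<noteq> 0"
  by (simp add: complex_eq_iff)

lemma of_real_neq_i [simp]: "complex_of_real x \<noteq> \<i>"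
  by (simp add: complex_eq_iff)

lemma norm_cayley [simp]: "cmod (cayley x) = 1"
proof -
  have "cmod (complex_of_real x - \<i>) = cmod (complex_of_real x + \<i>)" by (simp add: cmod_def)
  then show ?thesis by (simp add: cayley_def norm_divide)
qed

lemma cayley_neq_0 [simp]: "cayley x \<noteq> 0"
  using norm_cayley[of x] by (metis norm_zero zero_neq_one)

lemma cnj_cayley: "cnj (cayley x) = inverse (cayley x)"
  using complex_norm_square[of "cayley x"] by (simp add: field_simps)

lemma borel_measurable_cayley_powi [measurable]: "(\<lambda>x. cayley x powi n) \<in> borel_measurable borel"
proof -
  have "continuous_on UNIV (\<lambda>x. cayley x powi n)"
    unfolding cayley_def by (intro continuous_intros) auto
  then show ?thesis by (rule borel_measurable_continuous_onI)
qed

lemma norm_cayley_powi [simp]: "cmod (cayley x powi n) = 1"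
  by (simp add: norm_power_int)

lemma cnj_cayley_powi: "cnj (cayley x powi n) = cayley x powi (- n)"
  by (simp add: cnj_cayley power_int_minus power_int_inverse)

text \<open>On the circle the conjugate of \<open>z\<close> is its inverse, which makes the quotient
  equal to its own conjugate; taking \<open>Re\<close> therefore loses nothing.\<close>

lemma cayley_inverse:
  fixes z :: complex
  assumes "cmod z = 1" "z \<noteq> 1"
  shows "cayley (Re (\<i> * (1 + z) / (1 - z))) = z"
proof -
  define w where "w = \<i> * (1 + z) / (1 - z)"
  have zz: "z * cnj z = 1" using assms(1) complex_norm_square[of z] by simp
  have "1 - z \<noteq> 0" "1 - cnj z \<noteq> 0" using assms(2) by (auto simp: complex_eq_iff)
  then have "cnj w = w" unfolding w_def using zz by (simp add: field_simps)
  then have w: "complex_of_real (Re w) = w" by (metis Reals_cnj_iff of_real_Re)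
  have "w - \<i> = 2 * \<i> * z / (1 - z)" "w + \<i> = 2 * \<i> / (1 - z)"
    unfolding w_def using assms(2) by (simp_all add: field_simps)
  then show ?thesis unfolding cayley_def w_def[symmetric] w using assms(2) by simp
qed

context self_adjoint_operator
begin

sublocale cay: unitary_operator V
  by (rule unitary_operator.intro) (fact clinear_V bij_V norm_V)+

text \<open>Mean ergodic theorem for an operator without fixed vectors. A vector of \<open>D\<close>
  has the form \<open>(\<i> / 2) *\<^sub>C (V y - y)\<close>, so its averages telescope to order
  \<open>1 / N\<close>; averaging does not increase norms, and density of \<open>D\<close> covers
  all \<open>\<psi>\<close>.\<close>

lemma cesaro_V_tendsto_0: "(\<lambda>N. norm ((1 / complex_of_nat (Suc N)) *\<^sub>C (\<Sum>n<Suc N. zpow V (int n)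
    \<psi>))) \<longlonglongrightarrow> 0"
proof (rule LIMSEQ_I)
  let ?T = "\<lambda>N \<psi>. (1 / complex_of_nat (Suc N)) *\<^sub>C (\<Sum>n<Suc N. zpow V (int n) \<psi>)"
  fix \<epsilon> :: real assume \<epsilon>: "\<epsilon> > 0"
  obtain \<xi> where \<xi>: "\<xi> \<in> D" "dist \<xi> \<psi> < \<epsilon> / 2"
    using D_dense closure_approachable[of \<psi> D] half_gt_zero[OF \<epsilon>] by blast
  define y where "y = op \<xi> + \<i> *\<^sub>C \<xi>"
  have \<xi>y: "\<xi> = (\<i> / 2) *\<^sub>C (V y - y)"
    unfolding V_def y_def R_op[OF \<xi>(1)] by (simp add: scaleC_scaleC cvec.scale_minus_right
        scaleC_one)
  have sum\<xi>: "(\<Sum>n<N. zpow V (int n) \<xi>) = (\<i> / 2) *\<^sub>C (zpow V (int N) y - y)" for N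
  proof (induction N)
    case (Suc N)
    have "zpow V (int N) \<xi> = (\<i> / 2) *\<^sub>C (zpow V (int N) (zpow V 1 y) - zpow V (int N) y)"
      by (subst \<xi>y) (simp add: clinear_scaleC[OF cay.lin_zpow] clinear_diff[OF cay.lin_zpow])
    also have "zpow V (int N) (zpow V 1 y) = zpow V (int (Suc N)) y"
      using zpow_add[OF bij_V, of "int N" 1] by (simp add: add.commute)
    finally show ?case using Suc by (simp add: scaleC_add_right[symmetric])
  qed simp
  have T\<xi>: "norm (?T N \<xi>) \<le> norm y / real (Suc N)" for N
  proof -
    have "norm (zpow V (int (Suc N)) y - y) \<le> 2 * norm y"
      using norm_triangle_ineq4[of "zpow V (int (Suc N)) y" y] cay.iso_zpow[of "int (Suc N)" y]
          by simp
    then have "norm (zpow V (int (Suc N)) y - y) / (real (Suc N) * 2)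
        \<le> (2 * norm y) / (real (Suc N) * 2)"
      by (intro divide_right_mono) auto
    then show ?thesis unfolding sum\<xi> by (simp add: norm_divide norm_mult del: of_nat_Suc)
  qed
  have Td: "norm (?T N (\<psi> - \<xi>)) \<le> norm (\<psi> - \<xi>)" for N
  proof -
    have "norm (\<Sum>n<Suc N. zpow V (int n) (\<psi> - \<xi>)) \<le> (\<Sum>n<Suc N. norm (\<psi> - \<xi>))"
      by (rule sum_norm_le) (simp add: cay.iso_zpow)
    then show ?thesis by (simp add: norm_divide field_simps del: of_nat_Suc sum.lessThan_Suc)
  qed
  obtain N0 where "2 * norm y / \<epsilon> < real N0" using reals_Archimedean2 by blast
  then have "2 * norm y < \<epsilon> * real (Suc N0)" using \<epsilon> by (simp add: field_simps
      add_strict_increasing)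
  then have N0: "norm y / real (Suc N0) < \<epsilon> / 2" by (simp add: field_simps)
  show "\<exists>N0. \<forall>N\<ge>N0. norm (norm (?T N \<psi>) - 0) < \<epsilon>"
  proof (intro exI allI impI)
    fix N assume N: "N \<ge> N0"
    have "?T N \<psi> = ?T N (\<psi> - \<xi>) + ?T N \<xi>"
      by (simp only: scaleC_add_right[symmetric] sum.distrib[symmetric] clinear_diff[OF
          cay.lin_zpow] diff_add_cancel)
    then have "norm (?T N \<psi>) \<le> norm (?T N (\<psi> - \<xi>)) + norm (?T N \<xi>)"
      by (metis norm_triangle_ineq)
    also have "\<dots> \<le> norm (\<psi> - \<xi>) + norm y / real (Suc N)" by (intro add_mono Td T\<xi>)
    also have "norm y / real (Suc N) \<le> norm y / real (Suc N0)" using N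
        by (intro divide_left_mono) auto
    finally have "norm (?T N \<psi>) < \<epsilon>"
      using N0 \<xi>(2) unfolding dist_norm norm_minus_commute[of \<xi>] by linarith
    then show "norm (norm (?T N \<psi>) - 0) < \<epsilon>"
      by (simp only: diff_0_right real_norm_def abs_norm_cancel)
  qed
qed

text \<open>By the mean ergodic theorem \<open>1\<close> is not an atom of the spectral measure of the Cayley
  transform, which can therefore be moved to the real line.\<close>

lemma spectral_measure_cayley_exists:
  "\<exists>\<mu>. finite_borel_measure \<mu> \<and> (\<forall>n. (CLINT x|\<mu>. cayley x powi n) = cinner \<psi> (zpow V n \<psi>))"
proof -
  obtain \<nu> where \<nu>: "finite_borel_measure \<nu>"
    and c: "\<And>n. (CLINT x|\<nu>. iexp (of_int n * x)) = cinner \<psi> (zpow V n \<psi>)"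
    using cay.spectral_measure_exists by blast
  interpret finite_borel_measure \<nu> by fact
  have sp: "space \<nu> = UNIV" using M_is_borel sets_eq_imp_space_eq by fastforce
  define Z where "Z = {x. iexp x = 1}"
  have Zm: "Z \<in> sets borel" unfolding Z_def
    by (intro borel_closed closed_Collect_eq continuous_intros)
  \<comment> \<open>The averaged character \<open>s\<close> equals 1 on \<open>Z\<close>, so the
    integral of its squared modulus dominates the mass of \<open>Z\<close>. By the Fourier
    coefficients of \<open>\<nu>\<close> that integral is the squared norm of the Cesaro
    mean.\<close>
  have "measure \<nu> Z \<le> (norm ((1 / complex_of_nat (Suc N)) *\<^sub>C (\<Sum>n<Suc N. zpow V (int n) \<psi>)))\<^sup>2"
      for N
  proof -
    define s where "s x = (1 / complex_of_nat (Suc N)) * (\<Sum>n<Suc N. iexp (of_int (int n) * x))"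
        for x
    have sm: "s \<in> borel_measurable borel" unfolding s_def by measurable
    have sb: "cmod (s x) \<le> 1" for x
    proof -
      have "cmod (\<Sum>n<Suc N. iexp (of_int (int n) * x)) \<le> (\<Sum>n<Suc N. 1)"
        by (rule sum_norm_le) (simp add: norm_exp_eq_Re)
      then show ?thesis unfolding s_def by (simp add: norm_divide norm_mult field_simps
          del: of_nat_Suc sum.lessThan_Suc)
    qed
    have ss: "complex_of_real ((cmod (s x))\<^sup>2) = (1 / complex_of_nat (Suc N))\<^sup>2 *
       (\<Sum>j<Suc N. \<Sum>k<Suc N. iexp (of_int (int k - int j) * x))" for x
    proof -
      have "complex_of_real ((cmod (s x))\<^sup>2) = cnj (s x) * s x"
        by (simp only: complex_norm_square mult.commute)
      also have "\<dots> = (1 / complex_of_nat (Suc N))\<^sup>2 *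
          ((\<Sum>j<Suc N. cnj (iexp (of_int (int j) * x))) * (\<Sum>k<Suc N. iexp (of_int (int k) * x)))"
        unfolding s_def by (simp add: power2_eq_square del: of_nat_Suc sum.lessThan_Suc)
      also have "(\<Sum>j<Suc N. cnj (iexp (of_int (int j) * x))) * (\<Sum>k<Suc N. iexp (of_int (int k) * x))
          = (\<Sum>j<Suc N. \<Sum>k<Suc N. iexp (of_int (int k - int j) * x))"
        unfolding sum_product
        by (intro sum.cong refl) (simp add: exp_cnj exp_add[symmetric] algebra_simps)
      finally show ?thesis .
    qed
    have "complex_of_real (\<integral>x. (cmod (s x))\<^sup>2 \<partial>\<nu>) = (CLINT x|\<nu>. complex_of_real ((cmod (s x))\<^sup>2))"
      by (rule integral_complex_of_real[symmetric])
    also have "\<dots> = (1 / complex_of_nat (Suc N))\<^sup>2 * (\<Sum>j<Suc N. \<Sum>k<Suc N. cinner \<psi> (zpow V (int k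
        - int j) \<psi>))"
    proof -
      have i: "integrable \<nu> (\<lambda>x. iexp (of_int n * x))" for n
        by (rule integrable_bounded[where K=1]) (auto simp: norm_exp_eq_Re)
      show ?thesis
        unfolding ss integral_mult_right_zero
        by (subst Bochner_Integration.integral_sum, intro Bochner_Integration.integrable_sum i,
            subst Bochner_Integration.integral_sum, intro Bochner_Integration.integrable_sum i,
            simp only: c)
    qed
    also have "\<dots> = complex_of_real ((norm ((1 / complex_of_nat (Suc N)) *\<^sub>C (\<Sum>n<Suc N. zpow V
        (int n) \<psi>)))\<^sup>2)"
      unfolding cinner_norm[symmetric] cinner_scaleC_left cinner_scaleC_right cinner_sum_left
          cinner_sum_right
        cay.cinner_zpow by (subst sum.swap, simp add: power2_eq_square
            sum_divide_distrib[symmetric] del: of_nat_Suc sum.lessThan_Suc)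
    finally have eq: "(\<integral>x. (cmod (s x))\<^sup>2 \<partial>\<nu>) = (norm ((1 / complex_of_nat (Suc N)) *\<^sub>C (\<Sum>n<Suc
        N. zpow V (int n) \<psi>)))\<^sup>2"
      by (simp only: of_real_eq_iff)
    have "measure \<nu> Z = (\<integral>x. indicator Z x \<partial>\<nu>)" using Zm sp by (simp add: M_is_borel)
    also have "\<dots> \<le> (\<integral>x. (cmod (s x))\<^sup>2 \<partial>\<nu>)"
    proof (rule integral_mono)
      show "integrable \<nu> (indicator Z :: real \<Rightarrow> real)"
        by (rule integrable_bounded[where K=1]) (use Zm in \<open>auto simp: indicator_def\<close>)
      show "integrable \<nu> (\<lambda>x. (cmod (s x))\<^sup>2)"
        by (rule integrable_bounded[where K=1]) (use sm sb in \<open>auto simp: power_le_one\<close>)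
      fix x
      have "s x = 1" if "x \<in> Z"
      proof -
        have "iexp (of_int (int n) * x) = iexp x ^ n" for n
          by (simp add: exp_of_nat_mult[symmetric] algebra_simps)
        then have "iexp (of_int (int n) * x) = 1" for n using that by (simp add: Z_def)
        then show ?thesis unfolding s_def by (simp del: of_nat_Suc sum.lessThan_Suc)
      qed
      then show "indicator Z x \<le> (cmod (s x))\<^sup>2" by (auto simp: indicator_def)
    qed
    finally show ?thesis using eq by simp
  qed
  then have "measure \<nu> Z \<le> 0\<^sup>2"
    using LIMSEQ_le_const[OF tendsto_power[OF cesaro_V_tendsto_0, where n = 2]] by blast
  then have "emeasure \<nu> Z = 0" using measure_nonneg[of \<nu> Z]
      by (simp add: emeasure_eq_measure measure_le_0_iff)
  then have "AE x in \<nu>. x \<notin> Z" using Zm by (intro AE_not_in null_setsI) (auto simp: M_is_borel)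
  \<comment> \<open>The inverse Cayley map applied to \<open>iexp x\<close>; its denominator
    vanishes only on the null set \<open>Z\<close>.\<close>
  define g where "g x = Re (\<i> * (1 + iexp x) / (1 - iexp x))" for x
  have gm: "g \<in> borel_measurable \<nu>"
    unfolding g_def measurable_cong_sets[OF M_is_borel refl] by measurable
  have "finite_borel_measure (distr \<nu> borel g)"
  proof (intro finite_borel_measure.intro finite_borel_measure_axioms.intro)
    show "finite_measure (distr \<nu> borel g)" by (rule finite_measure_distr[OF gm])
  qed simp
  moreover have "(CLINT x|distr \<nu> borel g. cayley x powi n) = cinner \<psi> (zpow V n \<psi>)" for n
  proof -
    have "(CLINT x|distr \<nu> borel g. cayley x powi n) = (CLINT x|\<nu>. cayley (g x) powi n)"
      by (rule integral_distr[OF gm]) measurable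
    also have "\<dots> = (CLINT x|\<nu>. iexp (of_int n * x))"
    proof (rule integral_cong_AE)
      show "AE x in \<nu>. cayley (g x) powi n = iexp (of_int n * x)"
        using \<open>AE x in \<nu>. x \<notin> Z\<close>
      proof eventually_elim
        case (elim x)
        then have "cayley (g x) = iexp x" unfolding g_def
          by (intro cayley_inverse) (auto simp: Z_def norm_exp_eq_Re)
        then show ?case by (simp add: exp_power_int mult.left_commute)
      qed
      show "(\<lambda>x. cayley (g x) powi n) \<in> borel_measurable \<nu>"
        using measurable_compose[OF gm borel_measurable_cayley_powi] .
      show "(\<lambda>x. iexp (of_int n * x)) \<in> borel_measurable \<nu>"
        unfolding measurable_cong_sets[OF M_is_borel refl] by measurable
    qed
    also have "\<dots> = cinner \<psi> (zpow V n \<psi>)" by (rule c)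
    finally show ?thesis .
  qed
  ultimately show ?thesis by blast
qed

text \<open>Some measure with the right moments is chosen here;
  \<open>spectral_measure_eq_smeas\<close> identifies it with the spectral measure of the
  statement.\<close>

definition smeas :: "'a \<Rightarrow> real measure"
  where "smeas \<psi> = (SOME \<mu>. finite_borel_measure \<mu> \<and>
    (\<forall>n. (CLINT x|\<mu>. cayley x powi n) = cinner \<psi> (zpow V n \<psi>)))"

lemma finite_borel_measure_smeas: "finite_borel_measure (smeas \<psi>)"
  and integral_smeas_cayley: "(CLINT x|smeas \<psi>. cayley x powi n) = cinner \<psi> (zpow V n \<psi>)"
  using someI_ex[OF spectral_measure_cayley_exists] unfolding smeas_def by blast+

sublocale smeas: finite_borel_measure "smeas \<psi>" for \<psi>
  by (rule finite_borel_measure_smeas)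

end

lemma borel_measurable_cnj [measurable (raw)]:
  "f \<in> borel_measurable M \<Longrightarrow> (\<lambda>x. cnj (f x)) \<in> borel_measurable M"
  by (rule borel_measurable_continuous_on[of cnj f]) (auto intro: continuous_intros)

declare complex_cnj_power_int [simp del]

context self_adjoint_operator
begin

text \<open>\<open>fc f T\<close> states that \<open>T = f(A)\<close>; the functions so reached are the bounded Borel
  functions that arise from trigonometric polynomials in the Cayley transform by iterated
  bounded pointwise limits.\<close>

inductive fc :: "(real \<Rightarrow> complex) \<Rightarrow> ('a \<Rightarrow> 'a) \<Rightarrow> bool" where
  fc_powi: "fc (\<lambda>x. cayley x powi n) (zpow V n)"
| fc_add: "fc f T \<Longrightarrow> fc g S \<Longrightarrow> fc (\<lambda>x. f x + g x) (\<lambda>\<psi>. T \<psi> + S \<psi>)"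
| fc_scale: "fc f T \<Longrightarrow> fc (\<lambda>x. c * f x) (\<lambda>\<psi>. c *\<^sub>C T \<psi>)"
| fc_lim: "(\<And>n. fc (F n) (T n)) \<Longrightarrow> (\<And>n x. cmod (F n x) \<le> K) \<Longrightarrow> (\<And>x. (\<lambda>n. F n x) \<longlonglongrightarrow> f x)
    \<Longrightarrow> (\<And>\<psi>. (\<lambda>n. T n \<psi>) \<longlonglongrightarrow> S \<psi>) \<Longrightarrow> fc f S"

lemma fc_measurable: "fc f T \<Longrightarrow> f \<in> borel_measurable borel"
proof (induction rule: fc.induct)
  case (fc_lim F T K f S)
  then show ?case by (intro borel_measurable_LIMSEQ_metric[where f = F and g = f]) auto
qed auto

lemma fc_bounded: "fc f T \<Longrightarrow> \<exists>K. \<forall>x. cmod (f x) \<le> K"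
proof (induction rule: fc.induct)
  case (fc_add f T g S)
  then obtain K L where "\<forall>x. cmod (f x) \<le> K" "\<forall>x. cmod (g x) \<le> L" by blast
  then show ?case by (intro exI[of _ "K + L"]) (auto intro: norm_triangle_le add_mono)
next
  case (fc_scale f T c)
  then obtain K where "\<forall>x. cmod (f x) \<le> K" by blast
  then show ?case by (intro exI[of _ "cmod c * K"]) (auto simp: norm_mult intro: mult_left_mono)
next
  case (fc_lim F T K f S)
  then have "cmod (f x) \<le> K" for x
    by (intro Lim_bounded[OF tendsto_norm[of "\<lambda>n. F n x"], of _ 0]) auto
  then show ?case by blast
qed (auto intro: exI[of _ 1])

lemma fc_clinear: "fc f T \<Longrightarrow> clinear T"
proof (induction rule: fc.induct)
  case (fc_powi n)
  show ?case by (rule cay.lin_zpow)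
next
  case (fc_add f T g S)
  then show ?case
    by (intro clinearI) (auto simp: clinear_add clinear_scaleC scaleC_add_right)
next
  case (fc_scale f T c)
  then show ?case
    by (intro clinearI) (auto simp: clinear_add clinear_scaleC scaleC_add_right scaleC_scaleC
        mult.commute)
next
  case (fc_lim F T K f S)
  have T: "clinear (T n)" for n using fc_lim by blast
  show ?case
  proof (rule clinearI)
    show "S (x + y) = S x + S y" for x y
    proof (rule LIMSEQ_unique)
      show "(\<lambda>n. T n (x + y)) \<longlonglongrightarrow> S (x + y)" by (rule fc_lim)
      show "(\<lambda>n. T n (x + y)) \<longlonglongrightarrow> S x + S y"
        unfolding clinear_add[OF T] by (intro tendsto_add fc_lim)
    qed
    show "S (c *\<^sub>C x) = c *\<^sub>C S x" for c x
    proof (rule LIMSEQ_unique)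
      show "(\<lambda>n. T n (c *\<^sub>C x)) \<longlonglongrightarrow> S (c *\<^sub>C x)" by (rule fc_lim)
      show "(\<lambda>n. T n (c *\<^sub>C x)) \<longlonglongrightarrow> c *\<^sub>C S x"
        unfolding clinear_scaleC[OF T] by (intro tendsto_intros fc_lim)
    qed
  qed
qed

section \<open>Inner products and norms in the functional calculus\<close>

lemma fc_integrable:
  assumes "fc f T" "fc g S"
  shows "integrable (smeas \<psi>) (\<lambda>x. cnj (f x) * g x)"
proof -
  obtain K L where KL: "\<And>x. cmod (f x) \<le> K" "\<And>x. cmod (g x) \<le> L" using fc_bounded assms by meson
  show ?thesis
  proof (rule smeas.integrable_bounded[where K = "K * L"])
    show "(\<lambda>x. cnj (f x) * g x) \<in> borel_measurable borel"
      by (intro borel_measurable_times borel_measurable_cnj fc_measurable[OF assms(1)]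
          fc_measurable[OF assms(2)])
    show "norm (cnj (f x) * g x) \<le> K * L" for x
      using KL[of x] norm_ge_zero[of "f x"] by (simp add: norm_mult) (meson mult_mono
          norm_ge_zero order_trans)
  qed
qed

text \<open>An induction on two derivations at once is avoided: here the left factor is a monomial
  and \<open>g\<close> varies, and \<open>fc_cinner\<close> then fixes \<open>g\<close> and varies
  the left factor. Limits pass by dominated convergence. Both factors act on the same
  \<open>\<psi>\<close>, so the positive measure \<open>smeas \<psi>\<close> is enough and no
  complex measures arise.\<close>

lemma fc_cinner_powi:
  assumes "fc g S"
  shows "cinner (zpow V m \<psi>) (S \<psi>) = (CLINT x|smeas \<psi>. cnj (cayley x powi m) * g x)"
  using assms
proof (induction rule: fc.induct)
  case (fc_powi n)
  have "cnj (cayley x powi m) * cayley x powi n = cayley x powi (n - m)" for x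
    unfolding cnj_cayley_powi by (simp add: power_int_add[symmetric])
  then show ?case by (simp add: cay.cinner_zpow integral_smeas_cayley)
next
  case (fc_add f T g S)
  then show ?case
    by (simp add: cinner_add_right distrib_left Bochner_Integration.integral_add
        fc_integrable[OF fc.fc_powi])
next
  case (fc_scale f T c)
  have "cnj (cayley x powi m) * (c * f x) = c * (cnj (cayley x powi m) * f x)" for x by simp
  then show ?case using fc_scale by (simp only: cinner_scaleC_right integral_mult_right_zero)
next
  case (fc_lim F T K f S)
  show ?case
  proof (rule LIMSEQ_unique)
    show "(\<lambda>n. cinner (zpow V m \<psi>) (T n \<psi>)) \<longlonglongrightarrow> cinner (zpow V m \<psi>) (S \<psi>)"
      by (intro tendsto_intros fc_lim)
    have "(\<lambda>n. CLINT x|smeas \<psi>. cnj (cayley x powi m) * F n x)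
        \<longlonglongrightarrow> (CLINT x|smeas \<psi>. cnj (cayley x powi m) * f x)"
    proof (rule smeas.integral_bounded_convergence[where K = K])
      show "(\<lambda>x. cnj (cayley x powi m) * F n x) \<in> borel_measurable borel" for n
        using fc_lim by (intro borel_measurable_times borel_measurable_cnj
            borel_measurable_cayley_powi fc_measurable[of "F n" "T n"]) auto
      show "norm (cnj (cayley x powi m) * F n x) \<le> K" for n x
        using fc_lim(2)[of n x] by (simp only: norm_mult complex_mod_cnj norm_cayley_powi)
    qed (intro tendsto_intros fc_lim)
    then show "(\<lambda>n. cinner (zpow V m \<psi>) (T n \<psi>)) \<longlonglongrightarrow> (CLINT x|smeas \<psi>. cnj (cayley x powi m) * f x)"
      using fc_lim by simp
  qed
qed

lemma fc_cinner:
  assumes "fc f T" and gS: "fc g S"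
  shows "cinner (T \<psi>) (S \<psi>) = (CLINT x|smeas \<psi>. cnj (f x) * g x)"
  using assms(1)
proof (induction rule: fc.induct)
  case (fc_powi n)
  show ?case by (rule fc_cinner_powi[OF gS])
next
  case (fc_add f1 T1 f2 T2)
  then show ?case
    by (simp add: cinner_add_left distrib_right Bochner_Integration.integral_add
        fc_integrable[OF _ gS])
next
  case (fc_scale f T c)
  then show ?case by (simp add: cinner_scaleC_left mult.assoc)
next
  case (fc_lim F T K f T')
  obtain L where L: "\<And>x. cmod (g x) \<le> L" using fc_bounded[OF gS] by blast
  have K: "0 \<le> K" using fc_lim(2)[of 0 0] norm_ge_zero order_trans by blast
  show ?case
  proof (rule LIMSEQ_unique)
    show "(\<lambda>n. cinner (T n \<psi>) (S \<psi>)) \<longlonglongrightarrow> cinner (T' \<psi>) (S \<psi>)"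
      by (intro tendsto_intros fc_lim)
    have "(\<lambda>n. CLINT x|smeas \<psi>. cnj (F n x) * g x) \<longlonglongrightarrow> (CLINT x|smeas \<psi>. cnj (f x) * g x)"
    proof (rule smeas.integral_bounded_convergence[where K = "K * L"])
      show "(\<lambda>x. cnj (F n x) * g x) \<in> borel_measurable borel" for n
        using fc_lim by (intro borel_measurable_times borel_measurable_cnj fc_measurable[OF gS]
            fc_measurable[of "F n" "T n"]) auto
      show "norm (cnj (F n x) * g x) \<le> K * L" for n x
        using mult_mono[OF fc_lim(2)[of n x] L[of x] K] by (simp add: norm_mult)
    qed (intro tendsto_intros fc_lim)
    then show "(\<lambda>n. cinner (T n \<psi>) (S \<psi>)) \<longlonglongrightarrow> (CLINT x|smeas \<psi>. cnj (f x) * g x)"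
      using fc_lim by simp
  qed
qed

lemma fc_norm_sq:
  assumes "fc f T"
  shows "(norm (T \<psi>))\<^sup>2 = (\<integral>x. (cmod (f x))\<^sup>2 \<partial>smeas \<psi>)"
proof -
  have "complex_of_real ((norm (T \<psi>))\<^sup>2) = (CLINT x|smeas \<psi>. cnj (f x) * f x)"
    unfolding cinner_norm[symmetric] by (rule fc_cinner[OF assms assms])
  also have "\<dots> = (CLINT x|smeas \<psi>. complex_of_real ((cmod (f x))\<^sup>2))"
    by (simp only: complex_norm_square mult.commute)
  also have "\<dots> = complex_of_real (\<integral>x. (cmod (f x))\<^sup>2 \<partial>smeas \<psi>)"
    by (rule integral_complex_of_real)
  finally show ?thesis by (simp only: of_real_eq_iff)
qed

lemma fc_one: "fc (\<lambda>_. 1) (\<lambda>\<psi>. \<psi>)"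
  using fc_powi[of 0] by (simp add: id_def)

lemma fc_const: "fc (\<lambda>_. c) (\<lambda>\<psi>. c *\<^sub>C \<psi>)"
  using fc_scale[OF fc_one, of c] by simp

lemma fc_diff: "fc f T \<Longrightarrow> fc g S \<Longrightarrow> fc (\<lambda>x. f x - g x) (\<lambda>\<psi>. T \<psi> - S \<psi>)"
  using fc_add[of f T "\<lambda>x. -1 * g x" "\<lambda>\<psi>. (-1) *\<^sub>C S \<psi>"] fc_scale[of g S "-1"]
  by (simp add: cvec.scale_minus_left scaleC_one)

lemma smeas_UNIV: "measure (smeas \<psi>) UNIV = (norm \<psi>)\<^sup>2"
  using fc_norm_sq[OF fc_one, of \<psi>] sets_eq_imp_space_eq[OF smeas.M_is_borel] by simp

lemma fc_norm_le:
  assumes "fc f T" "\<And>x. cmod (f x) \<le> K"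
  shows "norm (T \<psi>) \<le> K * norm \<psi>"
proof -
  have K: "0 \<le> K" using assms(2)[of 0] norm_ge_zero order_trans by blast
  have sq: "(cmod (f x))\<^sup>2 \<le> K\<^sup>2" for x using assms(2) by (intro power_mono) auto
  have "(norm (T \<psi>))\<^sup>2 \<le> (\<integral>x. K\<^sup>2 \<partial>smeas \<psi>)"
    unfolding fc_norm_sq[OF assms(1)]
  proof (rule integral_mono)
    show "integrable (smeas \<psi>) (\<lambda>x. (cmod (f x))\<^sup>2)"
      using fc_measurable[OF assms(1)] sq by (intro smeas.integrable_bounded[where K = "K\<^sup>2"]) auto
  qed (use sq in auto)
  also have "\<dots> = (K * norm \<psi>)\<^sup>2"
    using smeas_UNIV[of \<psi>] sets_eq_imp_space_eq[OF smeas.M_is_borel]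
        by (simp add: power_mult_distrib mult.commute)
  finally show ?thesis using K by (auto intro: power2_le_imp_le)
qed

text \<open>The norm identity applied to the difference, which belongs to the zero function. So the
  operator depends on the function alone and not on the way in which it was built, and
  \<open>THE\<close> may be used for it.\<close>

lemma fc_unique:
  assumes "fc f T" "fc f S"
  shows "T = S"
proof
  fix \<psi>
  have "norm (T \<psi> - S \<psi>) \<le> 0 * norm \<psi>"
    by (rule fc_norm_le[OF fc_diff[OF assms]]) simp
  then show "T \<psi> = S \<psi>" by simp
qed

text \<open>Bounded pointwise convergence is convergence in the square mean for the finite measure
  \<open>smeas \<psi>\<close>, and \<open>fc_norm_sq\<close> transfers it to the vectors.\<close>

lemma fc_cauchy:
  assumes F: "\<And>n. fc (F n) (T n)" and K: "\<And>n x. cmod (F n x) \<le> K" and lim: "\<And>x. (\<lambda>n. F n x) \<longlonglongrightarrow> f x"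
  shows "Cauchy (\<lambda>n. T n \<psi>)"
proof (rule CauchyI)
  fix e :: real assume e: "e > 0"
  have fm: "f \<in> borel_measurable borel"
    by (rule borel_measurable_LIMSEQ_metric[OF fc_measurable[OF F] lim])
  have fK: "cmod (f x) \<le> K" for x
    using K by (intro Lim_bounded[OF tendsto_norm[OF lim], of 0]) auto
  have d: "cmod (F n x - f x) \<le> 2 * K" for n x
    using norm_triangle_ineq4[of "F n x" "f x"] K[of n x] fK[of x] by linarith
  have dsq: "(cmod (F n x - f x))\<^sup>2 \<le> (2 * K)\<^sup>2" for n x
    using d by (intro power_mono) auto
  have dm: "(\<lambda>x. (cmod (F n x - f x))\<^sup>2) \<in> borel_measurable borel" for n
    using fm fc_measurable[OF F[of n]] by measurable
  have di: "integrable (smeas \<psi>) (\<lambda>x. (cmod (F n x - f x))\<^sup>2)" for n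
    using dm dsq by (intro smeas.integrable_bounded[where K = "(2 * K)\<^sup>2"]) auto
  have "(\<lambda>n. \<integral>x. (cmod (F n x - f x))\<^sup>2 \<partial>smeas \<psi>) \<longlonglongrightarrow> (\<integral>x. 0 \<partial>smeas \<psi>)"
  proof (rule smeas.integral_bounded_convergence[where K = "(2 * K)\<^sup>2"])
    show "(\<lambda>n. (cmod (F n x - f x))\<^sup>2) \<longlonglongrightarrow> 0" for x
      using tendsto_power[OF tendsto_norm[OF tendsto_diff[OF lim[of x] tendsto_const[of "f
          x"]]], where n = 2]
      by simp
  qed (use dm dsq in auto)
  then obtain N where N: "\<And>n. n \<ge> N \<Longrightarrow> (\<integral>x. (cmod (F n x - f x))\<^sup>2 \<partial>smeas \<psi>) < e\<^sup>2 / 4"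
    using e unfolding lim_sequentially by (force dest: spec[of _ "e\<^sup>2 / 4"] simp: dist_real_def)
  show "\<exists>N. \<forall>m\<ge>N. \<forall>n\<ge>N. norm (T m \<psi> - T n \<psi>) < e"
  proof (intro exI allI impI)
    fix m n assume mn: "m \<ge> N" "n \<ge> N"
    have "(norm (T m \<psi> - T n \<psi>))\<^sup>2 = (\<integral>x. (cmod (F m x - F n x))\<^sup>2 \<partial>smeas \<psi>)"
      by (rule fc_norm_sq[OF fc_diff[OF F F]])
    also have "\<dots> \<le> (\<integral>x. 2 * (cmod (F m x - f x))\<^sup>2 + 2 * (cmod (F n x - f x))\<^sup>2 \<partial>smeas \<psi>)"
    proof (rule integral_mono)
      have "(cmod (F m x - F n x))\<^sup>2 \<le> (2 * K)\<^sup>2" for x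
        using norm_triangle_ineq4[of "F m x" "F n x"] K[of m x] K[of n x] by (intro power_mono) auto
      then show "integrable (smeas \<psi>) (\<lambda>x. (cmod (F m x - F n x))\<^sup>2)"
        using fc_measurable[OF F[of n]] fc_measurable[OF F[of m]]
        by (intro smeas.integrable_bounded[where K = "(2 * K)\<^sup>2"]) auto
      show "(cmod (F m x - F n x))\<^sup>2 \<le> 2 * (cmod (F m x - f x))\<^sup>2 + 2 * (cmod (F n x - f x))\<^sup>2"
          for x
      proof -
        have "cmod (F m x - F n x) \<le> cmod (F m x - f x) + cmod (F n x - f x)"
          by (metis norm_minus_commute norm_triangle_ineq4 add_diff_cancel_right'
              diff_add_eq_diff_diff_swap
              diff_diff_eq2 diff_add_cancel)
        then have "(cmod (F m x - F n x))\<^sup>2 \<le> (cmod (F m x - f x) + cmod (F n x - f x))\<^sup>2"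
          by (intro power_mono) auto
        also have "\<dots> \<le> 2 * (cmod (F m x - f x))\<^sup>2 + 2 * (cmod (F n x - f x))\<^sup>2"
          using zero_le_power2[of "cmod (F m x - f x) - cmod (F n x - f x)"]
          by (simp add: power2_eq_square algebra_simps)
        finally show ?thesis .
      qed
    qed (use di in auto)
    also have "\<dots> < e\<^sup>2" using N[OF mn(1)] N[OF mn(2)] di by simp
    finally show "norm (T m \<psi> - T n \<psi>) < e" using e by (auto intro: power2_less_imp_less)
  qed
qed

text \<open>Makes the strong convergence required by \<open>fc_lim\<close> automatic, so that only
  functions have to be checked from here on.\<close>

lemma fc_limit_exists:
  assumes "\<And>n. fc (F n) (T n)" "\<And>n x. cmod (F n x) \<le> K" "\<And>x. (\<lambda>n. F n x) \<longlonglongrightarrow> f x"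
  obtains S where "fc f S" "\<And>\<psi>. (\<lambda>n. T n \<psi>) \<longlonglongrightarrow> S \<psi>"
proof -
  have "\<exists>l. (\<lambda>n. T n \<psi>) \<longlonglongrightarrow> l" for \<psi>
    using fc_cauchy[OF assms] Cauchy_convergent convergent_def by blast
  then obtain S where "\<And>\<psi>. (\<lambda>n. T n \<psi>) \<longlonglongrightarrow> S \<psi>" by metis
  with fc_lim[OF assms] that show thesis by blast
qed

lemma fc_bounded_operator: "fc f T \<Longrightarrow> \<exists>K\<ge>0. \<forall>\<psi>. norm (T \<psi>) \<le> K * norm \<psi>"
  using fc_bounded[of f T] fc_norm_le[of f T] by (meson norm_ge_zero order_trans)

lemma fc_tendsto:
  assumes "fc f T" "X \<longlonglongrightarrow> x"
  shows "(\<lambda>n. T (X n)) \<longlonglongrightarrow> T x"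
proof -
  obtain K where K: "K \<ge> 0" "\<And>\<psi>. norm (T \<psi>) \<le> K * norm \<psi>" using fc_bounded_operator[OF assms(1)]
      by blast
  have "(\<lambda>n. T (X n) - T x) \<longlonglongrightarrow> 0"
  proof (rule Lim_null_comparison)
    show "\<forall>\<^sub>F n in sequentially. norm (T (X n) - T x) \<le> K * norm (X n - x)"
      using K(2) by (simp add: clinear_diff[OF fc_clinear[OF assms(1)], symmetric])
    have "(\<lambda>n. K * norm (X n - x)) \<longlonglongrightarrow> K * norm (x - x)" by (intro tendsto_intros assms)
    then show "(\<lambda>n. K * norm (X n - x)) \<longlonglongrightarrow> 0" by simp
  qed
  then show ?thesis by (rule LIM_zero_cancel)
qed

section \<open>Products and adjoints in the functional calculus\<close>

lemma fc_mult_powi: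
  assumes "fc g S"
  shows "fc (\<lambda>x. cayley x powi m * g x) (\<lambda>\<psi>. zpow V m (S \<psi>))"
  using assms
proof (induction rule: fc.induct)
  case (fc_powi n)
  have "cayley x powi m * cayley x powi n = cayley x powi (m + n)" for x
      by (simp add: power_int_add)
  moreover have "(\<lambda>\<psi>. zpow V m (zpow V n \<psi>)) = zpow V (m + n)"
    using zpow_add[OF bij_V, of m n] by (simp add: comp_def)
  ultimately show ?case using fc.fc_powi[of "m + n"] by simp
next
  case (fc_add f T g S)
  then show ?case using fc.fc_add[OF fc_add.IH]
    by (simp add: distrib_left clinear_add[OF cay.lin_zpow])
next
  case (fc_scale f T c)
  then show ?case using fc.fc_scale[OF fc_scale.IH, of c]
    by (simp add: clinear_scaleC[OF cay.lin_zpow] mult.left_commute)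
next
  case (fc_lim F T K f S)
  show ?case
  proof (rule fc.fc_lim)
    show "fc (\<lambda>x. cayley x powi m * F n x) (\<lambda>\<psi>. zpow V m (T n \<psi>))" for n using fc_lim by blast
    show "cmod (cayley x powi m * F n x) \<le> K" for n x using fc_lim by (simp add: norm_mult)
    show "(\<lambda>n. cayley x powi m * F n x) \<longlonglongrightarrow> cayley x powi m * f x" for x
      by (intro tendsto_intros fc_lim(3))
    show "(\<lambda>n. zpow V m (T n \<psi>)) \<longlonglongrightarrow> zpow V m (S \<psi>)" for \<psi>
      by (intro fc_tendsto[OF fc.fc_powi] fc_lim(4))
  qed
qed

text \<open>The same two stages as for \<open>fc_cinner\<close>. In the limit case the left
  operators are evaluated at the fixed vector \<open>S \<psi>\<close>, so strong convergence
  suffices.\<close>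

lemma fc_mult:
  assumes "fc f T" and gS: "fc g S"
  shows "fc (\<lambda>x. f x * g x) (\<lambda>\<psi>. T (S \<psi>))"
  using assms(1)
proof (induction rule: fc.induct)
  case (fc_powi n)
  show ?case by (rule fc_mult_powi[OF gS])
next
  case (fc_add f1 T1 f2 T2)
  then show ?case using fc.fc_add[OF fc_add.IH] by (simp add: distrib_right)
next
  case (fc_scale f T c)
  then show ?case using fc.fc_scale[OF fc_scale.IH, of c] by (simp add: mult.assoc)
next
  case (fc_lim F T K f T')
  obtain L where L: "\<And>x. cmod (g x) \<le> L" using fc_bounded[OF gS] by blast
  have K: "0 \<le> K" using fc_lim(2)[of 0 0] norm_ge_zero order_trans by blast
  show ?case
  proof (rule fc.fc_lim)
    show "fc (\<lambda>x. F n x * g x) (\<lambda>\<psi>. T n (S \<psi>))" for n using fc_lim by blast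
    show "cmod (F n x * g x) \<le> K * L" for n x
      using mult_mono[OF fc_lim(2)[of n x] L[of x] K] by (simp add: norm_mult)
    show "(\<lambda>n. F n x * g x) \<longlonglongrightarrow> f x * g x" for x by (intro tendsto_intros fc_lim(3))
    show "(\<lambda>n. T n (S \<psi>)) \<longlonglongrightarrow> T' (S \<psi>)" for \<psi> by (rule fc_lim(4))
  qed
qed

text \<open>Adjoints of a strongly convergent sequence need not converge strongly in general; here
  they do, because they belong to the conjugate functions, to which \<open>fc_limit_exists\<close>
  applies.\<close>

lemma fc_adjoint:
  assumes "fc f T"
  shows "\<exists>S. fc (\<lambda>x. cnj (f x)) S \<and> (\<forall>\<phi> \<psi>. cinner (T \<phi>) \<psi> = cinner \<phi> (S \<psi>))"
  using assms
proof (induction rule: fc.induct)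
  case (fc_powi n)
  have "cinner (zpow V n \<phi>) \<psi> = cinner \<phi> (zpow V (- n) \<psi>)" for \<phi> \<psi>
    using cay.cinner_zpow[of n \<phi> 0 \<psi>] by simp
  then show ?case using fc.fc_powi[of "- n"] cnj_cayley_powi
      by (intro exI[of _ "zpow V (- n)"]) simp
next
  case (fc_add f1 T1 f2 T2)
  then obtain S1 S2 where "fc (\<lambda>x. cnj (f1 x)) S1" "fc (\<lambda>x. cnj (f2 x)) S2"
    "\<forall>\<phi> \<psi>. cinner (T1 \<phi>) \<psi> = cinner \<phi> (S1 \<psi>)" "\<forall>\<phi> \<psi>. cinner (T2 \<phi>) \<psi> = cinner \<phi> (S2 \<psi>)" by blast
  then show ?case using fc.fc_add[of "\<lambda>x. cnj (f1 x)" S1 "\<lambda>x. cnj (f2 x)" S2]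
    by (intro exI[of _ "\<lambda>\<psi>. S1 \<psi> + S2 \<psi>"]) (simp add: cinner_simps)
next
  case (fc_scale f T c)
  then obtain S where "fc (\<lambda>x. cnj (f x)) S" "\<forall>\<phi> \<psi>. cinner (T \<phi>) \<psi> = cinner \<phi> (S \<psi>)" by blast
  then show ?case using fc.fc_scale[of "\<lambda>x. cnj (f x)" S "cnj c"]
    by (intro exI[of _ "\<lambda>\<psi>. cnj c *\<^sub>C S \<psi>"]) (simp add: cinner_simps)
next
  case (fc_lim F T K f T')
  then have "\<forall>n. \<exists>S. fc (\<lambda>x. cnj (F n x)) S \<and> (\<forall>\<phi> \<psi>. cinner (T n \<phi>) \<psi> = cinner \<phi> (S \<psi>))" by blast
  then obtain S where S: "\<And>n. fc (\<lambda>x. cnj (F n x)) (S n)"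
    "\<And>n \<phi> \<psi>. cinner (T n \<phi>) \<psi> = cinner \<phi> (S n \<psi>)" by metis
  obtain S' where S': "fc (\<lambda>x. cnj (f x)) S'" "\<And>\<psi>. (\<lambda>n. S n \<psi>) \<longlonglongrightarrow> S' \<psi>"
  proof (rule fc_limit_exists[of "\<lambda>n x. cnj (F n x)" S K "\<lambda>x. cnj (f x)"])
    show "fc (\<lambda>x. cnj (F n x)) (S n)" for n by (rule S)
    show "cmod (cnj (F n x)) \<le> K" for n x using fc_lim by simp
    show "(\<lambda>n. cnj (F n x)) \<longlonglongrightarrow> cnj (f x)" for x by (intro tendsto_intros fc_lim)
  qed auto
  have "cinner (T' \<phi>) \<psi> = cinner \<phi> (S' \<psi>)" for \<phi> \<psi>
  proof (rule LIMSEQ_unique)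
    show "(\<lambda>n. cinner (T n \<phi>) \<psi>) \<longlonglongrightarrow> cinner (T' \<phi>) \<psi>" by (intro tendsto_intros fc_lim)
    show "(\<lambda>n. cinner (T n \<phi>) \<psi>) \<longlonglongrightarrow> cinner \<phi> (S' \<psi>)" unfolding S(2) by (intro tendsto_intros S')
  qed
  with S'(1) show ?case by blast
qed

end

section \<open>From trigonometric polynomials to continuous functions and indicators\<close>

lemma i_plus_real_neq_0 [simp]: "\<i> + complex_of_real x \<noteq> 0"
  by (simp add: complex_eq_iff)

lemma cayley_1_minus: "1 - cayley x = 2 * \<i> / (complex_of_real x + \<i>)"
  by (simp add: cayley_def field_simps)

lemma cayley_neq_1 [simp]: "cayley x \<noteq> 1"
  using cayley_1_minus[of x] by auto

lemma cayley_inverse': "Re (\<i> * (1 + cayley x) / (1 - cayley x)) = x"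
proof -
  have plus: "1 + cayley x = 2 * complex_of_real x / (complex_of_real x + \<i>)"
    by (simp add: cayley_def field_simps)
  have "\<i> * (1 + cayley x) / (1 - cayley x) = complex_of_real x"
    unfolding plus cayley_1_minus by (simp add: field_simps)
  then show ?thesis by simp
qed

lemma norm_1_minus_cayley: "(cmod (1 - cayley x))\<^sup>2 = 4 / (1 + x\<^sup>2)"
proof -
  have "(cmod (complex_of_real x + \<i>))\<^sup>2 = 1 + x\<^sup>2" by (simp add: cmod_power2)
  then show ?thesis unfolding cayley_1_minus by (simp add: norm_divide norm_mult power_divide)
qed

lemma norm_id_plus_i_le: "cmod (complex_of_real x / (complex_of_real x + \<i>)) \<le> 1"
proof -
  have "cmod (complex_of_real x) \<le> cmod (complex_of_real x + \<i>)"
    using abs_Re_le_cmod[of "complex_of_real x + \<i>"] by simp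
  then show ?thesis by (simp add: norm_divide divide_le_eq)
qed

context self_adjoint_operator
begin

text \<open>The resolvent is an affine function of \<open>V\<close>, read off from the definition of
  \<open>V\<close>.\<close>

lemma fc_R: "fc (\<lambda>x. 1 / (complex_of_real x + \<i>)) R"
proof -
  have "fc (\<lambda>x. (- \<i> / 2) * (1 - cayley x)) (\<lambda>\<psi>. (- \<i> / 2) *\<^sub>C (\<psi> - V \<psi>))"
    using fc_scale[OF fc_diff[OF fc_one fc_powi[of 1]], of "- \<i> / 2"] by simp
  moreover have "(- \<i> / 2) * (1 - cayley x) = 1 / (complex_of_real x + \<i>)" for x
    unfolding cayley_1_minus by simp
  moreover have "(- \<i> / 2) *\<^sub>C (\<psi> - V \<psi>) = R \<psi>" for \<psi>
    by (simp add: V_def scaleC_scaleC scaleC_one)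
  ultimately show ?thesis by simp
qed

text \<open>A real-linear functional on the plane is \<open>a z + b cnj z\<close>, and on the circle
  \<open>cnj z\<close> is the inverse of \<open>z\<close>. Real polynomials in the plane thus become
  trigonometric polynomials of the Cayley variable, ready for Stone-Weierstrass.\<close>

lemma fc_real_polynomial:
  assumes "real_polynomial_function g"
  shows "\<exists>T. fc (\<lambda>x. complex_of_real (g (cayley x))) T"
  using assms
proof (induction rule: real_polynomial_function.induct)
  case (linear f)
  interpret bounded_linear f by fact
  define a where "a = (complex_of_real (f 1) - \<i> * complex_of_real (f \<i>)) / 2"
  define b where "b = (complex_of_real (f 1) + \<i> * complex_of_real (f \<i>)) / 2"
  have "complex_of_real (f z) = a * z + b * cnj z" for z
  proof -
    have "f z = f (Re z *\<^sub>R 1 + Im z *\<^sub>R \<i>)" by (rule arg_cong[where f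
        = f]) (simp add: complex_eq_iff)
    then have "f z = Re z * f 1 + Im z * f \<i>" by (simp add: add scaleR)
    then show ?thesis by (simp add: a_def b_def complex_eq_iff field_simps)
  qed
  then have "complex_of_real (f (cayley x)) = a * cayley x powi 1 + b * cayley x powi (-1)" for x
    by (simp add: cnj_cayley power_int_minus)
  then show ?case
    using fc_add[OF fc_scale[OF fc_powi[of 1], of a] fc_scale[OF fc_powi[of "-1"], of b]] by auto
next
  case (const c)
  show ?case using fc_const[of "complex_of_real c"] by blast
next
  case (add f g)
  then show ?case using fc_add by (auto simp del: fc.fc_add) blast
next
  case (mult f g)
  then show ?case using fc_mult by auto blast
qed

lemma fc_circle:
  assumes F: "continuous_on (sphere 0 1) (F :: complex \<Rightarrow> real)"
  shows "\<exists>T. fc (\<lambda>x. complex_of_real (F (cayley x))) T"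
proof -
  have "\<forall>n. \<exists>g. real_polynomial_function g \<and> (\<forall>z\<in>sphere 0 1. \<bar>F z - g z\<bar> < inverse (real (Suc n)))"
  proof
    fix n
    show "\<exists>g. real_polynomial_function g \<and> (\<forall>z\<in>sphere 0 1. \<bar>F z - g z\<bar> < inverse (real (Suc n)))"
      by (rule Stone_Weierstrass_real_polynomial_function[OF compact_sphere F, of "inverse (real
          (Suc n))"]) auto
  qed
  from choice[OF this] obtain g where "\<forall>n. real_polynomial_function (g n) \<and>
    (\<forall>z\<in>sphere 0 1. \<bar>F z - g n z\<bar> < inverse (real (Suc n)))" ..
  then have g: "\<And>n. real_polynomial_function (g n)"
    "\<And>n z. z \<in> sphere 0 1 \<Longrightarrow> \<bar>F z - g n z\<bar> < inverse (real (Suc n))" by simp_all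
  have "\<forall>n. \<exists>T. fc (\<lambda>x. complex_of_real (g n (cayley x))) T"
    using fc_real_polynomial[OF g(1)] by blast
  from choice[OF this] obtain T where T: "\<And>n. fc (\<lambda>x. complex_of_real (g n (cayley x))) (T n)"
    by blast
  have "bounded (F ` sphere 0 1)"
    by (intro compact_imp_bounded compact_continuous_image F compact_sphere)
  then obtain K where "\<forall>y\<in>F ` sphere 0 1. norm y \<le> K" unfolding bounded_iff by blast
  then have K: "\<And>z. z \<in> sphere 0 1 \<Longrightarrow> \<bar>F z\<bar> \<le> K" by simp
  have cS: "cayley x \<in> sphere 0 1" for x by simp
  obtain S where "fc (\<lambda>x. complex_of_real (F (cayley x))) S"
  proof (rule fc_limit_exists[OF T, where K = "K + 1" and f = "\<lambda>x. complex_of_real (F (cayley x))"])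
    show "cmod (complex_of_real (g n (cayley x))) \<le> K + 1" for n x
    proof -
      have "inverse (real (Suc n)) \<le> 1" by (simp add: field_simps)
      then show ?thesis using g(2)[OF cS, of x n] K[OF cS, of x] by (simp add: abs_le_iff) linarith
    qed
    show "(\<lambda>n. complex_of_real (g n (cayley x))) \<longlonglongrightarrow> complex_of_real (F (cayley x))" for x
    proof (rule tendsto_of_real, rule LIM_zero_cancel, rule Lim_null_comparison)
      show "\<forall>\<^sub>F n in sequentially. norm (g n (cayley x) - F (cayley x)) \<le> inverse (real (Suc n))"
        using less_imp_le[OF g(2)[OF cS, of x]] by (simp add: abs_minus_commute)
    qed (rule LIMSEQ_inverse_real_of_nat)
  qed auto
  then show ?thesis by blast
qed

text \<open>The weight \<open>1 / (1 + x\<^sup>2)\<close> is a quarter of the squared distance from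
  \<open>cayley x\<close> to 1, the image of infinity. The decay therefore says that
  \<open>f\<close>, moved to the circle, extends continuously by 0 to that point.\<close>

lemma fc_decaying:
  fixes f :: "real \<Rightarrow> real"
  assumes f: "continuous_on UNIV f" "\<And>x. \<bar>f x\<bar> \<le> K / (1 + x\<^sup>2)"
  shows "\<exists>T. fc (\<lambda>x. complex_of_real (f x)) T"
proof -
  define h where "h z = Re (\<i> * (1 + z) / (1 - z))" for z :: complex
  define F where "F z = (if z = 1 then 0 else f (h z))" for z
  have "continuous_on (sphere 0 1) F"
    unfolding continuous_on_eq_continuous_within
  proof
    fix z :: complex assume z: "z \<in> sphere 0 1"
    show "continuous (at z within sphere 0 1) F"
    proof (cases "z = 1")
      case True
      have le: "\<bar>F y\<bar> \<le> K / 4 * (cmod (1 - y))\<^sup>2" if "y \<in> sphere 0 1" for y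
      proof (cases "y = 1")
        case False
        then have y: "cayley (h y) = y" unfolding h_def using that by (intro cayley_inverse) auto
        have "(cmod (1 - y))\<^sup>2 = 4 / (1 + (h y)\<^sup>2)"
          using norm_1_minus_cayley[of "h y"] unfolding y .
        then have e: "K / 4 * (cmod (1 - y))\<^sup>2 = K / (1 + (h y)\<^sup>2)" by simp
        show ?thesis unfolding e using f(2)[of "h y"] False by (simp add: F_def)
      qed (simp add: F_def)
      have "(F \<longlongrightarrow> 0) (at 1 within sphere 0 1)"
      proof (rule Lim_null_comparison)
        show "\<forall>\<^sub>F y in at 1 within sphere 0 1. norm (F y) \<le> K / 4 * (cmod (1 - y))\<^sup>2"
          unfolding eventually_at_filter using le by (intro always_eventually) auto
        have "((\<lambda>y. K / 4 * (cmod (1 - y))\<^sup>2) \<longlongrightarrow> K / 4 * (cmod (1 - 1))\<^sup>2) (at 1 within sphere 0 1)"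
          by (intro tendsto_intros)
        then show "((\<lambda>y. K / 4 * (cmod (1 - y))\<^sup>2) \<longlongrightarrow> 0) (at 1 within sphere 0 1)" by simp
      qed
      then show ?thesis unfolding True continuous_within by (simp add: F_def)
    next
      case False
      have "continuous_on (- {1}) (\<lambda>z. f (h z))"
        unfolding h_def by (intro continuous_on_compose2[OF f(1)] continuous_intros) auto
      then have "continuous_on (- {1}) F"
        by (rule continuous_on_eq) (auto simp: F_def)
      then have "continuous (at z) F"
        using False by (subst (asm) continuous_on_eq_continuous_at) (auto simp: open_Compl)
      then show ?thesis by (rule continuous_at_imp_continuous_at_within)
    qed
  qed
  from fc_circle[OF this] show ?thesis by (simp add: F_def h_def cayley_inverse')
qed

lemma fc_continuous_real:
  fixes f :: "real \<Rightarrow> real"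
  assumes f: "continuous_on UNIV f" "\<And>x. \<bar>f x\<bar> \<le> K"
  shows "\<exists>T. fc (\<lambda>x. complex_of_real (f x)) T"
proof -
  \<comment> \<open>The factor is at most 1, tends to 1 pointwise, and supplies the decay that
    \<open>fc_decaying\<close> asks for.\<close>
  define F where "F n x = f x * (real (Suc n) / (real (Suc n) + x\<^sup>2))" for n x
  have nz: "real (Suc n) + x\<^sup>2 > 0" for n x by (intro add_pos_nonneg) auto
  have K: "0 \<le> K" using f(2)[of 0] by linarith
  have "\<exists>T. fc (\<lambda>x. complex_of_real (F n x)) T" for n
  proof (rule fc_decaying)
    show "continuous_on UNIV (F n)" unfolding F_def
      by (intro continuous_intros f) (use nz in \<open>auto simp del: of_nat_Suc
          simp: less_imp_neq[symmetric] dest: less_imp_neq\<close>)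
    show "\<bar>F n x\<bar> \<le> K * real (Suc n) / (1 + x\<^sup>2)" for x
    proof -
      have "real (Suc n) / (real (Suc n) + x\<^sup>2) \<le> real (Suc n) / (1 + x\<^sup>2)"
        by (intro divide_left_mono mult_pos_pos nz) (auto intro: add_pos_nonneg)
      then have "\<bar>f x\<bar> * (real (Suc n) / (real (Suc n) + x\<^sup>2)) \<le> K * (real (Suc n) / (1 + x\<^sup>2))"
        using f(2) K nz[of n x] by (intro mult_mono) auto
      then show ?thesis using nz[of n x] by (simp add: F_def abs_mult)
    qed
  qed
  then obtain T where T: "\<And>n. fc (\<lambda>x. complex_of_real (F n x)) (T n)" by metis
  obtain S where "fc (\<lambda>x. complex_of_real (f x)) S"
  proof (rule fc_limit_exists[OF T, where K = K and f = "\<lambda>x. complex_of_real (f x)"])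
    show "cmod (complex_of_real (F n x)) \<le> K" for n x
    proof -
      have "\<bar>f x\<bar> * (real (Suc n) / (real (Suc n) + x\<^sup>2)) \<le> K * 1"
        using f(2) K nz[of n x] by (intro mult_mono) (auto simp: divide_le_eq)
      moreover have "\<bar>real (Suc n) / (real (Suc n) + x\<^sup>2)\<bar> = real (Suc n) / (real (Suc n) + x\<^sup>2)"
        using nz[of n x] by (intro abs_of_nonneg) auto
      ultimately show ?thesis unfolding norm_of_real F_def abs_mult by linarith
    qed
    show "(\<lambda>n. complex_of_real (F n x)) \<longlonglongrightarrow> complex_of_real (f x)" for x
    proof (rule tendsto_of_real)
      have "\<bar>F n x - f x\<bar> \<le> \<bar>f x\<bar> * x\<^sup>2 * inverse (real (Suc n))" for n
      proof -
        have "F n x - f x = - (f x * (x\<^sup>2 / (real (Suc n) + x\<^sup>2)))"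
          using nz[of n x] by (simp add: F_def field_simps)
        then have "\<bar>F n x - f x\<bar> = \<bar>f x\<bar> * (x\<^sup>2 / (real (Suc n) + x\<^sup>2))"
          using nz[of n x] by (simp only: abs_minus abs_mult abs_divide abs_power2 abs_of_pos)
        also have "x\<^sup>2 / (real (Suc n) + x\<^sup>2) \<le> x\<^sup>2 / real (Suc n)"
          using nz[of n x] by (intro divide_left_mono) auto
        finally show ?thesis by (simp add: divide_inverse mult.assoc mult_left_mono)
      qed
      then have ev: "\<forall>\<^sub>F n in sequentially. norm (F n x - f x)
          \<le> \<bar>f x\<bar> * x\<^sup>2 * inverse (real (Suc n))"
        unfolding real_norm_def by (intro always_eventually allI)
      have "(\<lambda>n. F n x - f x) \<longlonglongrightarrow> 0"
        by (rule Lim_null_comparison[OF ev]) (rule tendsto_mult_right_zero[OF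
            LIMSEQ_inverse_real_of_nat])
      then show "(\<lambda>n. F n x) \<longlonglongrightarrow> f x" by (rule LIM_zero_cancel)
    qed
  qed auto
  then show ?thesis by blast
qed

lemma fc_continuous:
  fixes f :: "real \<Rightarrow> complex"
  assumes f: "continuous_on UNIV f" "\<And>x. cmod (f x) \<le> K"
  shows "\<exists>T. fc f T"
proof -
  have "\<bar>Re (f x)\<bar> \<le> K" "\<bar>Im (f x)\<bar> \<le> K" for x
    using f(2)[of x] abs_Re_le_cmod[of "f x"] abs_Im_le_cmod[of "f x"] by linarith+
  then obtain T S where "fc (\<lambda>x. complex_of_real (Re (f x))) T" "fc (\<lambda>x. complex_of_real (Im (f
      x))) S"
    using fc_continuous_real[of "\<lambda>x. Re (f x)" K] fc_continuous_real[of "\<lambda>x. Im (f x)" K] f(1)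
    by (metis continuous_on_Re continuous_on_Im)
  from fc_add[OF this(1) fc_scale[OF this(2), of \<i>]]
  show ?thesis by (auto simp: complex_eq[symmetric])
qed

text \<open>Induction over the sigma-algebra generated by open half-lines: the calculus is closed
  under complements, products and bounded pointwise limits.\<close>

lemma fc_indicator:
  assumes "S \<in> sets borel"
  shows "\<exists>T. fc (indicator S) T"
proof -
  have "S \<in> sigma_sets UNIV (range lessThan)"
    using assms unfolding borel_Iio by simp
  then show ?thesis
  proof (induction rule: sigma_sets.induct)
    case (Basic a)
    then obtain c :: real where a: "a = {..<c}" by auto
    \<comment> \<open>Ramps of slope \<open>n\<close> that vanish from \<open>c\<close> on and reach
      1 within distance \<open>1 / n\<close> below it.\<close>
    define f where "f n x = max 0 (min 1 (real n * (c - x)))" for n x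
    have "\<exists>T. fc (\<lambda>x. complex_of_real (f n x)) T" for n
      unfolding f_def by (rule fc_continuous_real[where K = 1]) (auto intro!: continuous_intros)
    then obtain T where T: "\<And>n. fc (\<lambda>x. complex_of_real (f n x)) (T n)" by metis
    obtain S where "fc (indicator a) S"
    proof (rule fc_limit_exists[OF T, where K = 1 and f = "indicator a"])
      show "cmod (complex_of_real (f n x)) \<le> 1" for n x by (simp add: f_def)
      show "(\<lambda>n. complex_of_real (f n x)) \<longlonglongrightarrow> indicator a x" for x
      proof (cases "x < c")
        case True
        obtain N where N: "real N * (c - x) > 1" using True reals_Archimedean3[of "c - x"] by auto
        have "f n x = 1" if "n \<ge> N" for n
        proof -
          have "real N * (c - x) \<le> real n * (c - x)" using that True by (intro mult_right_mono) auto
          then show ?thesis using N by (simp add: f_def)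
        qed
        then have "\<forall>\<^sub>F n in sequentially. complex_of_real (f n x) = indicator a x"
          unfolding eventually_sequentially a using True by (intro exI[of _ N]) simp
        then show ?thesis by (rule tendsto_eventually)
      next
        case False
        then have "real n * (c - x) \<le> 0" for n by (intro mult_nonneg_nonpos) auto
        then have "f n x = 0" for n unfolding f_def by (metis max.absorb1 min.coboundedI2)
        then show ?thesis using False by (simp add: a)
      qed
    qed auto
    then show ?case by blast
  next
    case Empty
    show ?case using fc_const[of 0] by auto
  next
    case (Compl a)
    then obtain T where "fc (indicator a) T" by blast
    moreover have "indicator (UNIV - a) = (\<lambda>x. 1 - indicator a x :: complex)"
      by (auto simp: fun_eq_iff indicator_def)
    ultimately show ?case using fc_diff[OF fc_one, of "indicator a" T] by auto
  next
    case (Union a)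
    \<comment> \<open>The sets may overlap, so unions are formed through products of the indicators
      of complements.\<close>
    have "\<exists>T. fc (\<lambda>x. 1 - indicator (\<Union>i<n. a i) x) T" for n :: nat
    proof (induction n)
      case 0
      show ?case using fc_one by auto
    next
      case (Suc n)
      then obtain T where T: "fc (\<lambda>x. 1 - indicator (\<Union>i<n. a i) x) T" by blast
      obtain S where S: "fc (indicator (a n)) S" using Union by blast
      have "(1 - indicator (\<Union>i<n. a i) x) * (1 - indicator (a n) x)
          = (1 - indicator (\<Union>i<Suc n. a i) x :: complex)" for x
        by (auto simp: indicator_def less_Suc_eq)
      then show ?case using fc_mult[OF T fc_diff[OF fc_one S]] by auto
    qed
    then obtain T where T: "\<And>n. fc (\<lambda>x. 1 - indicator (\<Union>i<n. a i) x) (T n)" by metis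
    obtain S where S: "fc (\<lambda>x. 1 - indicator (\<Union>i. a i) x) S"
    proof (rule fc_limit_exists[OF T, where K = 1 and f = "\<lambda>x. 1 - indicator (\<Union>i. a i) x"])
      show "cmod (1 - indicator (\<Union>i<n. a i) x) \<le> 1" for n x by (simp add: indicator_def)
      show "(\<lambda>n. 1 - indicator (\<Union>i<n. a i) x :: complex) \<longlonglongrightarrow> 1 - indicator (\<Union>i. a i) x" for x
        by (intro tendsto_diff tendsto_const LIMSEQ_indicator_UN)
    qed auto
    from fc_diff[OF fc_one this] show ?case by auto
  qed
qed

definition proj :: "real set \<Rightarrow> 'a \<Rightarrow> 'a"
  where "proj S = (THE T. fc (indicator S) T)"

lemma fc_the: "fc f T \<Longrightarrow> (THE T. fc f T) = T"
  using fc_unique by blast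

lemma fc_proj: "S \<in> sets borel \<Longrightarrow> fc (indicator S) (proj S)"
  using fc_indicator[of S] fc_the unfolding proj_def by auto

lemma measure_smeas: "S \<in> sets borel \<Longrightarrow> measure (smeas \<psi>) S = (norm (proj S \<psi>))\<^sup>2"
proof -
  assume S: "S \<in> sets borel"
  have "(cmod (indicator S x))\<^sup>2 = (indicator S x :: real)" for x by (simp add: indicator_def)
  then have "(norm (proj S \<psi>))\<^sup>2 = (\<integral>x. indicator S x \<partial>smeas \<psi>)"
    using fc_norm_sq[OF fc_proj[OF S], of \<psi>] by simp
  then show ?thesis using S sets_eq_imp_space_eq[OF smeas.M_is_borel]
      by (simp add: smeas.M_is_borel)
qed

text \<open>Multiplying \<open>x f + \<i> f\<close> by \<open>1 / (x + \<i>)\<close> returns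
  \<open>f\<close>, so \<open>T\<close> factors through \<open>R\<close> and maps into the domain.
  The unbounded function \<open>x\<close> itself never enters the calculus, only products with it
  that stay bounded.\<close>

lemma fc_domain:
  assumes T: "fc f T" and S: "fc (\<lambda>x. complex_of_real x * f x) S"
  shows "T \<psi> \<in> D \<and> op (T \<psi>) = S \<psi>"
proof -
  have "fc (\<lambda>x. complex_of_real x * f x + \<i> * f x) (\<lambda>\<psi>. S \<psi> + \<i> *\<^sub>C T \<psi>)"
    by (rule fc_add[OF S fc_scale[OF T]])
  note fc_mult[OF fc_R this]
  moreover have "(\<lambda>x. 1 / (complex_of_real x + \<i>) * (complex_of_real x * f x + \<i> * f x)) = f"
    by (rule ext) (simp add: field_simps)
  ultimately have "fc f (\<lambda>\<psi>. R (S \<psi> + \<i> *\<^sub>C T \<psi>))" by (simp only:)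
  from fc_unique[OF this T] have TR: "R (S \<psi> + \<i> *\<^sub>C T \<psi>) = T \<psi>" by (rule fun_cong)
  have "op (R (S \<psi> + \<i> *\<^sub>C T \<psi>)) = S \<psi>" by (subst op_R) (simp add: TR)
  moreover have "R (S \<psi> + \<i> *\<^sub>C T \<psi>) \<in> D" by (rule R_D)
  ultimately show ?thesis unfolding TR by blast
qed

text \<open>Counterpart of \<open>fc_domain\<close> with \<open>A\<close> acting first: with
  \<open>\<psi> = R y\<close> the vector \<open>op \<psi>\<close> becomes
  \<open>y - \<i> *\<^sub>C R y\<close>, which the calculus can handle.\<close>

lemma fc_op:
  assumes T: "fc f T" and S: "fc (\<lambda>x. f x * complex_of_real x) S" and \<psi>: "\<psi> \<in> D"
  shows "S \<psi> = T (op \<psi>)"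
proof -
  define y where "y = op \<psi> + \<i> *\<^sub>C \<psi>"
  have Ry: "R y = \<psi>" unfolding y_def by (rule R_op[OF \<psi>])
  have "fc (\<lambda>x. f x * (1 - \<i> * (1 / (complex_of_real x + \<i>)))) (\<lambda>\<psi>. T (\<psi> - \<i> *\<^sub>C R \<psi>))"
    by (intro fc_mult T fc_diff fc_one fc_scale fc_R)
  moreover have "fc (\<lambda>x. f x * complex_of_real x * (1 / (complex_of_real x + \<i>))) (\<lambda>\<psi>. S (R \<psi>))"
    by (intro fc_mult S fc_R)
  moreover have "(\<lambda>x. f x * (1 - \<i> * (1 / (complex_of_real x + \<i>))))
      = (\<lambda>x. f x * complex_of_real x * (1 / (complex_of_real x + \<i>)))"
    by (rule ext) (simp add: field_simps)
  ultimately have "(\<lambda>\<psi>. T (\<psi> - \<i> *\<^sub>C R \<psi>)) = (\<lambda>\<psi>. S (R \<psi>))"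
    by (intro fc_unique) (simp_all only:)
  then have "T (y - \<i> *\<^sub>C R y) = S (R y)" by (rule fun_cong)
  then show ?thesis unfolding Ry by (simp add: y_def)
qed

end

section \<open>The unitary group and the spectral measures\<close>

text \<open>The value at \<open>s = 0\<close> gives equal total masses; after normalization this is
  Levy's uniqueness theorem, and mass 0 is treated apart.\<close>

lemma finite_borel_measure_eqI_iexp:
  assumes M: "finite_borel_measure M" and N: "finite_borel_measure N"
    and eq: "\<And>s. (CLINT x|M. iexp (s * x)) = (CLINT x|N. iexp (s * x))"
  shows "M = N"
proof -
  interpret M: finite_borel_measure M by fact
  interpret N: finite_borel_measure N by fact
  have sp: "space M = UNIV" "space N = UNIV"
    using sets_eq_imp_space_eq[OF M.M_is_borel] sets_eq_imp_space_eq[OF N.M_is_borel] by auto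
  define c where "c = measure M UNIV"
  have cN: "measure N UNIV = c" using eq[of 0] sp unfolding c_def by simp
  have eM: "emeasure M UNIV = ennreal c" "emeasure N UNIV = ennreal c"
    using M.emeasure_eq_measure[of UNIV] N.emeasure_eq_measure[of UNIV] cN by (simp_all add: c_def)
  show ?thesis
  proof (cases "c = 0")
    case True
    show ?thesis
    proof (rule measure_eqI)
      show "sets M = sets N" by (simp add: M.M_is_borel N.M_is_borel)
      fix X
      have "emeasure M X \<le> emeasure M (space M)" "emeasure N X \<le> emeasure N (space N)"
        by (rule emeasure_space)+
      then show "emeasure M X = emeasure N X" using eM True sp by simp
    qed
  next
    case False
    then have c: "c > 0" unfolding c_def using measure_nonneg[of M UNIV] by linarith
    have rd: "real_distribution (density L (\<lambda>_. ennreal (1 / c)))"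
      if L: "finite_borel_measure L" "emeasure L UNIV = ennreal c" for L :: "real measure"
    proof -
      interpret L: finite_borel_measure L by fact
      have "space L = UNIV" using sets_eq_imp_space_eq[OF L.M_is_borel] by simp
      then have "emeasure (density L (\<lambda>_. ennreal (1 / c))) (space (density L (\<lambda>_. ennreal (1 /
          c)))) = 1"
        using L(2) c sets.top[of L] by (simp add: emeasure_density nn_integral_cmult
            ennreal_mult[symmetric])
      then show ?thesis
        by (intro real_distribution.intro real_distribution_axioms.intro prob_spaceI)
           (auto simp: L.M_is_borel)
    qed
    have int: "(CLINT x|density L (\<lambda>_. ennreal (1 / c)). iexp (s * x))
        = complex_of_real (1 / c) * (CLINT x|L. iexp (s * x))"
      if L: "finite_borel_measure L" for L s
    proof -
      interpret L: finite_borel_measure L by fact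
      have "(\<lambda>x. iexp (s * x)) \<in> borel_measurable L"
        unfolding measurable_cong_sets[OF L.M_is_borel refl] by measurable
      then show ?thesis using c by (subst integral_density) (auto simp: scaleR_conv_of_real)
    qed
    have "density M (\<lambda>_. ennreal (1 / c)) = density N (\<lambda>_. ennreal (1 / c))"
      by (rule Levy_uniqueness[OF rd[OF M eM(1)] rd[OF N eM(2)]])
         (rule ext, simp only: char_def int[OF M] int[OF N] eq)
    then have "density (density M (\<lambda>_. ennreal (1 / c))) (\<lambda>_. ennreal c)
        = density (density N (\<lambda>_. ennreal (1 / c))) (\<lambda>_. ennreal c)"
      by simp
    moreover have "density (density L (\<lambda>_. ennreal (1 / c))) (\<lambda>_. ennreal c) = L"
        for L :: "real measure"
      using c by (simp add: density_density_eq ennreal_mult[symmetric] density_1)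
    ultimately show ?thesis by simp
  qed
qed

context self_adjoint_operator
begin

section \<open>Stone's theorem: the unitary group and its generator\<close>

lemma fc_iexp: "\<exists>T. fc (\<lambda>x. iexp (s * x)) T"
  by (rule fc_continuous[where K = 1]) (auto intro!: continuous_intros simp: norm_exp_eq_Re)

definition U :: "real \<Rightarrow> 'a \<Rightarrow> 'a" where "U s = (THE T. fc (\<lambda>x. iexp (s * x)) T)"

lemma fc_U: "fc (\<lambda>x. iexp (s * x)) (U s)"
  using fc_iexp[of s] fc_the unfolding U_def by auto

lemma fc_null:
  assumes "\<And>n. fc (F n) (T n)" "\<And>n x. cmod (F n x) \<le> K" "\<And>x. (\<lambda>n. F n x) \<longlonglongrightarrow> 0"
  shows "(\<lambda>n. T n \<psi>) \<longlonglongrightarrow> 0"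
proof -
  obtain S where S: "fc (\<lambda>_. 0) S" "\<And>\<psi>. (\<lambda>n. T n \<psi>) \<longlonglongrightarrow> S \<psi>"
    using fc_limit_exists[OF assms] by blast
  have "S = (\<lambda>\<psi>. 0 *\<^sub>C \<psi>)" by (rule fc_unique[OF S(1) fc_const])
  then show ?thesis using S(2)[of \<psi>] by simp
qed

lemma U_0: "U 0 = id"
  using fc_unique[OF fc_U[of 0], of "\<lambda>\<psi>. \<psi>"] fc_one by (simp add: id_def)

lemma U_add: "U (s + t) = U s \<circ> U t"
proof (rule fc_unique[OF fc_U])
  have "(\<lambda>x. iexp (s * x) * iexp (t * x)) = (\<lambda>x. iexp ((s + t) * x))"
    by (simp add: exp_add[symmetric] algebra_simps)
  then show "fc (\<lambda>x. iexp ((s + t) * x)) (U s \<circ> U t)"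
    using fc_mult[OF fc_U[of s] fc_U[of t]] by (simp add: comp_def)
qed

lemma clinear_U: "clinear (U s)"
  by (rule fc_clinear[OF fc_U])

lemma norm_U: "norm (U s \<psi>) = norm \<psi>"
proof (rule antisym)
  have le: "norm (U s \<psi>) \<le> norm \<psi>" for s \<psi>
    using fc_norm_le[OF fc_U, of s 1 \<psi>] by (simp add: norm_exp_eq_Re)
  then show "norm (U s \<psi>) \<le> norm \<psi>" .
  have "U (- s) (U s \<psi>) = \<psi>" using U_add[of "- s" s] U_0
      by (metis add.left_inverse comp_apply id_apply)
  then show "norm \<psi> \<le> norm (U s \<psi>)" using le[of "- s" "U s \<psi>"] by simp
qed

lemma unitary_U: "unitary (U s)"
  unfolding unitary_def
proof (intro conjI allI)
  show "surj (U s)"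
  proof (rule surjI)
    show "U s (U (- s) x) = x" for x
      using U_add[of s "- s"] U_0 by (metis add.right_inverse comp_apply id_apply)
  qed
qed (rule clinear_U clinear_isometry_cinner[OF clinear_U norm_U])+

lemma continuous_U: "continuous_on UNIV (\<lambda>s. U s \<psi>)"
proof (rule continuous_at_imp_continuous_on, rule ballI)
  fix s :: real
  show "isCont (\<lambda>s. U s \<psi>) s"
    unfolding continuous_at_sequentially comp_def
  proof (intro allI impI)
    fix X assume X: "X \<longlonglongrightarrow> s"
    have "(\<lambda>n. U (X n) \<psi> - U s \<psi>) \<longlonglongrightarrow> 0"
    proof (rule fc_null[where F = "\<lambda>n x. iexp (X n * x) - iexp (s * x)" and K = 2 and T
        = "\<lambda>n \<psi>. U (X n) \<psi> - U s \<psi>"])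
      show "fc (\<lambda>x. iexp (X n * x) - iexp (s * x)) (\<lambda>\<psi>. U (X n) \<psi> - U s \<psi>)" for n
        by (intro fc_diff fc_U)
      show "cmod (iexp (X n * x) - iexp (s * x)) \<le> 2" for n x
        using norm_triangle_ineq4[of "iexp (X n * x)" "iexp (s * x)"] by (simp add: norm_exp_eq_Re)
      have "(\<lambda>n. iexp (X n * x) - iexp (s * x)) \<longlonglongrightarrow> iexp (s * x) - iexp (s * x)" for x
        by (intro tendsto_intros X)
      then show "(\<lambda>n. iexp (X n * x) - iexp (s * x)) \<longlonglongrightarrow> 0" for x by simp
    qed
    then show "(\<lambda>n. U (X n) \<psi>) \<longlonglongrightarrow> U s \<psi>" by (rule LIM_zero_cancel)
  qed
qed

lemma unitary_group_U: "unitary_group U"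
  unfolding unitary_group_def using unitary_U U_0 U_add continuous_U by blast

lemma norm_iexp_minus_1_le: "cmod (iexp t - 1) \<le> \<bar>t\<bar>"
  using iexp_approx1[of t 0] by simp

text \<open>With \<open>\<psi> = R y\<close> the difference quotient corresponds to
  \<open>(iexp (h x) - 1) / h\<close> times \<open>1 / (x + \<i>)\<close>. The resolvent factor
  bounds this by 1 uniformly in \<open>h\<close>, so pointwise convergence to the derivative
  suffices.\<close>

lemma U_generator_aux:
  assumes \<psi>: "\<psi> \<in> D" and h: "h \<longlonglongrightarrow> 0" "\<And>n. h n \<noteq> 0"
  shows "(\<lambda>n. complex_of_real (1 / h n) *\<^sub>C (U (h n) \<psi> - \<psi>) - \<i> *\<^sub>C op \<psi>) \<longlonglongrightarrow> 0"
proof -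
  define y where "y = op \<psi> + \<i> *\<^sub>C \<psi>"
  have Ry: "R y = \<psi>" unfolding y_def by (rule R_op[OF \<psi>])
  define r where "r x = 1 / (complex_of_real x + \<i>)" for x
  define F where "F n x = complex_of_real (1 / h n) * ((iexp (h n * x) - 1) * r x) - \<i> * (1 - \<i>
      * r x)" for n x
  define T where "T n y = complex_of_real (1 / h n) *\<^sub>C (U (h n) (R y) - R y) - \<i> *\<^sub>C (y - \<i> *\<^sub>C
      R y)" for n y
  have xr: "1 - \<i> * r x = complex_of_real x * r x" for x by (simp add: r_def field_simps)
  have "(\<lambda>n. T n y) \<longlonglongrightarrow> 0"
  proof (rule fc_null[where F = F and K = 2])
    fix n
    show "fc (F n) (T n)"
      unfolding F_def T_def r_def
      by (intro fc_diff fc_scale fc_one fc_R fc_mult[of "\<lambda>x. iexp (h n * x) - 1" "\<lambda>\<psi>. U (h n) \<psi>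
          - \<psi>"] fc_U)
  next
    fix n x
    have "cmod (complex_of_real (1 / h n) * ((iexp (h n * x) - 1) * r x))
        = cmod (iexp (h n * x) - 1) / \<bar>h n\<bar> * cmod (r x)"
      by (simp add: norm_mult norm_divide)
    also have "\<dots> \<le> \<bar>x\<bar> * cmod (r x)"
      using norm_iexp_minus_1_le[of "h n * x"] h(2)[of n]
      by (intro mult_right_mono) (auto simp: divide_le_eq abs_mult mult.commute)
    also have "\<dots> = cmod (complex_of_real x / (complex_of_real x + \<i>))"
      by (simp add: r_def norm_divide)
    also have "\<dots> \<le> 1" by (rule norm_id_plus_i_le)
    finally have 1: "cmod (complex_of_real (1 / h n) * ((iexp (h n * x) - 1) * r x)) \<le> 1" .
    have "cmod (\<i> * (1 - \<i> * r x)) = cmod (complex_of_real x / (complex_of_real x + \<i>))"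
      unfolding xr by (simp add: norm_mult r_def norm_divide)
    then have 2: "cmod (\<i> * (1 - \<i> * r x)) \<le> 1" using norm_id_plus_i_le[of x] by simp
    show "cmod (F n x) \<le> 2"
      unfolding F_def using 1 2 norm_triangle_ineq4 by (smt (verit, ccfv_SIG))
  next
    fix x
    have "((\<lambda>z. exp (\<i> * complex_of_real x * z)) has_field_derivative \<i> * complex_of_real x) (at 0)"
      by (auto intro!: derivative_eq_intros)
    then have "((\<lambda>z. (exp (\<i> * complex_of_real x * z) - 1) / z) \<longlongrightarrow> \<i> * complex_of_real x) (at 0)"
      by (simp add: has_field_derivative_iff)
    moreover have "filterlim (\<lambda>n. complex_of_real (h n)) (at 0) sequentially"
      using tendsto_of_real[OF h(1)] h(2) by (intro filterlim_atI) auto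
    ultimately have "(\<lambda>n. (exp (\<i> * complex_of_real x * complex_of_real (h n)) - 1) /
        complex_of_real (h n)) \<longlonglongrightarrow> \<i> * complex_of_real x"
      by (rule filterlim_compose)
    then have "(\<lambda>n. (exp (\<i> * complex_of_real x * complex_of_real (h n)) - 1) / complex_of_real
        (h n) * r x - \<i> * (complex_of_real x * r x))
        \<longlonglongrightarrow> \<i> * complex_of_real x * r x - \<i> * (complex_of_real x * r x)"
      by (intro tendsto_intros)
    then show "(\<lambda>n. F n x) \<longlonglongrightarrow> 0"
      unfolding F_def xr by (simp add: mult_ac)
  qed
  then show ?thesis unfolding T_def Ry by (simp add: y_def)
qed

text \<open>The functional calculus knows only limits of sequences, so the derivative is reduced to
  null sequences.\<close>

lemma has_vector_derivative_sequentiallyI: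
  fixes f :: "real \<Rightarrow> 'b::real_normed_vector"
  assumes "\<And>h. h \<longlonglongrightarrow> 0 \<Longrightarrow> (\<And>n. h n \<noteq> 0) \<Longrightarrow> (\<lambda>n. (1 / h n) *\<^sub>R (f (a + h n) - f a) - v) \<longlonglongrightarrow> 0"
  shows "(f has_vector_derivative v) (at a)"
proof -
  have "((\<lambda>h. norm (f (a + h) - f a - h *\<^sub>R v) / norm h) \<longlongrightarrow> 0) (at 0)"
    unfolding LIMSEQ_SEQ_conv[symmetric]
  proof (intro allI impI)
    fix h :: "nat \<Rightarrow> real" assume h: "(\<forall>n. h n \<noteq> 0) \<and> h \<longlonglongrightarrow> 0"
    have "norm (f (a + h n) - f a - h n *\<^sub>R v) / norm (h n) = norm ((1 / h n) *\<^sub>R (f (a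
        + h n) - f a) - v)" for n
    proof -
      have "(1 / h n) *\<^sub>R (f (a + h n) - f a) - v = (1 / h n) *\<^sub>R (f (a + h n) - f a - h n *\<^sub>R v)"
        using h by (simp add: scaleR_diff_right)
      then show ?thesis by simp
    qed
    moreover have "(\<lambda>n. (1 / h n) *\<^sub>R (f (a + h n) - f a) - v) \<longlonglongrightarrow> 0" using assms h by blast
    ultimately show "(\<lambda>n. norm (f (a + h n) - f a - h n *\<^sub>R v) / norm (h n)) \<longlonglongrightarrow> 0"
      by (simp add: tendsto_norm_zero)
  qed
  then show ?thesis
    unfolding has_vector_derivative_def has_derivative_at by (simp add: bounded_linear_scaleR_left)
qed

lemma U_generator:
  assumes "\<psi> \<in> D"
  shows "((\<lambda>s. U s \<psi>) has_vector_derivative \<i> *\<^sub>C op \<psi>) (at 0)"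
proof (rule has_vector_derivative_sequentiallyI)
  fix h :: "nat \<Rightarrow> real" assume "h \<longlonglongrightarrow> 0" "\<And>n. h n \<noteq> 0"
  from U_generator_aux[OF assms this]
  show "(\<lambda>n. (1 / h n) *\<^sub>R (U (0 + h n) \<psi> - U 0 \<psi>) - \<i> *\<^sub>C op \<psi>) \<longlonglongrightarrow> 0"
    by (simp add: U_0 scaleR_scaleC)
qed

lemma unitary_group_generator_symmetric:
  assumes W: "unitary_group W"
    and x: "((\<lambda>s. W s x) has_vector_derivative \<i> *\<^sub>C x') (at 0)"
    and y: "((\<lambda>s. W s y) has_vector_derivative \<i> *\<^sub>C y') (at 0)"
  shows "cinner x y' = cinner (x' :: 'a) y"
proof -
  have "((\<lambda>s. cinner (W s x) (W s y)) has_vector_derivative cinner (W 0 x) (\<i> *\<^sub>C y')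
      + cinner (\<i> *\<^sub>C x') (W 0 y)) (at 0)"
    by (rule bounded_bilinear.has_vector_derivative[OF bounded_bilinear_cinner x y])
  moreover have "cinner (W s x) (W s y) = cinner x y" for s
    using W unfolding unitary_group_def unitary_def by blast
  ultimately have "((\<lambda>s. cinner x y) has_vector_derivative cinner x (\<i> *\<^sub>C y')
      + cinner (\<i> *\<^sub>C x') y) (at 0)"
    using W unfolding unitary_group_def by simp
  then have "cinner x (\<i> *\<^sub>C y') + cinner (\<i> *\<^sub>C x') y = 0"
    using vector_derivative_unique_at has_vector_derivative_const by blast
  then show ?thesis by (simp add: cinner_simps algebra_simps)
qed

text \<open>The generator is symmetric and extends \<open>A\<close>; by \<open>op_maximal\<close> a
  self-adjoint operator has no proper symmetric extension.\<close>

lemma U_generator_iff: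
  "A x = Some y \<longleftrightarrow> ((\<lambda>s. U s x) has_vector_derivative \<i> *\<^sub>C y) (at 0)"
proof
  assume "A x = Some y"
  then show "((\<lambda>s. U s x) has_vector_derivative \<i> *\<^sub>C y) (at 0)"
    using U_generator by (auto simp: A_eq_Some_iff)
next
  assume x: "((\<lambda>s. U s x) has_vector_derivative \<i> *\<^sub>C y) (at 0)"
  have "cinner x (op z) = cinner y z" if "z \<in> D" for z
    by (rule unitary_group_generator_symmetric[OF unitary_group_U x U_generator[OF that]])
  then show "A x = Some y" using op_maximal A_eq_Some_iff by blast
qed

text \<open>Difference quotients at \<open>s\<close> are images under \<open>W s\<close> of those at
  0, so \<open>W s\<close> preserves the domain and commutes with \<open>A\<close>. It is stated for
  any group with generator \<open>A\<close> because the uniqueness proof applies it to two of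
  them.\<close>

lemma group_derivative:
  assumes W: "unitary_group W"
    and gen: "\<And>x y. A x = Some y \<longleftrightarrow> ((\<lambda>s. W s x) has_vector_derivative \<i> *\<^sub>C y) (at 0)"
    and x: "x \<in> D"
  shows "W s x \<in> D" "((\<lambda>s. W s x) has_vector_derivative \<i> *\<^sub>C op (W s x)) (at s)"
proof -
  have lin: "clinear (W s)" and isom: "norm (W s z) = norm z" and add: "W (s + t) = W s \<circ> W t"
      for s t z
  proof -
    show "clinear (W s)" "W (s + t) = W s \<circ> W t" using W unfolding unitary_group_def unitary_def
        by blast+
    have "cinner (W s z) (W s z) = cinner z z" using W unfolding unitary_group_def unitary_def
        by blast
    then have "(norm (W s z))\<^sup>2 = (norm z)\<^sup>2" by (simp add: norm_sq_cinner)
    then show "norm (W s z) = norm z" by simp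
  qed
  have bl: "bounded_linear (W s)"
    by (rule bounded_linear_intro[where K = 1])
       (auto simp: clinear_add[OF lin] clinear_scaleC[OF lin] scaleR_scaleC isom)
  have "((\<lambda>h. W h x) has_vector_derivative \<i> *\<^sub>C op x) (at 0)"
    using gen[of x "op x"] x A_eq_Some_iff by blast
  from bounded_linear.has_vector_derivative[OF bl this]
  have d: "((\<lambda>h. W (s + h) x) has_vector_derivative W s (\<i> *\<^sub>C op x)) (at 0)" by (simp add: add)
  moreover have "W (s + h) x = W h (W s x)" for h using add[of h s] by (simp add: add.commute)
  ultimately have "((\<lambda>h. W h (W s x)) has_vector_derivative \<i> *\<^sub>C W s (op x)) (at 0)"
    by (simp add: clinear_scaleC[OF lin])
  then have AW: "A (W s x) = Some (W s (op x))" using gen by blast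
  then show "W s x \<in> D" by (simp add: A_eq_Some_iff)
  have "((\<lambda>t. t - s) has_vector_derivative 1) (at s)" by (auto intro!: derivative_eq_intros)
  moreover have "((\<lambda>h. W (s + h) x) has_vector_derivative W s (\<i> *\<^sub>C op x)) (at (s - s))"
      using d by simp
  ultimately have "((\<lambda>h. W (s + h) x) \<circ> (\<lambda>t. t - s) has_vector_derivative 1 *\<^sub>R W s (\<i> *\<^sub>C op
      x)) (at s)"
    by (rule vector_diff_chain_at)
  then show "((\<lambda>s. W s x) has_vector_derivative \<i> *\<^sub>C op (W s x)) (at s)"
    using AW by (simp add: comp_def clinear_scaleC[OF lin] A_eq_Some_iff)
qed

text \<open>Two groups with generator \<open>A\<close> agree on the domain because the squared distance of the
  orbits is constant.\<close>

lemma unitary_group_unique: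
  assumes W: "unitary_group W"
    and gen: "\<And>x y. A x = Some y \<longleftrightarrow> ((\<lambda>s. W s x) has_vector_derivative \<i> *\<^sub>C y) (at 0)"
  shows "W = U"
proof (intro ext)
  fix s x
  have D_eq: "W s x = U s x" if x: "x \<in> D" for x
  proof -
    define d where "d s = W s x - U s x" for s
    have dD: "d s \<in> D" for s
      unfolding d_def using group_derivative(1)[OF W gen x] group_derivative(1)[OF
          unitary_group_U U_generator_iff x] by auto
    have "(d has_vector_derivative \<i> *\<^sub>C op (d s)) (at s)" for s
      using has_vector_derivative_diff[OF group_derivative(2)[OF W gen x] group_derivative(2)[OF
          unitary_group_U U_generator_iff x]]
        group_derivative(1)[OF W gen x] group_derivative(1)[OF unitary_group_U U_generator_iff x]
      unfolding d_def by (simp add: op_diff cvec.scale_right_diff_distrib)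
    from bounded_bilinear.has_vector_derivative[OF bounded_bilinear_cinner this this]
    have "((\<lambda>s. cinner (d s) (d s)) has_vector_derivative 0) (at s)" for s
      using op_symmetric[OF dD dD] by (simp add: cinner_simps)
    then have "\<exists>c. \<forall>s\<in>UNIV. cinner (d s) (d s) = c"
      by (intro has_derivative_zero_constant) (auto simp: has_vector_derivative_def)
    then have "cinner (d s) (d s) = cinner (d 0) (d 0)" by auto
    also have "d 0 = 0" using W U_0 unfolding d_def unitary_group_def by simp
    finally show ?thesis by (simp add: d_def)
  qed
  have lin: "clinear (W s)" and isom: "norm (W s z) = norm z" for z
  proof -
    show "clinear (W s)" using W unfolding unitary_group_def unitary_def by blast
    have "cinner (W s z) (W s z) = cinner z z" using W unfolding unitary_group_def unitary_def
        by blast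
    then have "(norm (W s z))\<^sup>2 = (norm z)\<^sup>2" by (simp add: norm_sq_cinner)
    then show "norm (W s z) = norm z" by simp
  qed
  have bl: "bounded_linear T" if "clinear T" "\<And>z. norm (T z) = norm z" for T :: "'a \<Rightarrow> 'a"
    by (rule bounded_linear_intro[where K = 1])
       (auto simp: clinear_add[OF that(1)] clinear_scaleC[OF that(1)] scaleR_scaleC that(2))
  obtain f where f: "\<And>n. f n \<in> D" "f \<longlonglongrightarrow> x" using closure_sequenceE[of x D] D_dense by auto
  have "(\<lambda>n. W s (f n)) \<longlonglongrightarrow> W s x" "(\<lambda>n. U s (f n)) \<longlonglongrightarrow> U s x"
    by (rule bounded_linear.tendsto[OF bl f(2)], use lin isom clinear_U norm_U in auto)+
  then show "W s x = U s x" unfolding D_eq[OF f(1)] by (rule LIMSEQ_unique)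
qed

lemma exp_i_eq_U: "exp_i A = U"
  unfolding exp_i_def using unitary_group_U U_generator_iff unitary_group_unique
  by (intro the_equality) blast+

text \<open>Both measures have the Fourier transform \<open>cinner \<psi> (U s \<psi>)\<close>; this
  resolves the last definite description of the statement.\<close>

lemma spectral_measure_eq_smeas: "spectral_measure A \<psi> = smeas \<psi>"
  unfolding spectral_measure_def exp_i_eq_U
proof (rule the_equality)
  have c: "cinner \<psi> (U s \<psi>) = (CLINT x|smeas \<psi>. iexp (s * x))" for s
    using fc_cinner[OF fc_one fc_U, of \<psi> s] by simp
  show "finite_borel_measure (smeas \<psi>) \<and> (\<forall>s. cinner \<psi> (U s \<psi>) = (CLINT E|smeas \<psi>. iexp (s * E)))"
    using finite_borel_measure_smeas c by simp
  show "\<mu> = smeas \<psi>" if "finite_borel_measure \<mu> \<and> (\<forall>s. cinner \<psi> (U s \<psi>)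
      = (CLINT E|\<mu>. iexp (s * E)))" for \<mu>
    by (rule finite_borel_measure_eqI_iexp) (use that finite_borel_measure_smeas c in auto)
qed

end

section \<open>Discrete and essential spectrum\<close>

text \<open>Each functional \<open>cinner f\<close> cuts the dimension by at most one, so dropping
  it from \<open>F\<close> costs one further spanning vector \<open>x0\<close>.\<close>

lemma subspace_finite_dim:
  fixes X :: "'a::chilbert_space set"
  assumes "finite F" "cvec.subspace X" "\<And>x. x \<in> X \<Longrightarrow> (\<And>f. f \<in> F \<Longrightarrow> cinner f x = 0) \<Longrightarrow> x = 0"
  shows "\<exists>G. finite G \<and> X = cvec.span G"
  using assms
proof (induction F arbitrary: X rule: finite_induct)
  case empty
  then have "X = {0}" using cvec.subspace_0 by blast
  then show ?case by (intro exI[of _ "{}"]) simp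
next
  case (insert f F)
  define X' where "X' = {x \<in> X. cinner f x = 0}"
  have sub: "cvec.subspace X'"
    unfolding X'_def
    by (rule cvec.subspaceI)
       (use insert.prems(1) in \<open>auto simp: cinner_simps cvec.subspace_0
           cvec.subspace_add cvec.subspace_scale\<close>)
  have "\<exists>G. finite G \<and> X' = cvec.span G"
    by (rule insert.IH[OF sub]) (use insert.prems(2) in \<open>auto simp: X'_def\<close>)
  then obtain G where G: "finite G" "X' = cvec.span G" by blast
  show ?case
  proof (cases "X' = X")
    case True
    then show ?thesis using G by blast
  next
    case False
    then obtain x0 where x0: "x0 \<in> X" "cinner f x0 \<noteq> 0" unfolding X'_def by blast
    have "G \<subseteq> X'" unfolding G(2) by (rule cvec.span_superset)
    then have "cvec.span (insert x0 G) \<subseteq> X"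
      using x0 by (intro cvec.span_minimal insert.prems(1)) (auto simp: X'_def)
    moreover have "x \<in> cvec.span (insert x0 G)" if x: "x \<in> X" for x
    proof -
      define c where "c = cinner f x / cinner f x0"
      have "x - c *\<^sub>C x0 \<in> X'"
        using x x0 insert.prems(1)
        by (auto simp: X'_def c_def cinner_simps intro: cvec.subspace_diff cvec.subspace_scale)
      then show ?thesis unfolding G(2) cvec.span_insert by blast
    qed
    ultimately show ?thesis using G(1) by (intro exI[of _ "insert x0 G"]) auto
  qed
qed

lemma orthogonal_independent:
  fixes B :: "'a::chilbert_space set"
  assumes B: "finite B" "\<And>x y. x \<in> B \<Longrightarrow> y \<in> B \<Longrightarrow> x \<noteq> y \<Longrightarrow> cinner x y = 0" "0 \<notin> B"
  shows "cvec.independent B"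
proof
  assume "cvec.dependent B"
  then obtain u v where u: "v \<in> B" "u v \<noteq> 0" "(\<Sum>x\<in>B. u x *\<^sub>C x) = 0"
    using cvec.dependent_finite[OF B(1)] by blast
  have "0 = cinner v (\<Sum>x\<in>B. u x *\<^sub>C x)" using u(3) by simp
  also have "\<dots> = (\<Sum>x\<in>B. if x = v then u v * cinner v v else 0)"
    unfolding cinner_sum_right using B(2)[OF u(1)]
    by (intro sum.cong refl) (auto simp: cinner_scaleC_right)
  also have "\<dots> = u v * cinner v v" using B(1) u(1) by simp
  finally show False using u B(3) by auto
qed

text \<open>Weyl's criterion with singular sequences replaced by approximate eigenvectors orthogonal
  to any prescribed finite set. In this form stability under Hilbert-Schmidt perturbations is
  direct, and orthonormal families can be chosen one vector at a time.\<close>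

definition ess_spectrum :: "('a::chilbert_space \<rightharpoonup> 'a) \<Rightarrow> real set"
  where "ess_spectrum A = {E. \<forall>\<tau>>0. \<forall>F. finite F \<longrightarrow>
    (\<exists>u y. A u = Some y \<and> norm u = 1 \<and> (\<forall>f\<in>F. cinner f u = 0)
        \<and> norm (y - complex_of_real E *\<^sub>C u) < \<tau>)}"

text \<open>Replacing \<open>E\<close> by \<open>E'\<close> changes the residual of a unit vector by
  at most \<open>\<bar>E' - E\<bar>\<close>, so the obstruction at \<open>E\<close> persists within
  \<open>\<tau> / 2\<close>. The bound becomes one of the constraints on the scale \<open>s\<close>
  in \<open>almost_diagonal\<close>.\<close>

lemma ess_spectrum_closed:
  assumes E: "E \<notin> ess_spectrum (A :: 'a::chilbert_space \<rightharpoonup> 'a)"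
  shows "\<exists>s>0. \<forall>E'\<in>ess_spectrum A. s \<le> \<bar>E' - E\<bar>"
proof -
  obtain \<tau> F where \<tau>: "\<tau> > 0" "finite F"
    and no: "\<And>u y. A u = Some y \<Longrightarrow> norm u = 1 \<Longrightarrow> (\<forall>f\<in>F. cinner f u = 0)
        \<Longrightarrow> \<not> norm (y - complex_of_real E *\<^sub>C u) < \<tau>"
    using E unfolding ess_spectrum_def by blast
  have "\<tau> / 2 \<le> \<bar>E' - E\<bar>" if E': "E' \<in> ess_spectrum A" for E'
  proof (rule ccontr)
    assume lt: "\<not> \<tau> / 2 \<le> \<bar>E' - E\<bar>"
    obtain u y where u: "A u = Some y" "norm u = 1" "\<forall>f\<in>F. cinner f u = 0"
        "norm (y - complex_of_real E' *\<^sub>C u) < \<tau> / 2"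
      using E' \<tau> half_gt_zero[OF \<tau>(1)] unfolding ess_spectrum_def by blast
    have "y - complex_of_real E *\<^sub>C u = (y - complex_of_real E' *\<^sub>C u)
        + complex_of_real (E' - E) *\<^sub>C u"
      by (simp add: cvec.scale_left_diff_distrib)
    then have "norm (y - complex_of_real E *\<^sub>C u) \<le> norm (y - complex_of_real E' *\<^sub>C u)
        + norm (complex_of_real (E' - E) *\<^sub>C u)"
      by (metis norm_triangle_ineq)
    also have "norm (complex_of_real (E' - E) *\<^sub>C u) = \<bar>E' - E\<bar>" using u(2)
        by (simp only: norm_scaleC norm_of_real) simp
    finally have "norm (y - complex_of_real E *\<^sub>C u) < \<tau>" using u(4) lt by linarith
    with no u show False by blast
  qed
  then show ?thesis using half_gt_zero[OF \<tau>(1)] by blast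
qed

context self_adjoint_operator
begin

lemma eigenvalue_real:
  assumes "A \<psi> = Some (E *\<^sub>C \<psi>)" "\<psi> \<noteq> 0"
  shows "E = complex_of_real (Re E)"
proof -
  have "\<psi> \<in> D" "op \<psi> = E *\<^sub>C \<psi>" using assms(1) by (auto simp: A_eq_Some_iff)
  then have "cnj E * cinner \<psi> \<psi> = E * cinner \<psi> \<psi>"
    using op_symmetric[of \<psi> \<psi>] by (simp add: cinner_simps)
  then have "cnj E = E" using assms(2) by simp
  then show ?thesis by (metis Reals_cnj_iff of_real_Re)
qed

lemma eigenspace_subspace: "cvec.subspace (eigenspace A E)"
  by (rule cvec.subspaceI)
     (auto simp: eigenspace_def A_eq_Some_iff op_add op_scale scaleC_add_right mult.commute)

text \<open>One identity for \<open>S\<close> and \<open>T\<close> gives a two-sided inverse: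
  \<open>fc_domain\<close> puts \<open>A\<close> after \<open>T\<close>, and \<open>fc_op\<close>
  puts it before.\<close>

lemma resolvent_setI:
  assumes T: "fc f T" and S: "fc (\<lambda>x. complex_of_real x * f x) S" and inv: "\<And>\<psi>. S \<psi> - z *\<^sub>C T \<psi> = \<psi>"
  shows "z \<in> resolvent_set A"
proof -
  have ST: "S \<psi> = T (op \<psi>)" if "\<psi> \<in> D" for \<psi>
    by (rule fc_op[OF T _ that]) (use S in \<open>simp add: mult.commute\<close>)
  have left: "T (op \<psi> - z *\<^sub>C \<psi>) = \<psi>" if "\<psi> \<in> D" for \<psi>
    using inv[of \<psi>] ST[OF that] by (simp add: clinear_diff[OF fc_clinear[OF T]]
        clinear_scaleC[OF fc_clinear[OF T]])
  have right: "T \<psi> \<in> D" "op (T \<psi>) - z *\<^sub>C T \<psi> = \<psi>" for \<psi>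
    using fc_domain[OF T S] inv by auto
  have "bij_betw (\<lambda>x. op x - z *\<^sub>C x) D UNIV"
    by (rule bij_betw_byWitness[where f' = T]) (use left right in auto)
  moreover obtain K where "\<And>\<psi>. norm (T \<psi>) \<le> K * norm \<psi>" using fc_bounded_operator[OF T] by blast
  then have "\<forall>x\<in>D. norm x \<le> K * norm (op x - z *\<^sub>C x)" using left by metis
  ultimately show ?thesis unfolding resolvent_set_def D_def op_def by blast
qed

lemma nonreal_resolvent_set:
  assumes z: "Im z \<noteq> 0"
  shows "z \<in> resolvent_set A"
proof -
  have nz: "complex_of_real x - z \<noteq> 0" for x using z by (auto simp: complex_eq_iff)
  define f where "f x = 1 / (complex_of_real x - z)" for x
  have "\<exists>T. fc f T"
  proof (rule fc_continuous)
    show "continuous_on UNIV f" unfolding f_def using nz by (intro continuous_intros) auto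
    show "cmod (f x) \<le> 1 / \<bar>Im z\<bar>" for x
    proof -
      have "\<bar>Im z\<bar> \<le> cmod (complex_of_real x - z)" using abs_Im_le_cmod[of "complex_of_real x
          - z"] by simp
      then show ?thesis using z by (simp add: f_def norm_divide frac_le)
    qed
  qed
  then obtain T where T: "fc f T" by blast
  have "complex_of_real x * f x = 1 + z * f x" for x
    using nz[of x] by (simp add: f_def field_simps)
  then have "fc (\<lambda>x. complex_of_real x * f x) (\<lambda>\<psi>. \<psi> + z *\<^sub>C T \<psi>)"
    using fc_add[OF fc_one fc_scale[OF T, of z]] by simp
  then show ?thesis by (rule resolvent_setI[OF T]) simp
qed

text \<open>A bounded continuous substitute for \<open>1 / (x - r)\<close> that agrees with it at
  distance at least \<open>\<delta>\<close> from \<open>r\<close>. It yields resolvents at points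
  without spectral mass nearby and the tail estimate \<open>proj_away\<close>.\<close>

lemma clipped_inverse:
  fixes r \<delta> :: real
  assumes \<delta>: "\<delta> > 0"
  defines "f \<equiv> \<lambda>x. (x - r) / max (\<delta>\<^sup>2) ((x - r)\<^sup>2)"
  shows "\<exists>T. fc (\<lambda>x. complex_of_real (f x)) T" "continuous_on UNIV f" "\<bar>f x\<bar> \<le> 1 / \<delta>"
    "0 \<le> (x - r) * f x" "(x - r) * f x \<le> 1" "\<delta> \<le> \<bar>x - r\<bar> \<Longrightarrow> (x - r) * f x = 1"
proof -
  have mpos: "max (\<delta>\<^sup>2) ((x - r)\<^sup>2) > 0" for x using \<delta> by (simp add: less_max_iff_disj)
  have mnz: "max (\<delta>\<^sup>2) ((x - r)\<^sup>2) \<noteq> 0" for x using mpos[of x] by simp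
  show fcont: "continuous_on UNIV f" unfolding f_def by (intro continuous_intros) (use mnz in auto)
  have fbound: "\<bar>f x\<bar> \<le> 1 / \<delta>" for x
  proof -
    have "\<bar>x - r\<bar> * \<delta> \<le> max (\<delta>\<^sup>2) ((x - r)\<^sup>2)"
    proof (cases "\<bar>x - r\<bar> \<le> \<delta>")
      case True
      then have "\<bar>x - r\<bar> * \<delta> \<le> \<delta> * \<delta>" using \<delta> by (intro mult_right_mono) auto
      then show ?thesis by (simp add: power2_eq_square le_max_iff_disj)
    next
      case False
      then have "\<bar>x - r\<bar> * \<delta> \<le> \<bar>x - r\<bar> * \<bar>x - r\<bar>" by (intro mult_left_mono) auto
      then show ?thesis by (simp add: power2_eq_square le_max_iff_disj)
    qed
    then show ?thesis using \<delta> mpos[of x] by (simp add: f_def abs_divide field_simps abs_of_pos)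
  qed
  then show "\<bar>f x\<bar> \<le> 1 / \<delta>" .
  show "\<exists>T. fc (\<lambda>x. complex_of_real (f x)) T" by (rule fc_continuous_real[OF fcont fbound])
  show "0 \<le> (x - r) * f x" "(x - r) * f x \<le> 1"
    using mpos[of x] unfolding f_def by (auto simp: power2_eq_square divide_le_eq
        intro!: divide_nonneg_nonneg)
  show "(x - r) * f x = 1" if "\<delta> \<le> \<bar>x - r\<bar>"
  proof -
    have "\<delta>\<^sup>2 \<le> (x - r)\<^sup>2" using \<delta> that by (auto simp: abs_le_square_iff[symmetric])
    moreover have "x - r \<noteq> 0" using that \<delta> by auto
    ultimately show ?thesis by (simp add: f_def max_absorb2 power2_eq_square)
  qed
qed

text \<open>The defect \<open>g = 1 - (x - r) f\<close> lives in the ball, where the spectral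
  projection is 0; hence \<open>g(A) = 0\<close> and \<open>f(A)\<close> inverts
  \<open>A - r\<close>. Used contrapositively: every ball around a spectral point has a nonzero
  spectral projection.\<close>

lemma proj_null_resolvent_set:
  assumes \<delta>: "\<delta> > 0" and null: "\<And>\<psi>. proj (ball r \<delta>) \<psi> = 0"
  shows "complex_of_real r \<in> resolvent_set A"
proof -
  define f where "f = (\<lambda>x. (x - r) / max (\<delta>\<^sup>2) ((x - r)\<^sup>2))"
  define g where "g x = 1 - (x - r) * f x" for x
  have f: "\<exists>T. fc (\<lambda>x. complex_of_real (f x)) T" "continuous_on UNIV f" "0 \<le> (x - r) * f x"
      "(x - r) * f x \<le> 1" "\<delta> \<le> \<bar>x - r\<bar> \<Longrightarrow> (x - r) * f x = 1" for x
    unfolding f_def by (rule clipped_inverse[OF \<delta>]; assumption?)+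
  have gbound: "\<bar>g x\<bar> \<le> 1" for x using f(3,4)[of x] by (simp add: g_def)
  have gsupp: "g x = g x * indicator (ball r \<delta>) x" for x
  proof (cases "x \<in> ball r \<delta>")
    case False
    then have "g x = 0" using f(5)[of x] by (simp add: g_def dist_real_def abs_minus_commute)
    then show ?thesis by simp
  qed simp
  obtain T where T: "fc (\<lambda>x. complex_of_real (f x)) T" using f(1) by blast
  have "continuous_on UNIV g" unfolding g_def by (intro continuous_intros f(2))
  then obtain Q where Q: "fc (\<lambda>x. complex_of_real (g x)) Q"
      using fc_continuous_real[of g, OF _ gbound] by blast
  have "(\<lambda>x. complex_of_real (g x) * indicator (ball r \<delta>) x) = (\<lambda>x. complex_of_real (g x))"
  proof
    fix x
    show "complex_of_real (g x) * indicator (ball r \<delta>) x = complex_of_real (g x)"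
      using gsupp[of x] by (auto simp: indicator_def split: if_splits)
  qed
  then have "fc (\<lambda>x. complex_of_real (g x)) (\<lambda>\<psi>. Q (proj (ball r \<delta>) \<psi>))"
    using fc_mult[OF Q fc_proj[of "ball r \<delta>"]] by simp
  from fc_unique[OF Q this] have Q0: "Q \<psi> = 0" for \<psi>
    using null clinear_0[OF fc_clinear[OF Q]] by metis
  have "complex_of_real x * complex_of_real (f x) = (1 - complex_of_real (g x))
      + complex_of_real r * complex_of_real (f x)" for x
    by (simp add: g_def algebra_simps)
  then have "fc (\<lambda>x. complex_of_real x * complex_of_real (f x)) (\<lambda>\<psi>. (\<psi> - Q \<psi>)
      + complex_of_real r *\<^sub>C T \<psi>)"
    using fc_add[OF fc_diff[OF fc_one Q] fc_scale[OF T, of "complex_of_real r"]] by simp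
  then show ?thesis by (rule resolvent_setI[OF T]) (simp add: Q0)
qed

lemma proj_mult:
  assumes "S \<in> sets borel" "S' \<in> sets borel"
  shows "proj S (proj S' \<psi>) = proj (S \<inter> S') \<psi>"
proof -
  have "fc (indicator (S \<inter> S')) (\<lambda>\<psi>. proj S (proj S' \<psi>))"
    using fc_mult[OF fc_proj[OF assms(1)] fc_proj[OF assms(2)]]
    by (simp add: indicator_inter_arith[symmetric])
  then have "(\<lambda>\<psi>. proj S (proj S' \<psi>)) = proj (S \<inter> S')"
    by (rule fc_unique[OF _ fc_proj]) (use assms in auto)
  then show ?thesis by (rule fun_cong)
qed

lemma proj_empty: "proj {} \<psi> = 0"
proof -
  have "proj {} = (\<lambda>\<psi>. 0 *\<^sub>C \<psi>)"
    by (rule fc_unique[OF fc_proj]) (use fc_const[of 0] in \<open>auto simp: indicator_def[abs_def]\<close>)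
  then show ?thesis by simp
qed

lemma clinear_proj: "S \<in> sets borel \<Longrightarrow> clinear (proj S)"
  by (rule fc_clinear[OF fc_proj])

lemma cinner_proj:
  assumes S: "S \<in> sets borel"
  shows "cinner (proj S \<phi>) \<psi> = cinner \<phi> (proj S \<psi>)"
proof -
  obtain T where T: "fc (\<lambda>x. cnj (indicator S x)) T" "\<And>\<phi> \<psi>. cinner (proj S \<phi>) \<psi> = cinner \<phi> (T \<psi>)"
    using fc_adjoint[OF fc_proj[OF S]] by blast
  have "(\<lambda>x. cnj (indicator S x)) = indicator S" by (auto simp: indicator_def)
  then have "T = proj S" using T(1) fc_unique[OF _ fc_proj[OF S]] by simp
  then show ?thesis using T(2) by simp
qed

text \<open>Clipping \<open>x - r\<close> to the interval from \<open>-d\<close> to \<open>d\<close>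
  gives a function in the calculus that is bounded by \<open>d\<close> and unchanged on
  \<open>S\<close>.\<close>

lemma proj_interval_approx:
  assumes S: "S \<in> sets borel" "\<And>x. x \<in> S \<Longrightarrow> \<bar>x - r\<bar> \<le> d" and d: "d \<ge> 0"
  shows "proj S \<psi> \<in> D" "norm (op (proj S \<psi>) - complex_of_real r *\<^sub>C proj S \<psi>) \<le> d * norm (proj S \<psi>)"
proof -
  define g where "g x = max (- d) (min d (x - r))" for x
  have gb: "\<bar>g x\<bar> \<le> d" for x using d by (auto simp: g_def abs_le_iff)
  have "continuous_on UNIV g" unfolding g_def by (intro continuous_intros)
  then obtain Q where Q: "fc (\<lambda>x. complex_of_real (g x)) Q"
      using fc_continuous_real[of g, OF _ gb] by blast
  have "complex_of_real (g x) * indicator S x + complex_of_real r * indicator S x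
      = complex_of_real x * indicator S x" for x
  proof (cases "x \<in> S")
    case True
    then have "g x = x - r" using S(2)[of x] by (auto simp: g_def abs_le_iff)
    with True show ?thesis by simp
  qed simp
  then have "fc (\<lambda>x. complex_of_real x * indicator S x) (\<lambda>\<psi>. Q (proj S \<psi>)
      + complex_of_real r *\<^sub>C proj S \<psi>)"
    using fc_add[OF fc_mult[OF Q fc_proj[OF S(1)]] fc_scale[OF fc_proj[OF S(1)],
        of "complex_of_real r"]] by simp
  from fc_domain[OF fc_proj[OF S(1)] this, of \<psi>]
  have *: "proj S \<psi> \<in> D" "op (proj S \<psi>) - complex_of_real r *\<^sub>C proj S \<psi> = Q (proj S \<psi>)" by auto
  show "proj S \<psi> \<in> D" by fact
  show "norm (op (proj S \<psi>) - complex_of_real r *\<^sub>C proj S \<psi>) \<le> d * norm (proj S \<psi>)"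
    unfolding *(2) by (rule fc_norm_le[OF Q]) (use gb in simp)
qed

text \<open>If Weyl's criterion fails at \<open>E\<close> for \<open>\<tau>\<close> and
  \<open>F\<close>, then no nonzero vector orthogonal to \<open>F\<close> lies in the spectral
  subspace of radius \<open>\<tau> / 2\<close>, which is thus finite-dimensional. Distinct spectral
  points there yield orthogonal nonzero vectors, so there are finitely many of them and
  \<open>E\<close> is isolated.\<close>

lemma disc_spectrum_if_not_ess:
  assumes eig: "A \<psi> = Some (complex_of_real E *\<^sub>C \<psi>)" "\<psi> \<noteq> 0" and E: "E \<notin> ess_spectrum A"
  shows "complex_of_real E \<in> disc_spectrum A"
proof -
  obtain \<tau> F where \<tau>: "\<tau> > 0" "finite F"
    and no: "\<And>u y. A u = Some y \<Longrightarrow> norm u = 1 \<Longrightarrow> (\<forall>f\<in>F. cinner f u = 0)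
        \<Longrightarrow> \<not> norm (y - complex_of_real E *\<^sub>C u) < \<tau>"
    using E unfolding ess_spectrum_def by blast
  \<comment> \<open>Passing to \<open>\<tau> / 2\<close> trades the strict inequality for a
    non-strict one that scales with \<open>norm u\<close> and matches the estimate on the closed
    interval \<open>I\<close> below.\<close>
  have orth: "u = 0" if u: "u \<in> D" "\<And>f. f \<in> F \<Longrightarrow> cinner f u = 0"
      "norm (op u - complex_of_real E *\<^sub>C u) \<le> \<tau> / 2 * norm u" for u
  proof (rule ccontr)
    assume nz: "u \<noteq> 0"
    let ?c = "complex_of_real (1 / norm u)"
    have "A (?c *\<^sub>C u) = Some (?c *\<^sub>C op u)" using u(1) by (auto simp: A_eq_Some_iff op_scale)
    moreover have "norm (?c *\<^sub>C u) = 1" using nz by (simp add: norm_divide)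
    moreover have "\<forall>f\<in>F. cinner f (?c *\<^sub>C u) = 0" using u(2) by (simp add: cinner_scaleC_right)
    ultimately have "\<not> norm (?c *\<^sub>C op u - complex_of_real E *\<^sub>C ?c *\<^sub>C u) < \<tau>" by (rule no)
    moreover have "?c *\<^sub>C op u - complex_of_real E *\<^sub>C ?c *\<^sub>C u
        = ?c *\<^sub>C (op u - complex_of_real E *\<^sub>C u)"
      by (simp add: cvec.scale_right_diff_distrib mult.commute)
    ultimately have "\<not> norm (op u - complex_of_real E *\<^sub>C u) / norm u < \<tau>"
      by (simp add: norm_divide)
    then have "\<tau> * norm u \<le> norm (op u - complex_of_real E *\<^sub>C u)" using nz
        by (simp add: field_simps not_less)
    with u(3) have "\<tau> * norm u \<le> \<tau> / 2 * norm u" by linarith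
    then show False using \<tau>(1) nz by simp
  qed
  have "\<exists>G. finite G \<and> eigenspace A (complex_of_real E) = cvec.span G"
  proof (rule subspace_finite_dim[OF \<tau>(2) eigenspace_subspace])
    fix x assume x: "x \<in> eigenspace A (complex_of_real E)" "\<And>f. f \<in> F \<Longrightarrow> cinner f x = 0"
    show "x = 0" by (rule orth) (use x \<tau> in \<open>auto simp: eigenspace_def A_eq_Some_iff\<close>)
  qed
  moreover have "\<exists>x\<in>eigenspace A (complex_of_real E). x \<noteq> 0"
    using eig by (auto simp: eigenspace_def)
  moreover have "complex_of_real E isolated_in spectrum A"
  proof -
    define I where "I = cball E (\<tau> / 2)"
    have I: "I \<in> sets borel" unfolding I_def by simp
    define X where "X = range (proj I)"
    have Xfix: "proj I x = x" if "x \<in> X" for x using that proj_mult[OF I I] unfolding X_def by auto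
    have "cvec.subspace X"
    proof (rule cvec.subspaceI)
      show "0 \<in> X" unfolding X_def using clinear_0[OF clinear_proj[OF I]] by (metis rangeI)
      show "x + y \<in> X" if "x \<in> X" "y \<in> X" for x y
        using Xfix[OF that(1)] Xfix[OF that(2)] clinear_add[OF clinear_proj[OF I]]
            unfolding X_def by (metis rangeI)
      show "c *\<^sub>C x \<in> X" if "x \<in> X" for c x
        using Xfix[OF that] clinear_scaleC[OF clinear_proj[OF I]] unfolding X_def by (metis rangeI)
    qed
    moreover have "x = 0" if x: "x \<in> X" "\<And>f. f \<in> F \<Longrightarrow> cinner f x = 0" for x
    proof (rule orth)
      have "\<bar>y - E\<bar> \<le> \<tau> / 2" if "y \<in> I" for y using that
          by (auto simp: I_def dist_real_def abs_minus_commute)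
      from proj_interval_approx[OF I this, of x] Xfix[OF x(1)] \<tau>(1)
      show "x \<in> D" "norm (op x - complex_of_real E *\<^sub>C x) \<le> \<tau> / 2 * norm x" by auto
    qed (rule x)
    ultimately obtain G where G: "finite G" "X = cvec.span G" using subspace_finite_dim[OF \<tau>(2)]
        by metis
    define P where "P = {r. complex_of_real r \<in> spectrum A \<and> \<bar>r - E\<bar> < \<tau> / 2}"
    have "finite P"
    proof (rule ccontr)
      assume "infinite P"
      then obtain Q where Q: "Q \<subseteq> P" "finite Q" "card Q = Suc (card G)"
        using infinite_arbitrarily_large by blast
      have "\<exists>\<delta>>0. \<forall>r\<in>Q. \<forall>r'\<in>Q. r \<noteq> r' \<longrightarrow> 2 * \<delta> \<le> \<bar>r - r'\<bar>"
      proof (cases "\<exists>r\<in>Q. \<exists>r'\<in>Q. r \<noteq> r'")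
        case True
        let ?S = "(\<lambda>(r, r'). \<bar>r - r'\<bar>) ` {p \<in> Q \<times> Q. fst p \<noteq> snd p}"
        have fin: "finite ?S" "?S \<noteq> {}" using Q(2) True by auto
        then have "Min ?S \<in> ?S" by (rule Min_in)
        then have "Min ?S > 0" by auto
        moreover have "Min ?S \<le> \<bar>r - r'\<bar>" if "r \<in> Q" "r' \<in> Q" "r \<noteq> r'" for r r'
          by (rule Min_le[OF fin(1)]) (use that in force)
        ultimately show ?thesis by (intro exI[of _ "Min ?S / 2"]) auto
      next
        case False
        then show ?thesis by (intro exI[of _ 1]) auto
      qed
      then obtain \<delta> where \<delta>: "\<delta> > 0" "\<And>r r'. r \<in> Q \<Longrightarrow> r' \<in> Q \<Longrightarrow> r \<noteq> r' \<Longrightarrow> 2 * \<delta> \<le> \<bar>r - r'\<bar>" by blast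
      \<comment> \<open>The first bound on the radius makes the balls disjoint, the second keeps
        them inside \<open>I\<close>.\<close>
      define J where "J r = ball r (min \<delta> (\<tau> / 2 - \<bar>r - E\<bar>))" for r
      have J: "J r \<in> sets borel" for r by (simp add: J_def)
      have "\<exists>u. proj (J r) u \<noteq> 0" if "r \<in> Q" for r
      proof (rule ccontr)
        assume "\<not> (\<exists>u. proj (J r) u \<noteq> 0)"
        then have "complex_of_real r \<in> resolvent_set A"
          unfolding J_def using \<delta>(1) Q(1) that by (intro proj_null_resolvent_set[of "min \<delta> (\<tau> /
              2 - \<bar>r - E\<bar>)"]) (auto simp: P_def)
        then show False using that Q(1) by (auto simp: P_def spectrum_def)
      qed
      then obtain u where u: "\<And>r. r \<in> Q \<Longrightarrow> proj (J r) (u r) \<noteq> 0" by metis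
      define w where "w r = proj (J r) (u r)" for r
      have disj: "J r \<inter> J r' = {}" if "r \<in> Q" "r' \<in> Q" "r \<noteq> r'" for r r'
        using \<delta>(2)[OF that] by (auto simp: J_def dist_real_def)
      have w_orth: "cinner (w r) (w r') = 0" if "r \<in> Q" "r' \<in> Q" "r \<noteq> r'" for r r'
        unfolding w_def cinner_proj[OF J] proj_mult[OF J J] disj[OF that] proj_empty by simp
      have w_nz: "w r \<noteq> 0" if "r \<in> Q" for r using u[OF that] by (simp add: w_def)
      have inj: "inj_on w Q"
      proof (rule inj_onI)
        fix r r' assume "r \<in> Q" "r' \<in> Q" "w r = w r'"
        then show "r = r'" using w_orth[of r r'] w_nz[of r] by force
      qed
      have "cvec.independent (w ` Q)"
        by (rule orthogonal_independent) (use Q(2) w_orth w_nz in force)+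
      moreover have "w ` Q \<subseteq> cvec.span G"
      proof -
        have "proj I (w r) = w r" for r
        proof -
          have "\<bar>E - x\<bar> \<le> \<tau> / 2" if "\<bar>r - x\<bar> < \<tau> / 2 - \<bar>r - E\<bar>" for x using that by linarith
          then have "I \<inter> J r = J r" by (auto simp: I_def J_def dist_real_def)
          then show ?thesis unfolding w_def proj_mult[OF I J] by simp
        qed
        then show ?thesis unfolding G(2)[symmetric] X_def by (metis image_subsetI rangeI)
      qed
      ultimately have "card (w ` Q) \<le> card G" using cvec.independent_span_bound[OF G(1)] by blast
      then show False using card_image[OF inj] Q(3) by simp
    qed
    have E_spec: "complex_of_real E \<in> spectrum A"
    proof -
      have "\<not> inj_on (\<lambda>x. the (A x) - complex_of_real E *\<^sub>C x) (dom A)"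
      proof
        assume "inj_on (\<lambda>x. the (A x) - complex_of_real E *\<^sub>C x) (dom A)"
        moreover have "0 \<in> dom A" "\<psi> \<in> dom A" "the (A \<psi>) = complex_of_real E *\<^sub>C \<psi>" "the (A 0) = 0"
          using eig(1) D_0 op_0 unfolding D_def op_def by auto
        ultimately have "\<psi> = 0" by (auto dest: inj_onD[where x = \<psi> and y = 0])
        then show False using eig(2) by simp
      qed
      then show ?thesis by (auto simp: spectrum_def resolvent_set_def bij_betw_def)
    qed
    \<comment> \<open>\<open>E\<close> belongs to \<open>P\<close>, so only the other points are
      removed; the spectrum is real, and the rest of the disc meets it in \<open>E\<close>
      alone.\<close>
    define T where "T = ball (complex_of_real E) (\<tau> / 2) - complex_of_real ` (P - {E})"
    have "open T" unfolding T_def by (intro open_Diff finite_imp_closed) (use \<open>finite P\<close> in auto)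
    moreover have "T \<inter> spectrum A = {complex_of_real E}"
    proof (intro equalityI subsetI)
      fix z assume z: "z \<in> T \<inter> spectrum A"
      then have "Im z = 0" using nonreal_resolvent_set unfolding spectrum_def by blast
      then have zr: "z = complex_of_real (Re z)" by (simp add: complex_eq_iff)
      then have "\<bar>Re z - E\<bar> < \<tau> / 2" using z unfolding T_def
        by (metis Diff_iff IntD1 dist_commute dist_of_real dist_real_def mem_ball)
      then have "Re z \<in> P" using z zr by (simp add: P_def)
      then show "z \<in> {complex_of_real E}" using z zr unfolding T_def
          by (metis Diff_iff IntD1 image_eqI singletonI singletonD)
    qed (use E_spec \<tau> in \<open>auto simp: T_def\<close>)
    ultimately show ?thesis using E_spec unfolding isolated_in_def by blast
  qed
  ultimately show ?thesis unfolding disc_spectrum_def by blast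
qed

lemma proj_singleton_eigenvector: "A (proj {E} \<psi>) = Some (complex_of_real E *\<^sub>C proj {E} \<psi>)"
  using proj_interval_approx[of "{E}" E 0 \<psi>] by (auto simp: A_eq_Some_iff)

lemma emeasure_smeas: "S \<in> sets borel \<Longrightarrow> emeasure (smeas \<psi>) S = ennreal ((norm (proj S \<psi>))\<^sup>2)"
  using measure_smeas smeas.emeasure_eq_measure by metis

text \<open>The mass of the atom is \<open>cinner (proj {E} \<psi>) \<psi>\<close>, and
  \<open>proj {E} \<psi>\<close> lies in the eigenspace.\<close>

lemma smeas_no_atom:
  assumes "\<And>\<phi>. A \<phi> = Some (complex_of_real E *\<^sub>C \<phi>) \<Longrightarrow> cinner \<phi> \<psi> = 0"
  shows "emeasure (smeas \<psi>) {E} = 0"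
proof -
  have "cinner (proj {E} \<psi>) (proj {E} \<psi>) = cinner (proj {E} \<psi>) \<psi>"
    using cinner_proj[of "{E}" "proj {E} \<psi>" \<psi>] proj_mult[of "{E}" "{E}" \<psi>] by simp
  also have "\<dots> = 0" by (rule assms[OF proj_singleton_eigenvector])
  finally show ?thesis by (simp add: emeasure_smeas)
qed

end

section \<open>Hilbert-Schmidt perturbations\<close>

lemma sa_hilbert_schmidtI:
  fixes T :: "'a::chilbert_space \<Rightarrow> 'a"
  assumes lin: "clinear T" and bd: "\<And>x. norm (T x) \<le> K * norm x"
    and sym: "\<And>x y. cinner y (T x) = cinner (T y) x"
    and sm: "(\<lambda>e. (norm (T e))\<^sup>2) summable_on some_basis"
  shows "T \<in> sa_hilbert_schmidt"
proof -
  have "bounded_linear T"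
    by (rule bounded_linear_intro[where K = K])
       (use bd in \<open>auto simp: clinear_add[OF lin] clinear_scaleC[OF lin] scaleR_scaleC
           mult.commute\<close>)
  moreover have "self_adjoint (\<lambda>x. Some (T x))"
    unfolding self_adjoint_def densely_defined_operator_def
  proof (intro conjI)
    have "dom (\<lambda>x. Some (T x)) = UNIV" by auto
    then show "cvec.subspace (dom (\<lambda>x. Some (T x)))" "closure (dom (\<lambda>x. Some (T x))) = UNIV"
        by simp_all
    then show "adjoint_of (\<lambda>x. Some (T x)) = (\<lambda>x. Some (T x))"
      by (intro ext adjoint_of_eq_SomeI) (auto simp: sym)
  qed (auto simp: clinear_add[OF lin] clinear_scaleC[OF lin])
  ultimately show ?thesis using lin sm unfolding sa_hilbert_schmidt_def hilbert_schmidt_def by simp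
qed

context
  fixes T :: "'a::chilbert_space \<Rightarrow> 'a"
  assumes T: "T \<in> sa_hilbert_schmidt"
begin

lemma sa_hs_clinear: "clinear T"
  and sa_hs_hilbert_schmidt: "hilbert_schmidt T"
  and sa_hs_summable: "(\<lambda>e. (norm (T e))\<^sup>2) summable_on some_basis"
  using T unfolding sa_hilbert_schmidt_def hilbert_schmidt_def by auto

lemma sa_hs_symmetric: "cinner y (T x) = cinner (T y) x"
  using T self_adjoint_total unfolding sa_hilbert_schmidt_def by blast

lemma sa_hs_has_sum: "((\<lambda>e. (norm (T e))\<^sup>2) has_sum (hs_norm T)\<^sup>2) some_basis"
  using has_sum_infsum[OF sa_hs_summable] unfolding hs_norm_def
  by (simp add: infsum_nonneg)

lemma sa_hs_parseval: "((\<lambda>e. (cmod (cinner (T e) x))\<^sup>2) has_sum (norm (T x))\<^sup>2) some_basis"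
  using parseval[OF some_basis, of "T x"] by (simp add: sa_hs_symmetric)

lemma hs_norm_nonneg: "hs_norm T \<ge> 0"
  unfolding hs_norm_def by (simp add: infsum_nonneg)

lemma cmod_cinner_sq_le: "(cmod (cinner (y::'a) x))\<^sup>2 \<le> (norm y)\<^sup>2 * (norm x)\<^sup>2"
  using power_mono[OF cinner_cauchy_schwarz[of y x], of 2] by (simp add: power_mult_distrib)

text \<open>By symmetry the coefficient of \<open>T x\<close> at \<open>e\<close> is
  \<open>cinner (T e) x\<close>; Cauchy-Schwarz is applied term by term in Parseval's sum.\<close>

lemma norm_le_hs_norm: "norm (T x) \<le> hs_norm T * norm x"
proof -
  have "(norm (T x))\<^sup>2 \<le> (hs_norm T)\<^sup>2 * (norm x)\<^sup>2"
    by (rule has_sum_mono[OF sa_hs_parseval has_sum_cmult_left[OF sa_hs_has_sum]])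
       (rule cmod_cinner_sq_le)
  then have "(norm (T x))\<^sup>2 \<le> (hs_norm T * norm x)\<^sup>2" by (simp add: power_mult_distrib)
  then show ?thesis by (rule power2_le_imp_le) (simp add: hs_norm_nonneg)
qed

text \<open>Compactness of \<open>T\<close> in the form that Weyl's theorem uses. \<open>F\<close>
  consists of the images of finitely many basis vectors that carry all but
  \<open>\<tau>\<^sup>2\<close> of the squared norm; orthogonality to them kills the corresponding
  coefficients of \<open>T x\<close>.\<close>

lemma sa_hs_small_on_complement:
  assumes "\<tau> > 0"
  obtains F where "finite F" "\<And>x. (\<And>f. f \<in> F \<Longrightarrow> cinner f x = 0) \<Longrightarrow> norm (T x) \<le> \<tau> * norm x"
proof -
  obtain X where X: "finite X" "X \<subseteq> some_basis"
    and dX: "dist (\<Sum>e\<in>X. (norm (T e))\<^sup>2) ((hs_norm T)\<^sup>2) < \<tau>\<^sup>2"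
    using sa_hs_has_sum assms unfolding has_sum_def tendsto_iff eventually_finite_subsets_at_top
    by (metis subset_refl zero_less_power)
  show thesis
  proof (rule that[of "T ` X"])
    show "finite (T ` X)" using X by simp
    fix x assume orth: "\<And>f. f \<in> T ` X \<Longrightarrow> cinner f x = 0"
    \<comment> \<open>The coefficients over \<open>X\<close> vanish, which leaves room to add their
      majorants; comparison with the full norm then bounds \<open>T x\<close> by the tail.\<close>
    have "((\<lambda>e. if e \<in> X then (norm (T e))\<^sup>2 * (norm x)\<^sup>2 else 0)
        has_sum (\<Sum>e\<in>X. (norm (T e))\<^sup>2) * (norm x)\<^sup>2) some_basis"
      by (rule has_sum_finite_neutralI[OF X]) (auto simp: sum_distrib_right)
    from has_sum_add[OF sa_hs_parseval this]
    have "(norm (T x))\<^sup>2 + (\<Sum>e\<in>X. (norm (T e))\<^sup>2) * (norm x)\<^sup>2 \<le> (hs_norm T)\<^sup>2 * (norm x)\<^sup>2"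
      by (rule has_sum_mono[OF _ has_sum_cmult_left[OF sa_hs_has_sum]])
         (use orth cmod_cinner_sq_le in auto)
    then have "(norm (T x))\<^sup>2 \<le> ((hs_norm T)\<^sup>2 - (\<Sum>e\<in>X. (norm (T e))\<^sup>2)) * (norm x)\<^sup>2"
      by (simp add: algebra_simps)
    also have "\<dots> \<le> \<tau>\<^sup>2 * (norm x)\<^sup>2"
      using dX by (intro mult_right_mono) (auto simp: dist_real_def)
    finally have "(norm (T x))\<^sup>2 \<le> (\<tau> * norm x)\<^sup>2" by (simp add: power_mult_distrib)
    then show "norm (T x) \<le> \<tau> * norm x" by (rule power2_le_imp_le) (use assms in simp)
  qed
qed

end

section \<open>The space of perturbations and Weyl's theorem\<close>

lemma sa_hs_diff:
  fixes S T :: "'a::chilbert_space \<Rightarrow> 'a"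
  assumes S: "S \<in> sa_hilbert_schmidt" and T: "T \<in> sa_hilbert_schmidt"
  shows "(\<lambda>x. S x - T x) \<in> sa_hilbert_schmidt"
proof (rule sa_hilbert_schmidtI[where K = "hs_norm S + hs_norm T"])
  show "clinear (\<lambda>x. S x - T x)"
    using sa_hs_clinear[OF S] sa_hs_clinear[OF T]
    by (intro clinearI) (auto simp: clinear_add clinear_scaleC cvec.scale_right_diff_distrib)
  show "norm (S x - T x) \<le> (hs_norm S + hs_norm T) * norm x" for x
    using norm_triangle_ineq4[of "S x" "T x"] norm_le_hs_norm[OF S, of x] norm_le_hs_norm[OF T,
        of x]
    by (simp add: distrib_right)
  show "cinner y (S x - T x) = cinner (S y - T y) x" for x y
    by (simp add: cinner_simps sa_hs_symmetric[OF S] sa_hs_symmetric[OF T])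
qed (rule hilbert_schmidt_diff_summable[OF sa_hs_hilbert_schmidt[OF S] sa_hs_hilbert_schmidt[OF T]])

lemma zero_sa_hs: "(\<lambda>x::'a::chilbert_space. 0) \<in> sa_hilbert_schmidt"
  by (rule sa_hilbert_schmidtI[where K = 0]) (auto intro: clinearI)

lemma sa_hs_uminus: "T \<in> sa_hilbert_schmidt \<Longrightarrow> (\<lambda>x. - T x :: 'a::chilbert_space) \<in>
    sa_hilbert_schmidt"
  using sa_hs_diff[OF zero_sa_hs] by force

lemma sa_hs_add:
  "S \<in> sa_hilbert_schmidt \<Longrightarrow> T \<in> sa_hilbert_schmidt \<Longrightarrow> (\<lambda>x. S x
      + T x :: 'a::chilbert_space) \<in> sa_hilbert_schmidt"
  using sa_hs_diff[OF _ sa_hs_uminus, of S T] by simp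

lemma norm_diff_le_hs_dist:
  assumes "S \<in> sa_hilbert_schmidt" "T \<in> sa_hilbert_schmidt"
  shows "norm (S x - T x) \<le> hs_dist S T * norm (x::'a::chilbert_space)"
  using norm_le_hs_norm[OF sa_hs_diff[OF assms]] unfolding hs_dist_def .

lemma perturb_eq_Some_iff: "perturb A C x = Some y \<longleftrightarrow> A x = Some (y - C (x::'a::chilbert_space))"
  unfolding perturb_def by (auto simp: algebra_simps)

lemma self_adjoint_perturb:
  fixes A :: "'a::chilbert_space \<rightharpoonup> 'a"
  assumes A: "self_adjoint A" and C: "C \<in> sa_hilbert_schmidt"
  shows "self_adjoint (perturb A C)"
proof -
  interpret self_adjoint_operator A by unfold_locales fact
  have dom: "dom (perturb A C) = D" by (auto simp: perturb_def D_def)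
  have val: "the (perturb A C x) = op x + C x" if "x \<in> D" for x
    using that by (auto simp: perturb_def D_def op_def)
  have dense: "closure (dom (perturb A C)) = UNIV" by (simp add: dom D_dense)
  have "adjoint_of (perturb A C) y = Some z \<longleftrightarrow> perturb A C y = Some z" for y z
  proof
    assume z: "adjoint_of (perturb A C) y = Some z"
    have "cinner y (op x) = cinner (z - C y) x" if "x \<in> D" for x
      using adjoint_of_SomeD[OF dense z] that
      by (simp add: dom val cinner_simps sa_hs_symmetric[OF C] eq_diff_eq)
    then have "y \<in> D \<and> op y = z - C y" by (rule op_maximal)
    then show "perturb A C y = Some z" unfolding perturb_eq_Some_iff A_eq_Some_iff .
  next
    assume "perturb A C y = Some z"
    then have y: "y \<in> D" "op y = z - C y" unfolding perturb_eq_Some_iff A_eq_Some_iff by auto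
    show "adjoint_of (perturb A C) y = Some z"
    proof (rule adjoint_of_eq_SomeI[OF dense])
      fix x assume "x \<in> dom (perturb A C)"
      then show "cinner y (the (perturb A C x)) = cinner z x"
        using op_symmetric[OF y(1), of x] y(2)
        by (simp add: dom val cinner_simps sa_hs_symmetric[OF C] algebra_simps)
    qed
  qed
  then have "adjoint_of (perturb A C) = perturb A C"
    by (intro ext) (metis not_Some_eq)
  then show ?thesis
    unfolding self_adjoint_def densely_defined_operator_def dense
    using D_subspace by (auto simp: dom val op_add op_scale scaleC_add_right D_add D_scale
        clinear_add[OF sa_hs_clinear[OF C]] clinear_scaleC[OF sa_hs_clinear[OF C]])
qed

text \<open>\<open>F\<close> is enlarged by a finite set on whose complement \<open>C\<close>
  contributes at most \<open>\<tau> / 2\<close>; the criterion for \<open>A\<close> pays the other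
  half.\<close>

lemma ess_spectrum_perturb_subset:
  fixes A :: "'a::chilbert_space \<rightharpoonup> 'a"
  assumes C: "C \<in> sa_hilbert_schmidt"
  shows "ess_spectrum A \<subseteq> ess_spectrum (perturb A C)"
proof
  fix E assume E: "E \<in> ess_spectrum A"
  show "E \<in> ess_spectrum (perturb A C)"
    unfolding ess_spectrum_def mem_Collect_eq
  proof (intro allI impI)
    fix \<tau> :: real and F :: "'a set" assume \<tau>: "\<tau> > 0" and F: "finite F"
    obtain F' where F': "finite F'" "\<And>x. (\<And>f. f \<in> F' \<Longrightarrow> cinner f x = 0) \<Longrightarrow> norm (C x)
        \<le> \<tau> / 2 * norm x"
      using sa_hs_small_on_complement[OF C half_gt_zero[OF \<tau>]] by blast
    obtain u y where u: "A u = Some y" "norm u = 1" "\<forall>f\<in>F \<union> F'. cinner f u = 0"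
        "norm (y - complex_of_real E *\<^sub>C u) < \<tau> / 2"
      using E half_gt_zero[OF \<tau>] finite_UnI[OF F F'(1)] unfolding ess_spectrum_def by blast
    have "norm (C u) \<le> \<tau> / 2" using F'(2)[of u] u by simp
    moreover have "(y + C u) - complex_of_real E *\<^sub>C u = (y - complex_of_real E *\<^sub>C u) + C u"
        by simp
    then have "norm ((y + C u) - complex_of_real E *\<^sub>C u) \<le> norm (y - complex_of_real E *\<^sub>C u)
        + norm (C u)"
      by (simp only: norm_triangle_ineq)
    ultimately have "norm ((y + C u) - complex_of_real E *\<^sub>C u) < \<tau>" using u(4) by linarith
    moreover have "perturb A C u = Some (y + C u)" using u(1) by (simp add: perturb_def)
    ultimately show "\<exists>u y. perturb A C u = Some y \<and> norm u = 1 \<and> (\<forall>f\<in>F. cinner f u = 0) \<and>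
        norm (y - complex_of_real E *\<^sub>C u) < \<tau>" using u by blast
  qed
qed

lemma perturb_perturb: "perturb (perturb A C) C' = perturb A (\<lambda>x. C x + C' (x::'a::chilbert_space))"
  unfolding perturb_def by (auto simp: option.map_comp comp_def add.assoc)

lemma ess_spectrum_perturb:
  fixes A :: "'a::chilbert_space \<rightharpoonup> 'a"
  assumes C: "C \<in> sa_hilbert_schmidt"
  shows "ess_spectrum (perturb A C) = ess_spectrum A"
proof (rule antisym)
  have "perturb (perturb A C) (\<lambda>x. - C x) = A"
    unfolding perturb_perturb by (simp add: perturb_def option.map_ident)
  then show "ess_spectrum (perturb A C) \<subseteq> ess_spectrum A"
    using ess_spectrum_perturb_subset[OF sa_hs_uminus[OF C], of "perturb A C"] by simp
qed (rule ess_spectrum_perturb_subset[OF C])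

text \<open>Completeness for Baire's theorem. The candidate is the pointwise limit; its distance is
  controlled through finite partial sums.\<close>

lemma mcomplete_hs: "Metric_space.mcomplete (sa_hilbert_schmidt :: ('a::chilbert_space \<Rightarrow> 'a)
    set) hs_dist"
proof -
  interpret Metric_space "sa_hilbert_schmidt :: ('a \<Rightarrow> 'a) set" hs_dist by (rule Metric_space_hs)
  show ?thesis
    unfolding mcomplete_def
  proof (intro allI impI)
    fix \<sigma> :: "nat \<Rightarrow> 'a \<Rightarrow> 'a" assume "MCauchy \<sigma>"
    then have \<sigma>: "\<And>n. \<sigma> n \<in> sa_hilbert_schmidt"
      and C: "\<And>\<epsilon>. \<epsilon> > 0 \<Longrightarrow> \<exists>N. \<forall>n n'. N \<le> n \<longrightarrow> N \<le> n' \<longrightarrow> hs_dist (\<sigma> n) (\<sigma> n') < \<epsilon>"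
      unfolding MCauchy_def by auto
    note lin = sa_hs_clinear[OF \<sigma>]
    have "convergent (\<lambda>n. \<sigma> n x)" for x
    proof (rule Cauchy_convergent, rule CauchyI)
      fix e :: real assume e: "e > 0"
      obtain N where N: "\<And>n n'. N \<le> n \<Longrightarrow> N \<le> n' \<Longrightarrow> hs_dist (\<sigma> n) (\<sigma> n') < e / (norm x + 1)"
        using C[of "e / (norm x + 1)"] e by (auto simp: add_nonneg_pos)
      have "norm (\<sigma> m x - \<sigma> n x) < e" if "m \<ge> N" "n \<ge> N" for m n
      proof -
        have "norm (\<sigma> m x - \<sigma> n x) \<le> hs_dist (\<sigma> m) (\<sigma> n) * norm x"
            by (rule norm_diff_le_hs_dist[OF \<sigma> \<sigma>])
        also have "\<dots> \<le> e / (norm x + 1) * norm x"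
          using N[OF that] by (intro mult_right_mono) auto
        also have "\<dots> < e"
          using e mult_strict_left_mono[of "norm x" "norm x + 1" e]
          by (simp add: pos_divide_less_eq add_nonneg_pos)
        finally show ?thesis .
      qed
      then show "\<exists>N. \<forall>m\<ge>N. \<forall>n\<ge>N. norm (\<sigma> m x - \<sigma> n x) < e" by blast
    qed
    then obtain T where T: "\<And>x. (\<lambda>n. \<sigma> n x) \<longlonglongrightarrow> T x" unfolding convergent_def by metis
    have linT: "clinear T"
    proof (rule clinearI)
      show "T (x + y) = T x + T y" for x y
      proof (rule LIMSEQ_unique[OF T])
        show "(\<lambda>n. \<sigma> n (x + y)) \<longlonglongrightarrow> T x + T y"
          unfolding clinear_add[OF lin] by (intro tendsto_add T)
      qed
      show "T (c *\<^sub>C x) = c *\<^sub>C T x" for c x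
      proof (rule LIMSEQ_unique[OF T])
        show "(\<lambda>n. \<sigma> n (c *\<^sub>C x)) \<longlonglongrightarrow> c *\<^sub>C T x"
          unfolding clinear_scaleC[OF lin] by (intro tendsto_intros T)
      qed
    qed
    have symT: "cinner y (T x) = cinner (T y) x" for x y
    proof (rule LIMSEQ_unique)
      show "(\<lambda>n. cinner y (\<sigma> n x)) \<longlonglongrightarrow> cinner y (T x)" by (intro tendsto_intros T)
      show "(\<lambda>n. cinner y (\<sigma> n x)) \<longlonglongrightarrow> cinner (T y) x"
        unfolding sa_hs_symmetric[OF \<sigma>] by (intro tendsto_intros T)
    qed
    \<comment> \<open>For finitely many basis vectors the Cauchy bound passes to the pointwise
      limit, and the supremum over finite sets gives the full sum.\<close>
    have fin: "(\<Sum>e\<in>F. (norm (\<sigma> n e - T e))\<^sup>2) \<le> \<epsilon>\<^sup>2"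
      if N: "\<And>n n'. N \<le> n \<Longrightarrow> N \<le> n' \<Longrightarrow> hs_dist (\<sigma> n) (\<sigma> n') < \<epsilon>" and n: "n \<ge> N"
        and F: "finite F" "F \<subseteq> some_basis" for N n \<epsilon> F
    proof (rule LIMSEQ_le_const2)
      show "(\<lambda>m. \<Sum>e\<in>F. (norm (\<sigma> n e - \<sigma> m e))\<^sup>2) \<longlonglongrightarrow> (\<Sum>e\<in>F. (norm (\<sigma> n e - T e))\<^sup>2)"
        by (intro tendsto_intros T)
      have "(\<Sum>e\<in>F. (norm (\<sigma> n e - \<sigma> m e))\<^sup>2) \<le> \<epsilon>\<^sup>2" if "m \<ge> N" for m
      proof -
        have "(\<Sum>e\<in>F. (norm (\<sigma> n e - \<sigma> m e))\<^sup>2) \<le> (hs_dist (\<sigma> n) (\<sigma> m))\<^sup>2"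
          unfolding hs_dist_def
          by (rule has_sum_mono2[OF has_sum_finite[OF F(1)] sa_hs_has_sum[OF sa_hs_diff[OF \<sigma> \<sigma>]]
              F(2)]) simp
        also have "\<dots> \<le> \<epsilon>\<^sup>2" using N[OF n that] by (intro power_mono) auto
        finally show ?thesis .
      qed
      then show "\<exists>N. \<forall>m\<ge>N. (\<Sum>e\<in>F. (norm (\<sigma> n e - \<sigma> m e))\<^sup>2) \<le> \<epsilon>\<^sup>2" by blast
    qed
    have sumdiff: "(\<lambda>e. (norm (\<sigma> n e - T e))\<^sup>2) summable_on some_basis"
      and distle: "hs_dist (\<sigma> n) T \<le> \<epsilon>"
      if N: "\<And>n n'. N \<le> n \<Longrightarrow> N \<le> n' \<Longrightarrow> hs_dist (\<sigma> n) (\<sigma> n') < \<epsilon>" and n: "n \<ge> N" and \<epsilon>: "\<epsilon> > 0"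
          for N n \<epsilon>
    proof -
      show s: "(\<lambda>e. (norm (\<sigma> n e - T e))\<^sup>2) summable_on some_basis"
        by (rule nonneg_bdd_above_summable_on) (use fin[OF N n]
            in \<open>auto intro!: bdd_aboveI[of _ "\<epsilon>\<^sup>2"]\<close>)
      have "(\<Sum>\<^sub>\<infinity>e\<in>some_basis. (norm (\<sigma> n e - T e))\<^sup>2) \<le> \<epsilon>\<^sup>2"
        by (rule infsum_le_finite_sums[OF s]) (rule fin[OF N n])
      then show "hs_dist (\<sigma> n) T \<le> \<epsilon>"
        unfolding hs_dist_def hs_norm_def using \<epsilon> by (intro real_le_lsqrt) (auto
            intro: infsum_nonneg)
    qed
    obtain N where N: "\<And>n n'. N \<le> n \<Longrightarrow> N \<le> n' \<Longrightarrow> hs_dist (\<sigma> n) (\<sigma> n') < 1" using C[of 1] by auto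
    have bdT: "norm (T x) \<le> (hs_norm (\<sigma> N) + 1) * norm x" for x
    proof (rule LIMSEQ_le_const2[OF tendsto_norm[OF T]], intro exI allI impI)
      fix n assume n: "n \<ge> N"
      have "norm (\<sigma> n x) \<le> norm (\<sigma> N x) + norm (\<sigma> n x - \<sigma> N x)" using norm_triangle_sub by blast
      also have "\<dots> \<le> hs_norm (\<sigma> N) * norm x + hs_dist (\<sigma> n) (\<sigma> N) * norm x"
        by (intro add_mono norm_le_hs_norm norm_diff_le_hs_dist \<sigma>)
      also have "hs_dist (\<sigma> n) (\<sigma> N) * norm x \<le> 1 * norm x"
        using N[OF n order_refl] by (intro mult_right_mono) auto
      finally show "norm (\<sigma> n x) \<le> (hs_norm (\<sigma> N) + 1) * norm x" by (simp add: distrib_right)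
    qed
    have bdD: "norm (\<sigma> N x - T x) \<le> (2 * hs_norm (\<sigma> N) + 1) * norm x" for x
      using norm_triangle_ineq4[of "\<sigma> N x" "T x"] bdT[of x] norm_le_hs_norm[OF \<sigma>, of N x]
      by (simp add: distrib_right)
    \<comment> \<open>Summability is known for the difference from \<open>\<sigma> N\<close>, so
      \<open>T\<close> is recovered by subtracting that difference from
      \<open>\<sigma> N\<close>.\<close>
    have "(\<lambda>x. \<sigma> N x - T x) \<in> sa_hilbert_schmidt"
      by (rule sa_hilbert_schmidtI[OF _ bdD _ sumdiff[OF N]])
         (use lin linT in \<open>auto intro!: clinearI simp: clinear_add clinear_scaleC
             cvec.scale_right_diff_distrib
            cinner_simps symT sa_hs_symmetric[OF \<sigma>]\<close>)
    from sa_hs_diff[OF \<sigma>[of N] this] have TI: "T \<in> sa_hilbert_schmidt" by simp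
    have "limitin mtopology \<sigma> T sequentially"
      unfolding limit_metric_sequentially
    proof (intro conjI TI allI impI)
      fix \<epsilon> :: real assume \<epsilon>: "\<epsilon> > 0"
      obtain N where "\<And>n n'. N \<le> n \<Longrightarrow> N \<le> n' \<Longrightarrow> hs_dist (\<sigma> n) (\<sigma> n') < \<epsilon> / 2"
        using C[OF half_gt_zero[OF \<epsilon>]] by auto
      from distle[OF this _ half_gt_zero[OF \<epsilon>]] \<epsilon>
      show "\<exists>N. \<forall>n\<ge>N. \<sigma> n \<in> sa_hilbert_schmidt \<and> hs_dist (\<sigma> n) T < \<epsilon>" using \<sigma> by fastforce
    qed
    then show "\<exists>x. limitin mtopology \<sigma> x sequentially" by blast
  qed
qed

section \<open>Finite rank corrections\<close>

lemma has_sum_sum_finite: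
  fixes f :: "'i \<Rightarrow> 'b \<Rightarrow> 'c::topological_comm_monoid_add"
  assumes "\<And>i. i \<in> I \<Longrightarrow> (f i has_sum s i) A"
  shows "((\<lambda>x. \<Sum>i\<in>I. f i x) has_sum (\<Sum>i\<in>I. s i)) A"
  using assms by (induction I rule: infinite_finite_induct) (auto intro: has_sum_add)

text \<open>Expanding the square and summing over the basis with Parseval leaves the product of two
  Gram matrices. If one of the families is orthonormal, only the diagonal remains.\<close>

lemma finite_rank_hs_has_sum:
  fixes w q :: "'i \<Rightarrow> 'a::chilbert_space"
  shows "((\<lambda>e. (norm (\<Sum>b\<in>J. cinner (w b) e *\<^sub>C q b))\<^sup>2) has_sum
    Re (\<Sum>b\<in>J. \<Sum>c\<in>J. cinner (w c) (w b) * cinner (q b) (q c))) some_basis"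
proof -
  have "((\<lambda>e. \<Sum>b\<in>J. \<Sum>c\<in>J. (cinner (w c) e * cinner e (w b)) * cinner (q b) (q c)) has_sum
    (\<Sum>b\<in>J. \<Sum>c\<in>J. cinner (w c) (w b) * cinner (q b) (q c))) some_basis"
    by (intro has_sum_sum_finite has_sum_cmult_left parseval_cinner some_basis)
  from has_sum_bounded_linear[OF bounded_linear_Re this]
  have "((\<lambda>e. Re (\<Sum>b\<in>J. \<Sum>c\<in>J. (cinner (w c) e * cinner e (w b)) * cinner (q b) (q c))) has_sum
    Re (\<Sum>b\<in>J. \<Sum>c\<in>J. cinner (w c) (w b) * cinner (q b) (q c))) some_basis" .
  moreover have "Re (\<Sum>b\<in>J. \<Sum>c\<in>J. (cinner (w c) e * cinner e (w b)) * cinner (q b) (q c))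
      = (norm (\<Sum>b\<in>J. cinner (w b) e *\<^sub>C q b))\<^sup>2" for e
    unfolding norm_sq_cinner cinner_sum_left cinner_sum_right cinner_scaleC_left cinner_scaleC_right
    by (subst sum.swap, intro arg_cong[where f = Re] sum.cong refl, subst cinner_commute[of e])
      (simp add: mult_ac sum_distrib_left)
  ultimately show ?thesis by simp
qed

context self_adjoint_operator
begin

text \<open>With \<open>P\<close> the projection onto the span of the \<open>w b\<close> and \<open>K = (A - \<Sum>\<^sub>b b w\<^sub>b w\<^sub>b\<^sup>* ) P\<close>,
  the perturbation is \<open>- (1 - P) K - K\<^sup>*\<close>.\<close>

lemma perturb_to_eigenvectors:
  fixes w :: "real \<Rightarrow> 'a"
  assumes J: "finite J" and wD: "\<And>b. b \<in> J \<Longrightarrow> w b \<in> D"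
    and on: "\<And>b c. b \<in> J \<Longrightarrow> c \<in> J \<Longrightarrow> cinner (w b) (w c) = (if b = c then 1 else 0)"
  defines "k \<equiv> \<lambda>b. op (w b) - complex_of_real b *\<^sub>C w b"
  shows "\<exists>C\<in>sa_hilbert_schmidt. hs_norm C \<le> 2 * sqrt (\<Sum>b\<in>J. (norm (k b))\<^sup>2) \<and> (\<forall>b\<in>J. C (w b)
      = - k b)"
proof -
  \<comment> \<open>\<open>p b\<close> and \<open>q b\<close> are the components of the residual
    \<open>k b\<close> inside and orthogonal to the span of the \<open>w b\<close>.\<close>
  define p where "p b = (\<Sum>c\<in>J. cinner (w c) (k b) *\<^sub>C w c)" for b
  define q where "q b = k b - p b" for b
  define C where "C x = - (\<Sum>b\<in>J. cinner (w b) x *\<^sub>C q b) - (\<Sum>b\<in>J. cinner (k b) x *\<^sub>C w b)" for x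
  have wk: "cinner (w c) (k b) = cinner (k c) (w b)" if "b \<in> J" "c \<in> J" for b c
    using op_symmetric[OF wD[OF that(2)] wD[OF that(1)]] on[OF that(2,1)]
    by (auto simp: k_def cinner_simps)
  have lin: "clinear C"
    by (rule clinearI)
       (simp_all add: C_def cinner_simps scaleC_add_left scaleC_scaleC sum.distrib sum_distrib_left
          cvec.scale_sum_right cvec.scale_right_diff_distrib cvec.scale_minus_right)
  have pC: "(\<Sum>b\<in>J. cinner (w b) x *\<^sub>C p b) = (\<Sum>b\<in>J. (\<Sum>c\<in>J. cinner (w b) (k c) * cinner (w c) x)
      *\<^sub>C w b)" for x
    unfolding p_def cvec.scale_sum_right cvec.scale_sum_left
    by (subst sum.swap) (simp add: scaleC_scaleC mult.commute)
  have sym: "cinner y (C x) = cinner (C y) x" for x y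
  proof -
    have q: "cinner z (q b) = cinner z (k b) - (\<Sum>c\<in>J. cinner (w c) (k b) * cinner z (w c))" for z b
      by (simp add: q_def p_def cinner_diff_right cinner_sum_right cinner_scaleC_right)
    have q': "cinner (q b) z = cinner (k b) z - (\<Sum>c\<in>J. cnj (cinner (w c) (k b)) * cinner (w c)
        z)" for z b
      by (simp add: q_def p_def cinner_diff_left cinner_sum_left cinner_scaleC_left)
    have e: "(\<Sum>b\<in>J. \<Sum>c\<in>J. cinner (w b) x * (cinner (w c) (k b) * cinner y (w c)))
        = (\<Sum>b\<in>J. \<Sum>c\<in>J. cinner y (w b) * (cnj (cinner (w c) (k b)) * cinner (w c) x))"
    proof (subst sum.swap, intro sum.cong refl)
      fix b c assume bc: "b \<in> J" "c \<in> J"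
      have "cnj (cinner (w c) (k b)) = cinner (w b) (k c)"
        using wk[OF bc] wk[OF bc(2,1)] cinner_commute[of "k b" "w c"] by simp
      then show "cinner (w c) x * (cinner (w b) (k c) * cinner y (w b))
          = cinner y (w b) * (cnj (cinner (w c) (k b)) * cinner (w c) x)" by simp
    qed
    have "cinner y (C x) = - (\<Sum>b\<in>J. cinner (w b) x * cinner y (k b))
       + (\<Sum>b\<in>J. \<Sum>c\<in>J. cinner (w b) x * (cinner (w c) (k b) * cinner y (w c))) - (\<Sum>b\<in>J. cinner (k
           b) x * cinner y (w b))"
      by (simp add: C_def cinner_diff_right cinner_minus_right cinner_sum_right
          cinner_scaleC_right q
          right_diff_distrib sum_subtractf sum_distrib_left)
    also have "\<dots> = - (\<Sum>b\<in>J. cinner y (w b) * cinner (k b) x)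
       + (\<Sum>b\<in>J. \<Sum>c\<in>J. cinner y (w b) * (cnj (cinner (w c) (k b)) * cinner (w c) x))
           - (\<Sum>b\<in>J. cinner y (k b) * cinner (w b) x)"
      unfolding e by (simp add: mult.commute)
    also have "\<dots> = cinner (C y) x"
      by (simp add: C_def cinner_diff_left cinner_minus_left cinner_sum_left cinner_scaleC_left q'
          right_diff_distrib sum_subtractf sum_distrib_left cinner_commute[of y])
    finally show ?thesis .
  qed
  have Cw: "C (w b) = - k b" if b: "b \<in> J" for b
  proof -
    have "(\<Sum>c\<in>J. cinner (w c) (w b) *\<^sub>C q c) = (\<Sum>c\<in>J. if c = b then q b else 0)"
      using on[OF _ b] by (intro sum.cong refl) (auto simp: scaleC_one)
    also have "\<dots> = q b" using J b by simp
    finally have 1: "(\<Sum>c\<in>J. cinner (w c) (w b) *\<^sub>C q c) = q b" .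
    have 2: "(\<Sum>c\<in>J. cinner (k c) (w b) *\<^sub>C w c) = p b"
      unfolding p_def using wk[OF b] by (intro sum.cong refl) auto
    show ?thesis unfolding C_def 1 2 by (simp add: q_def)
  qed
  define s where "s = (\<Sum>b\<in>J. (norm (k b))\<^sup>2)"
  have qs: "(norm (q b))\<^sup>2 \<le> (norm (k b))\<^sup>2" if b: "b \<in> J" for b
  proof -
    have "cinner (w c) (q b) = 0" if c: "c \<in> J" for c
    proof -
      have "cinner (w c) (p b) = (\<Sum>d\<in>J. if d = c then cinner (w c) (k b) else 0)"
        unfolding p_def cinner_sum_right cinner_scaleC_right using on[OF c]
        by (intro sum.cong refl) auto
      then show ?thesis using J c by (simp add: q_def cinner_diff_right)
    qed
    then have "cinner (p b) (q b) = 0" by (simp add: p_def cinner_sum_left cinner_scaleC_left)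
    from norm_add_sq_orth[OF this] have "(norm (k b))\<^sup>2 = (norm (p b))\<^sup>2 + (norm (q b))\<^sup>2"
      by (simp add: q_def)
    then show ?thesis by simp
  qed
  have h1: "((\<lambda>e. (norm (\<Sum>b\<in>J. cinner (w b) e *\<^sub>C q b))\<^sup>2)
      has_sum (\<Sum>b\<in>J. (norm (q b))\<^sup>2)) some_basis"
  proof -
    have "(\<Sum>b\<in>J. \<Sum>c\<in>J. cinner (w c) (w b) * cinner (q b) (q c)) = (\<Sum>b\<in>J. \<Sum>c\<in>J. if c
        = b then complex_of_real ((norm (q b))\<^sup>2) else 0)"
      using on by (intro sum.cong refl) (auto simp: cinner_norm)
    also have "\<dots> = complex_of_real (\<Sum>b\<in>J. (norm (q b))\<^sup>2)" using J by simp
    finally show ?thesis using finite_rank_hs_has_sum[where J = J and w = w and q = q] by simp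
  qed
  have h2: "((\<lambda>e. (norm (\<Sum>b\<in>J. cinner (k b) e *\<^sub>C w b))\<^sup>2) has_sum s) some_basis"
  proof -
    have "(\<Sum>b\<in>J. \<Sum>c\<in>J. cinner (k c) (k b) * cinner (w b) (w c)) = (\<Sum>b\<in>J. \<Sum>c\<in>J. if c
        = b then complex_of_real ((norm (k b))\<^sup>2) else 0)"
      using on by (intro sum.cong refl) (auto simp: cinner_norm)
    also have "\<dots> = complex_of_real s" using J by (simp add: s_def)
    finally show ?thesis using finite_rank_hs_has_sum[where J = J and w = k and q = w] by simp
  qed
  have h: "((\<lambda>e. 2 * (norm (\<Sum>b\<in>J. cinner (w b) e *\<^sub>C q b))\<^sup>2
      + 2 * (norm (\<Sum>b\<in>J. cinner (k b) e *\<^sub>C w b))\<^sup>2)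
      has_sum (2 * (\<Sum>b\<in>J. (norm (q b))\<^sup>2) + 2 * s)) some_basis"
    by (intro has_sum_add has_sum_cmult_right h1 h2)
  have Cle: "(norm (C e))\<^sup>2 \<le> 2 * (norm (\<Sum>b\<in>J. cinner (w b) e *\<^sub>C q b))\<^sup>2
      + 2 * (norm (\<Sum>b\<in>J. cinner (k b) e *\<^sub>C w b))\<^sup>2" for e
    using parallelogram_law[of "- (\<Sum>b\<in>J. cinner (w b) e *\<^sub>C q b)" "\<Sum>b\<in>J. cinner (k b) e *\<^sub>C w b"]
      zero_le_power2[of "norm (- (\<Sum>b\<in>J. cinner (w b) e *\<^sub>C q b) + (\<Sum>b\<in>J. cinner (k b) e *\<^sub>C w b))"]
    unfolding C_def norm_minus_cancel by linarith
  have sm: "(\<lambda>e. (norm (C e))\<^sup>2) summable_on some_basis"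
    by (rule summable_on_comparison_test[OF has_sum_imp_summable[OF h]]) (use Cle in auto)
  have "norm (C x) \<le> (\<Sum>b\<in>J. norm (w b) * norm (q b) + norm (k b) * norm (w b)) * norm x" for x
  proof -
    have "norm (C x) \<le> norm (\<Sum>b\<in>J. cinner (w b) x *\<^sub>C q b) + norm (\<Sum>b\<in>J. cinner (k b) x *\<^sub>C w b)"
      unfolding C_def using norm_triangle_ineq4[of "- (\<Sum>b\<in>J. cinner (w b) x *\<^sub>C q b)"] by simp
    also have "\<dots> \<le> (\<Sum>b\<in>J. norm (w b) * norm (q b) * norm x)
        + (\<Sum>b\<in>J. norm (k b) * norm (w b) * norm x)"
    proof (intro add_mono sum_norm_le)
      show "norm (cinner (w b) x *\<^sub>C q b) \<le> norm (w b) * norm (q b) * norm x"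
        "norm (cinner (k b) x *\<^sub>C w b) \<le> norm (k b) * norm (w b) * norm x" for b
        using mult_right_mono[OF cinner_cauchy_schwarz[of "w b" x], of "norm (q b)"]
          mult_right_mono[OF cinner_cauchy_schwarz[of "k b" x], of "norm (w b)"]
              by (simp_all add: mult_ac)
    qed
    finally show ?thesis by (simp add: sum.distrib sum_distrib_right distrib_right)
  qed
  then have CI: "C \<in> sa_hilbert_schmidt" by (rule sa_hilbert_schmidtI[OF lin _ sym sm])
  \<comment> \<open>Both parts have squared norm at most \<open>s\<close>, the first because
    projecting shrinks each \<open>k b\<close>. The parallelogram law doubles their sum, hence
    \<open>4 * s\<close> and the constant 2 of the statement.\<close>
  have "(hs_norm C)\<^sup>2 \<le> 2 * (\<Sum>b\<in>J. (norm (q b))\<^sup>2) + 2 * s"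
    by (rule has_sum_mono[OF sa_hs_has_sum[OF CI] h Cle])
  also have "(\<Sum>b\<in>J. (norm (q b))\<^sup>2) \<le> s" unfolding s_def by (intro sum_mono qs)
  finally have "(hs_norm C)\<^sup>2 \<le> (2 * sqrt s)\<^sup>2" by (simp add: power_mult_distrib s_def sum_nonneg)
  then have "hs_norm C \<le> 2 * sqrt s" by (rule power2_le_imp_le) (simp add: s_def sum_nonneg)
  then show ?thesis using CI Cw unfolding s_def by blast
qed

end

section \<open>Approximate diagonalization\<close>

context self_adjoint_operator
begin

text \<open>A real \<open>b\<close> is both index and approximate eigenvalue, so distinct vectors
  have distinct labels. The sum of squares is the quantity that bounds the Hilbert-Schmidt norm of
  the correction in \<open>perturb_to_eigenvectors\<close>.\<close>

definition approx_diag :: "'a \<Rightarrow> real \<Rightarrow> real \<Rightarrow> real set \<Rightarrow> (real \<Rightarrow> 'a) \<Rightarrow> (real \<Rightarrow> complex) \<Rightarrow> bool"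
  where "approx_diag \<phi> \<epsilon> \<sigma> J w c \<longleftrightarrow> finite J \<and> (\<forall>b\<in>J. w b \<in> D) \<and>
    (\<forall>b\<in>J. \<forall>b'\<in>J. cinner (w b) (w b') = (if b = b' then 1 else 0)) \<and>
    norm (\<phi> - (\<Sum>b\<in>J. c b *\<^sub>C w b)) < \<epsilon> \<and>
    (\<Sum>b\<in>J. (norm (op (w b) - complex_of_real b *\<^sub>C w b))\<^sup>2) < \<sigma>"

lemma fc_sum:
  assumes "finite I" "\<And>i. i \<in> I \<Longrightarrow> fc (f i) (T i)"
  shows "fc (\<lambda>x. \<Sum>i\<in>I. f i x) (\<lambda>\<psi>. \<Sum>i\<in>I. T i \<psi>)"
  using assms
proof (induction I rule: finite_induct)
  case empty
  then show ?case using fc_const[of 0] by simp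
qed (auto intro: fc_add)

text \<open>Weyl and von Neumann: the spectral projections of \<open>\<phi>\<close> to intervals of length \<open>1 / n\<close>
  are approximate eigenvectors with error \<open>1 / n\<close>, and there are only \<open>O(n)\<close> of them.\<close>

lemma approx_diag_exists:
  assumes \<epsilon>: "\<epsilon> > 0" and \<sigma>: "\<sigma> > 0"
  shows "\<exists>J w c. approx_diag \<phi> \<epsilon> \<sigma> J w c"
proof -
  have "(\<lambda>n. proj (- {- real n..<real n}) \<phi>) \<longlonglongrightarrow> 0"
  proof (rule fc_null[where F = "\<lambda>n. indicator (- {- real n..<real n})" and K = 1 and T
      = "\<lambda>n. proj (- {- real n..<real n})"])
    show "fc (indicator (- {- real n..<real n})) (proj (- {- real n..<real n}))" for n
      by (rule fc_proj) auto
    show "cmod (indicator (- {- real n..<real n}) x) \<le> 1" for n x by (simp add: indicator_def)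
    show "(\<lambda>n. indicator (- {- real n..<real n}) x :: complex) \<longlonglongrightarrow> 0" for x
    proof (rule tendsto_eventually)
      obtain N where N: "\<bar>x\<bar> < real N" using reals_Archimedean2 by blast
      have "indicator (- {- real n..<real n}) x = (0::complex)" if "n \<ge> N" for n
      proof -
        have "real N \<le> real n" using that by simp
        then show ?thesis using N by (auto simp: indicator_def)
      qed
      then show "\<forall>\<^sub>F n in sequentially. indicator (- {- real n..<real n}) x = (0::complex)"
        unfolding eventually_sequentially by blast
    qed
  qed
  then obtain r where r: "norm (proj (- {- real r..<real r}) \<phi>) < \<epsilon>"
    using LIMSEQ_D[OF _ \<epsilon>] by fastforce
  \<comment> \<open>At most \<open>2 * r * n\<close> pieces with squared residual at most
    \<open>1 / n\<^sup>2\<close> add up to \<open>2 * r / n\<close>.\<close>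
  obtain n0 where n0: "2 * real r / \<sigma> < real n0" using reals_Archimedean2 by blast
  define n where "n = Suc n0"
  have n: "real n > 0" by (simp add: n_def)
  have n\<sigma>: "2 * real r / real n < \<sigma>"
  proof -
    have "2 * real r < \<sigma> * real n0" using n0 \<sigma> by (simp add: field_simps)
    also have "\<dots> \<le> \<sigma> * real n" using \<sigma> by (simp add: n_def)
    finally show ?thesis using n by (simp add: field_simps)
  qed
  define Z where "Z = {- int (r * n)..<int (r * n)}"
  define \<beta> where "\<beta> j = of_int j / real n" for j :: int
  define I where "I b = {b..<b + 1 / real n}" for b :: real
  have inj: "inj_on \<beta> Z" using n by (auto simp: \<beta>_def inj_on_def)
  have Im: "I b \<in> sets borel" for b by (simp add: I_def)
  \<comment> \<open>The floor names the interval that contains \<open>x\<close>; disjointness and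
    exact covering both follow from it.\<close>
  have xI: "x \<in> I (\<beta> j) \<longleftrightarrow> \<lfloor>real n * x\<rfloor> = j" for x j
    using n by (auto simp: I_def \<beta>_def floor_eq_iff field_simps)
  have disj: "I (\<beta> i) \<inter> I (\<beta> j) = {}" if "i \<noteq> j" for i j
    using that by (auto simp: set_eq_iff xI)
  define e where "e b = proj (I b) \<phi>" for b
  \<comment> \<open>Zero pieces are dropped so that the others can be normalized.\<close>
  define J where "J = {b \<in> \<beta> ` Z. e b \<noteq> 0}"
  define w where "w b = complex_of_real (1 / norm (e b)) *\<^sub>C e b" for b
  define c where "c b = complex_of_real (norm (e b))" for b
  have cw: "c b *\<^sub>C w b = e b" if "e b \<noteq> 0" for b
    using that by (simp add: c_def w_def scaleC_scaleC scaleC_one)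
  have J: "finite J" by (simp add: J_def Z_def)
  have "card J \<le> card (\<beta> ` Z)" unfolding J_def by (rule card_mono) (auto simp: Z_def)
  also have "\<dots> = card Z" by (rule card_image[OF inj])
  also have "\<dots> = 2 * (r * n)" by (simp add: Z_def nat_mult_distrib)
  finally have cardJ: "card J \<le> 2 * (r * n)" .
  have "approx_diag \<phi> \<epsilon> \<sigma> J w c"
    unfolding approx_diag_def
  proof (intro conjI ballI J)
    have approx: "proj (I b) \<psi> \<in> D" "norm (op (proj (I b) \<psi>) - complex_of_real b *\<^sub>C proj (I b)
        \<psi>) \<le> 1 / real n * norm (proj (I b) \<psi>)" for b \<psi>
    proof -
      have "\<bar>x - b\<bar> \<le> 1 / real n" if "x \<in> I b" for x using that by (auto simp: I_def)
      from proj_interval_approx[OF Im this] n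
      show "proj (I b) \<psi> \<in> D" "norm (op (proj (I b) \<psi>) - complex_of_real b *\<^sub>C proj (I b) \<psi>)
          \<le> 1 / real n * norm (proj (I b) \<psi>)"
        by auto
    qed
    show "w b \<in> D" if "b \<in> J" for b unfolding w_def e_def by (intro D_scale approx)
    show "cinner (w b) (w b') = (if b = b' then 1 else 0)" if b: "b \<in> J" "b' \<in> J" for b b'
    proof (cases "b = b'")
      case True
      then show ?thesis using b by (simp add: w_def J_def cinner_simps cinner_norm
          power2_eq_square norm_divide)
    next
      case False
      obtain i j where "b = \<beta> i" "b' = \<beta> j" using b unfolding J_def by auto
      then have "I b \<inter> I b' = {}" using False disj[of i j] by auto
      then have "cinner (e b) (e b') = 0"
        unfolding e_def cinner_proj[OF Im] proj_mult[OF Im Im] by (simp add: proj_empty)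
      then show ?thesis using False by (simp add: w_def cinner_simps)
    qed
    have sum_e: "(\<Sum>b\<in>J. c b *\<^sub>C w b) = proj {- real r..<real r} \<phi>"
    proof -
      have "(\<Sum>b\<in>J. c b *\<^sub>C w b) = (\<Sum>b\<in>J. e b)" by (rule sum.cong) (auto simp: J_def cw)
      also have "\<dots> = (\<Sum>b\<in>\<beta> ` Z. e b)" by (rule sum.mono_neutral_left) (auto simp: J_def Z_def)
      also have "\<dots> = (\<Sum>j\<in>Z. proj (I (\<beta> j)) \<phi>)" by (simp add: sum.reindex[OF inj] e_def)
      also have "\<dots> = proj {- real r..<real r} \<phi>"
      proof -
        have "(\<Sum>j\<in>Z. indicator (I (\<beta> j)) x) = (indicator {- real r..<real r} x :: complex)" for x
        proof -
          have "(\<Sum>j\<in>Z. indicator (I (\<beta> j)) x) = (\<Sum>j\<in>Z. if j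
              = \<lfloor>real n * x\<rfloor> then 1 else 0 :: complex)"
            by (rule sum.cong) (auto simp: indicator_def xI)
          also have "\<dots> = (if \<lfloor>real n * x\<rfloor> \<in> Z then 1 else 0)" by (simp add: Z_def)
          also have "\<lfloor>real n * x\<rfloor> \<in> Z \<longleftrightarrow> x \<in> {- real r..<real r}"
          proof -
            have "- int (r * n) \<le> \<lfloor>real n * x\<rfloor> \<longleftrightarrow> - real r * real n \<le> x * real n"
              by (simp add: le_floor_iff mult.commute)
            moreover have "\<lfloor>real n * x\<rfloor> < int (r * n) \<longleftrightarrow> x * real n < real r * real n"
              by (simp add: floor_less_iff mult.commute)
            moreover have "- real r * real n \<le> x * real n \<longleftrightarrow> - real r \<le> x"
              "x * real n < real r * real n \<longleftrightarrow> x < real r"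
              using n by (simp_all only: mult_le_cancel_right_pos mult_less_cancel_right_pos)
            ultimately show ?thesis unfolding Z_def by simp
          qed
          finally show ?thesis by (simp add: indicator_def)
        qed
        then have "fc (indicator {- real r..<real r}) (\<lambda>\<psi>. \<Sum>j\<in>Z. proj (I (\<beta> j)) \<psi>)"
          using fc_sum[of Z "\<lambda>j. indicator (I (\<beta> j))" "\<lambda>j. proj (I (\<beta> j))"] fc_proj[OF Im]
              by (simp add: Z_def)
        then have "(\<lambda>\<psi>. \<Sum>j\<in>Z. proj (I (\<beta> j)) \<psi>) = proj {- real r..<real r}"
          by (rule fc_unique[OF _ fc_proj]) simp
        then show ?thesis by (rule fun_cong)
      qed
      finally show ?thesis .
    qed
    have "proj {- real r..<real r} \<phi> + proj (- {- real r..<real r}) \<phi> = \<phi>"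
    proof -
      have "fc (\<lambda>x. indicator {- real r..<real r} x + indicator (- {- real r..<real r}) x)
          (\<lambda>\<psi>. proj {- real r..<real r} \<psi> + proj (- {- real r..<real r}) \<psi>)"
        by (intro fc_add fc_proj) auto
      moreover have "(\<lambda>x. indicator {- real r..<real r} x + indicator (- {- real r..<real r}) x)
          = (\<lambda>_. 1::complex)"
        by (auto simp: indicator_def)
      ultimately have "(\<lambda>\<psi>. proj {- real r..<real r} \<psi> + proj (- {- real r..<real r}) \<psi>) = (\<lambda>\<psi>. \<psi>)"
        using fc_unique[OF _ fc_one] by simp
      then show ?thesis by (rule fun_cong)
    qed
    then have "\<phi> - (\<Sum>b\<in>J. c b *\<^sub>C w b) = proj (- {- real r..<real r}) \<phi>"
      unfolding sum_e by (metis add_diff_cancel_left')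
    then show "norm (\<phi> - (\<Sum>b\<in>J. c b *\<^sub>C w b)) < \<epsilon>" using r by simp
    have "(\<Sum>b\<in>J. (norm (op (w b) - complex_of_real b *\<^sub>C w b))\<^sup>2) \<le> (\<Sum>b\<in>J. (1 / real n)\<^sup>2)"
    proof (rule sum_mono)
      fix b assume "b \<in> J"
      then have nz: "norm (e b) > 0" by (simp add: J_def)
      have "op (w b) - complex_of_real b *\<^sub>C w b = complex_of_real (1 / norm (e b)) *\<^sub>C (op (e
          b) - complex_of_real b *\<^sub>C e b)"
        unfolding w_def using approx(1)[of b \<phi>]
        by (simp add: e_def op_scale cvec.scale_right_diff_distrib mult.commute)
      then have "norm (op (w b) - complex_of_real b *\<^sub>C w b)
          = norm (op (e b) - complex_of_real b *\<^sub>C e b) / norm (e b)"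
        by (simp add: norm_divide)
      also have "\<dots> \<le> 1 / real n"
        using approx(2)[of b \<phi>] nz unfolding e_def[symmetric] by (simp add: pos_divide_le_eq)
      finally show "(norm (op (w b) - complex_of_real b *\<^sub>C w b))\<^sup>2 \<le> (1 / real n)\<^sup>2"
          by (intro power_mono) auto
    qed
    also have "\<dots> = real (card J) / (real n)\<^sup>2" by (simp add: power_divide)
    also have "\<dots> \<le> real (2 * (r * n)) / (real n)\<^sup>2" by (intro divide_right_mono of_nat_mono
        cardJ) simp
    also have "\<dots> = 2 * real r / real n" using n by (simp add: power2_eq_square)
    also have "\<dots> < \<sigma>" by (rule n\<sigma>)
    finally show "(\<Sum>b\<in>J. (norm (op (w b) - complex_of_real b *\<^sub>C w b))\<^sup>2) < \<sigma>" .
  qed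
  then show ?thesis by blast
qed

text \<open>Vectors are picked one by one, those already chosen joining the finite set to which the
  next must be orthogonal. Indices are real because they will serve as labels.\<close>

lemma ess_spectrum_orthonormal:
  assumes E: "E \<in> ess_spectrum A" and L: "finite L" and F: "finite F" and \<eta>: "\<eta> > 0"
  shows "\<exists>u :: real \<Rightarrow> 'a. (\<forall>x\<in>L. u x \<in> D \<and> (\<forall>f\<in>F. cinner f (u x) = 0) \<and>
      norm (op (u x) - complex_of_real E *\<^sub>C u x) < \<eta>) \<and>
    (\<forall>x\<in>L. \<forall>y\<in>L. cinner (u x) (u y) = (if x = y then 1 else 0))"
  using L
proof (induction L rule: finite_induct)
  case (insert x L)
  then obtain u where u: "\<forall>x\<in>L. u x \<in> D \<and> (\<forall>f\<in>F. cinner f (u x) = 0) \<and>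
      norm (op (u x) - complex_of_real E *\<^sub>C u x) < \<eta>"
    "\<forall>x\<in>L. \<forall>y\<in>L. cinner (u x) (u y) = (if x = y then 1 else 0)" by blast
  have "finite (F \<union> u ` L)" using F insert by simp
  then obtain v where v: "v \<in> D" "norm v = 1" "\<forall>f\<in>F \<union> u ` L. cinner f v = 0"
      "norm (op v - complex_of_real E *\<^sub>C v) < \<eta>"
    using E \<eta> unfolding ess_spectrum_def by (auto simp: A_eq_Some_iff) blast
  have v1: "cinner v v = 1" using v(2) by (simp add: cinner_norm)
  have vu: "cinner (u y) v = 0" "cinner v (u y) = 0" if "y \<in> L" for y
    using v(3) that cinner_commute[of v "u y"] by auto
  show ?case
    by (rule exI[of _ "u(x := v)"]) (use u v v1 vu insert.hyps(2) in auto)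
qed simp

text \<open>A vector \<open>e\<close> with label in the essential spectrum is spread over \<open>N\<close> orthonormal
  vectors \<open>e / \<surd>N + u\<^sub>x - (1 / N) \<Sum>\<^sub>y u\<^sub>y\<close>, the vertices of a regular simplex, where the
  \<open>u\<^sub>x\<close> are approximate eigenvectors orthogonal to everything chosen so far.\<close>

lemma approx_diag_split:
  assumes ad: "approx_diag \<phi> \<epsilon> \<sigma> J w c" and \<epsilon>: "\<epsilon> > 0"
    and b: "b \<in> J" "b \<in> ess_spectrum A"
  obtains J' w' c' where "approx_diag \<phi> \<epsilon> \<sigma> J' w' c'"
    "\<And>x. x \<in> J' \<Longrightarrow> \<epsilon> \<le> cmod (c' x) \<Longrightarrow> x \<in> J - {b} \<and> c' x = c x"
proof -
  have J: "finite J" and wD: "\<And>b. b \<in> J \<Longrightarrow> w b \<in> D"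
    and on: "\<And>b b'. b \<in> J \<Longrightarrow> b' \<in> J \<Longrightarrow> cinner (w b) (w b') = (if b = b' then 1 else 0)"
    and \<phi>: "norm (\<phi> - (\<Sum>b\<in>J. c b *\<^sub>C w b)) < \<epsilon>"
    and \<sigma>: "(\<Sum>b\<in>J. (norm (op (w b) - complex_of_real b *\<^sub>C w b))\<^sup>2) < \<sigma>"
    using ad unfolding approx_diag_def by auto
  define e where "e = w b"
  define t where "t = norm (op e - complex_of_real b *\<^sub>C e)"
  \<comment> \<open>\<open>N\<close> exceeds the squared ratio of the coefficient to
    \<open>\<epsilon>\<close>, so each of the \<open>N\<close> new coefficients
    \<open>c b / q\<close> is shorter than \<open>\<epsilon>\<close>.\<close>
  obtain N0 where N0: "(cmod (c b) / \<epsilon>)\<^sup>2 < real N0" using reals_Archimedean2 by blast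
  define N where "N = Suc N0"
  define q where "q = sqrt (real N)"
  have N: "real N > 0" and q: "q > 0" "q * q = real N" by (simp_all add: N_def q_def)
  have cq: "cmod (c b) / q < \<epsilon>"
  proof -
    have "(cmod (c b) / \<epsilon>)\<^sup>2 < q\<^sup>2" using N0 q(2) by (simp add: power2_eq_square N_def)
    then have "cmod (c b) / \<epsilon> < q" by (rule power_less_imp_less_base) (rule less_imp_le[OF q(1)])
    then show ?thesis using \<epsilon> q(1) by (simp add: field_simps)
  qed
  define \<tau> where "\<tau> = \<sigma> - (\<Sum>b\<in>J. (norm (op (w b) - complex_of_real b *\<^sub>C w b))\<^sup>2)"
  have \<tau>: "\<tau> > 0" using \<sigma> by (simp add: \<tau>_def)
  \<comment> \<open>Spreading is free in the limit: since \<open>q * q = N\<close>, the squared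
    residuals of the \<open>N\<close> new vectors tend to the \<open>t\<^sup>2\<close> of the old
    one. The slack \<open>\<tau>\<close> in the strict inequality pays for a positive
    \<open>\<eta>\<close>.\<close>
  have "((\<lambda>\<eta>. real N * (t / q + 3 * \<eta>)\<^sup>2) \<longlongrightarrow> real N * (t / q + 3 * 0)\<^sup>2) (at_right 0)"
    by (intro tendsto_intros)
  moreover have "real N * (t / q + 3 * 0)\<^sup>2 = t\<^sup>2" using q N
      by (simp add: power_divide power2_eq_square)
  ultimately have "\<forall>\<^sub>F \<eta> in at_right 0. real N * (t / q + 3 * \<eta>)\<^sup>2 < t\<^sup>2 + \<tau>"
    using \<tau> by (intro order_tendstoD) auto
  then have "\<forall>\<^sub>F \<eta> in at_right 0. real N * (t / q + 3 * \<eta>)\<^sup>2 < t\<^sup>2 + \<tau> \<and> \<eta> > 0"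
    by (intro eventually_conj) (simp_all add: eventually_at_right_less)
  then obtain \<eta> where \<eta>: "\<eta> > 0" "real N * (t / q + 3 * \<eta>)\<^sup>2 < t\<^sup>2 + \<tau>"
    using eventually_happens'[OF trivial_limit_at_right_real[of 0]] by blast
  \<comment> \<open>The new labels avoid those in use and lie within \<open>\<eta>\<close> of
    \<open>b\<close>, so relabelling costs at most \<open>\<eta>\<close>.\<close>
  have "infinite ({b<..<b + \<eta>} - J)" using \<eta> J infinite_Ioo[of b "b + \<eta>"]
      by (simp add: Diff_infinite_finite)
  then obtain L where L: "L \<subseteq> {b<..<b + \<eta>} - J" "finite L" "card L = N"
    using infinite_arbitrarily_large by blast
  have "finite (w ` J)" using J by simp
  from ess_spectrum_orthonormal[OF b(2) L(2) this \<eta>(1)]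
  obtain u where u1: "\<forall>x\<in>L. u x \<in> D \<and> (\<forall>f\<in>w ` J. cinner f (u x) = 0) \<and>
      norm (op (u x) - complex_of_real b *\<^sub>C u x) < \<eta>"
    and u2: "\<forall>x\<in>L. \<forall>y\<in>L. cinner (u x) (u y) = (if x = y then 1 else 0)" by (elim exE conjE)
  have u: "\<And>x. x \<in> L \<Longrightarrow> u x \<in> D" "\<And>x a. x \<in> L \<Longrightarrow> a \<in> J \<Longrightarrow> cinner (w a) (u x) = 0"
    "\<And>x. x \<in> L \<Longrightarrow> norm (op (u x) - complex_of_real b *\<^sub>C u x) < \<eta>"
    "\<And>x y. x \<in> L \<Longrightarrow> y \<in> L \<Longrightarrow> cinner (u x) (u y) = (if x = y then 1 else 0)"
    using u1 u2 by blast+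
  have eD: "e \<in> D" and ee: "cinner e e = 1" using wD[OF b(1)] on[OF b(1,1)] by (auto simp: e_def)
  have wu: "cinner (u x) (w a) = 0" if "x \<in> L" "a \<in> J" for x a
    using u(2)[OF that] cinner_commute[of "u x" "w a"] by simp
  define m where "m = complex_of_real (1 / real N) *\<^sub>C (\<Sum>y\<in>L. u y)"
  define v where "v x = complex_of_real (1 / q) *\<^sub>C e + (u x - m)" for x
  have mD: "m \<in> D" unfolding m_def by (intro D_scale D_sum u)
  have vD: "v x \<in> D" if "x \<in> L" for x unfolding v_def by (intro D_add D_scale eD D_diff mD u that)
  have um: "cinner (u x) m = complex_of_real (1 / real N)" if x: "x \<in> L" for x
  proof -
    have "(\<Sum>y\<in>L. cinner (u x) (u y)) = (\<Sum>y\<in>L. if y = x then 1 else 0)"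
      using u(4)[OF x] by (intro sum.cong refl) auto
    then show ?thesis using L(2) x by (simp add: m_def cinner_simps cinner_sum_right)
  qed
  have mu: "cinner m (u x) = complex_of_real (1 / real N)" if x: "x \<in> L" for x
    using um[OF x] cinner_commute[of m "u x"] by simp
  have mm: "cinner m m = complex_of_real (1 / real N)"
  proof -
    have "cinner m m = complex_of_real (1 / real N) * (\<Sum>y\<in>L. cinner m (u y))"
      by (subst (2) m_def) (simp add: cinner_simps cinner_sum_right)
    also have "(\<Sum>y\<in>L. cinner m (u y)) = of_nat (card L) * complex_of_real (1 / real N)" using mu
        by simp
    finally show ?thesis using N L(3) by simp
  qed
  have wm: "cinner (w a) m = 0" "cinner m (w a) = 0" if a: "a \<in> J" for a
    using u(2)[OF _ a] wu[OF _ a] by (simp_all add: m_def cinner_simps cinner_sum_right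
        cinner_sum_left)
  have qq: "complex_of_real (1 / q) * complex_of_real (1 / q) = complex_of_real (1 / real N)"
    using q by (simp flip: of_real_mult)
  \<comment> \<open>The \<open>1 / N\<close> contributed by \<open>e / q\<close> cancels the
    \<open>- 1 / N\<close> in the Gram matrix of the simplex vectors \<open>u x - m\<close>.\<close>
  have vv: "cinner (v x) (v y) = (if x = y then 1 else 0)" if "x \<in> L" "y \<in> L" for x y
  proof -
    have "cinner e (u z - m) = 0" "cinner (u z - m) e = 0" if "z \<in> L" for z
      using u(2)[OF that b(1)] wu[OF that b(1)] wm[OF b(1)] by (simp_all add: e_def cinner_simps)
    then have "cinner (v x) (v y) = complex_of_real (1 / q) * complex_of_real (1 / q)
        + cinner (u x - m) (u y - m)"
      using that by (simp add: v_def cinner_add_left cinner_add_right cinner_scaleC_left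
          cinner_scaleC_right ee)
    also have "cinner (u x - m) (u y - m) = (if x = y then 1 else 0) - complex_of_real (1 / real N)"
      using that by (simp add: cinner_diff_left cinner_diff_right um mu mm u(4))
    finally show ?thesis unfolding qq by simp
  qed
  have vw: "cinner (w a) (v x) = 0" "cinner (v x) (w a) = 0" if "x \<in> L" "a \<in> J - {b}" for x a
    using that u(2)[of x a] wu[of x a] wm[of a] on[of a b] on[of b a] b(1)
    by (auto simp: v_def e_def cinner_simps)
  have sumv: "(\<Sum>x\<in>L. complex_of_real (1 / q) *\<^sub>C v x) = e"
  proof -
    have "(\<Sum>x\<in>L. u x - m) = 0"
    proof -
      have "(\<Sum>x\<in>L. m) = of_nat N *\<^sub>R m" using L(3) by (simp add: sum_constant_scaleR)
      also have "\<dots> = (\<Sum>y\<in>L. u y)" using N by (simp add: m_def scaleR_scaleC scaleC_scaleC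
          scaleC_one)
      finally show ?thesis by (simp add: sum_subtractf)
    qed
    then have "(\<Sum>x\<in>L. v x) = (\<Sum>x\<in>L. complex_of_real (1 / q) *\<^sub>C e)"
      unfolding v_def by (simp add: sum.distrib)
    also have "\<dots> = complex_of_real (real N * (1 / q)) *\<^sub>C e"
      using L(3) by (simp only: sum_constant_scaleR scaleR_scaleC scaleC_scaleC of_real_mult)
    also have "real N * (1 / q) = q" using q by (simp add: field_simps)
    finally show ?thesis using q(1) by (simp add: cvec.scale_sum_right[symmetric] scaleC_scaleC
        scaleC_one)
  qed
  define k where "k x z = op z - complex_of_real x *\<^sub>C z" for x z
  have kv: "(norm (k x (v x)))\<^sup>2 \<le> (t / q + 3 * \<eta>)\<^sup>2" if x: "x \<in> L" for x
  proof -
    have km: "norm (k b m) \<le> \<eta>"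
    proof -
      have "k b m = complex_of_real (1 / real N) *\<^sub>C (\<Sum>y\<in>L. k b (u y))"
      proof -
        have "op m = complex_of_real (1 / real N) *\<^sub>C (\<Sum>y\<in>L. op (u y))"
          unfolding m_def by (subst op_scale, intro D_sum u(1)) (simp_all add: op_sum u(1))
        then show ?thesis
          by (simp add: k_def m_def sum_subtractf cvec.scale_right_diff_distrib
              cvec.scale_sum_right[symmetric] mult.commute)
      qed
      moreover have "norm (\<Sum>y\<in>L. k b (u y)) \<le> (\<Sum>y\<in>L. \<eta>)"
        using u(3) by (intro sum_norm_le) (auto simp: k_def intro: less_imp_le)
      ultimately show ?thesis using N L(3) by (simp add: norm_divide field_simps)
    qed
    \<comment> \<open>Three errors of size \<open>\<eta>\<close> occur: the residual of
      \<open>u x\<close>, that of the mean \<open>m\<close>, and the shift of the label from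
      \<open>b\<close> to \<open>x\<close>.\<close>
    have "k x (v x) = complex_of_real (1 / q) *\<^sub>C k b e
        + (k b (u x) - k b m) - complex_of_real (x - b) *\<^sub>C v x"
    proof -
      have "op (v x) = complex_of_real (1 / q) *\<^sub>C op e + (op (u x) - op m)"
        unfolding v_def using x by (simp add: op_add op_scale op_diff D_scale D_diff eD mD u(1))
      then show ?thesis
        by (simp add: k_def v_def scaleC_add_right cvec.scale_right_diff_distrib
            cvec.scale_left_diff_distrib
            scaleC_scaleC algebra_simps)
    qed
    then have "norm (k x (v x)) \<le> norm (complex_of_real (1 / q) *\<^sub>C k b e + (k b (u x) - k b m))
        + norm (complex_of_real (x - b) *\<^sub>C v x)"
      by (metis norm_triangle_ineq4)
    also have "norm (complex_of_real (1 / q) *\<^sub>C k b e + (k b (u x) - k b m))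
        \<le> norm (complex_of_real (1 / q) *\<^sub>C k b e) + (norm (k b (u x)) + norm (k b m))"
      by (intro order_trans[OF norm_triangle_ineq] add_left_mono norm_triangle_ineq4)
    also have "norm (complex_of_real (1 / q) *\<^sub>C k b e) = t / q"
      using q(1) by (simp add: t_def k_def norm_divide)
    also have "norm (complex_of_real (x - b) *\<^sub>C v x) \<le> \<eta>"
    proof -
      have "norm (v x) = 1" using vv[OF x x] cinner_norm[of "v x"]
        by (metis norm_ge_zero of_real_eq_1_iff power2_eq_1_iff order_trans
            le_minus_one_simps(3) power_one)
      moreover have "\<bar>x - b\<bar> \<le> \<eta>" using x L(1) by auto
      ultimately show ?thesis by (simp only: norm_scaleC norm_of_real mult_1_right)
    qed
    finally have "norm (k x (v x)) \<le> t / q + 3 * \<eta>"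
      using km u(3)[OF x] unfolding k_def by linarith
    then show ?thesis by (intro power_mono) auto
  qed
  define J' where "J' = (J - {b}) \<union> L"
  define w' where "w' x = (if x \<in> L then v x else w x)" for x
  define c' where "c' x = (if x \<in> L then c b * complex_of_real (1 / q) else c x)" for x
  have LJ: "L \<inter> J = {}" using L(1) by auto
  have fin: "finite (J - {b})" "finite L" "(J - {b}) \<inter> L = {}" using J L(2) LJ by auto
  have "approx_diag \<phi> \<epsilon> \<sigma> J' w' c'"
    unfolding approx_diag_def
  proof (intro conjI ballI)
    show "finite J'" using J L by (simp add: J'_def)
    show "w' x \<in> D" if "x \<in> J'" for x using that vD wD by (auto simp: J'_def w'_def)
    show "cinner (w' x) (w' y) = (if x = y then 1 else 0)" if "x \<in> J'" "y \<in> J'" for x y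
      using that vv vw on LJ by (auto simp: J'_def w'_def)
    have "(\<Sum>x\<in>J'. c' x *\<^sub>C w' x) = (\<Sum>x\<in>J - {b}. c x *\<^sub>C w x)
        + (\<Sum>x\<in>L. c b *\<^sub>C complex_of_real (1 / q) *\<^sub>C v x)"
      unfolding J'_def sum.union_disjoint[OF fin]
      by (intro arg_cong2[where f = "(+)"] sum.cong refl) (use LJ
          in \<open>auto simp: c'_def w'_def scaleC_scaleC\<close>)
    also have "(\<Sum>x\<in>L. c b *\<^sub>C complex_of_real (1 / q) *\<^sub>C v x) = c b *\<^sub>C w b"
      by (subst e_def[symmetric], subst sumv[symmetric]) (rule cvec.scale_sum_right[symmetric])
    also have "(\<Sum>x\<in>J - {b}. c x *\<^sub>C w x) + c b *\<^sub>C w b = (\<Sum>x\<in>J. c x *\<^sub>C w x)"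
      using sum.remove[OF J b(1), of "\<lambda>x. c x *\<^sub>C w x"] by (simp add: add.commute)
    finally show "norm (\<phi> - (\<Sum>x\<in>J'. c' x *\<^sub>C w' x)) < \<epsilon>" using \<phi> by simp
    have "(\<Sum>x\<in>J'. (norm (op (w' x) - complex_of_real x *\<^sub>C w' x))\<^sup>2)
        = (\<Sum>x\<in>J - {b}. (norm (k x (w x)))\<^sup>2) + (\<Sum>x\<in>L. (norm (k x (v x)))\<^sup>2)"
      unfolding J'_def sum.union_disjoint[OF fin]
      by (intro arg_cong2[where f = "(+)"] sum.cong refl) (use LJ in \<open>auto simp: w'_def k_def\<close>)
    also have "(\<Sum>x\<in>L. (norm (k x (v x)))\<^sup>2) \<le> (\<Sum>x\<in>L. (t / q + 3 * \<eta>)\<^sup>2)"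
        by (rule sum_mono) (rule kv)
    also have "\<dots> < t\<^sup>2 + \<tau>" using \<eta>(2) L(3) by simp
    also have "(\<Sum>x\<in>J - {b}. (norm (k x (w x)))\<^sup>2) + (t\<^sup>2 + \<tau>) = \<sigma>"
      using sum.remove[OF J b(1), of "\<lambda>x. (norm (k x (w x)))\<^sup>2"]
          unfolding \<tau>_def t_def e_def k_def by linarith
    finally show "(\<Sum>x\<in>J'. (norm (op (w' x) - complex_of_real x *\<^sub>C w' x))\<^sup>2) < \<sigma>" by simp
  qed
  moreover have "x \<in> J - {b} \<and> c' x = c x" if "x \<in> J'" "\<epsilon> \<le> cmod (c' x)" for x
  proof -
    have "x \<notin> L"
    proof
      assume "x \<in> L"
      then have "cmod (c' x) = cmod (c b) / q" using q(1)
          by (simp add: c'_def norm_mult norm_divide)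
      then show False using cq that(2) by simp
    qed
    then show ?thesis using that(1) by (auto simp: J'_def c'_def)
  qed
  ultimately show thesis by (rule that)
qed

text \<open>Induction on the number of bad labels: splitting removes one and creates none, because
  the new coefficients are shorter than \<open>\<epsilon>\<close>.\<close>

lemma approx_diag_spread:
  assumes \<epsilon>: "\<epsilon> > 0" and \<sigma>: "\<sigma> > 0"
  shows "\<exists>J w c. approx_diag \<phi> \<epsilon> \<sigma> J w c \<and> (\<forall>b\<in>J. cmod (c b) < \<epsilon> \<or> b \<notin> ess_spectrum A)"
proof -
  define bad where "bad J c = {b \<in> J. \<epsilon> \<le> cmod (c b) \<and> b \<in> ess_spectrum A}"
      for J :: "real set" and c
  obtain J w c where "approx_diag \<phi> \<epsilon> \<sigma> J w c" using approx_diag_exists[OF assms] by blast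
  then show ?thesis
  proof (induction "card (bad J c)" arbitrary: J w c rule: less_induct)
    case less
    show ?case
    proof (cases "bad J c = {}")
      case True
      then show ?thesis using less.prems by (force simp: bad_def)
    next
      case False
      then obtain b where b: "b \<in> J" "\<epsilon> \<le> cmod (c b)" "b \<in> ess_spectrum A" unfolding bad_def
          by blast
      obtain J' w' c' where ad': "approx_diag \<phi> \<epsilon> \<sigma> J' w' c'"
        and bad': "\<And>x. x \<in> J' \<Longrightarrow> \<epsilon> \<le> cmod (c' x) \<Longrightarrow> x \<in> J - {b} \<and> c' x = c x"
        using approx_diag_split[OF less.prems \<epsilon> b(1,3)] by blast
      have "finite (bad J c)" using less.prems unfolding bad_def approx_diag_def by simp
      moreover have "bad J' c' \<subseteq> bad J c - {b}"
        unfolding bad_def by (auto dest: bad')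
      moreover have "b \<in> bad J c" using b by (simp add: bad_def)
      ultimately have "card (bad J' c') < card (bad J c)"
        by (meson card_Diff1_less card_mono finite_Diff le_less_trans)
      from less.hyps[OF this ad'] show ?thesis .
    qed
  qed
qed

end

section \<open>The generic set\<close>

text \<open>Intervals of radius \<open>s\<close> about the labels have total length below
  \<open>2 \<epsilon>\<close>; divided by \<open>s\<close>, the residuals bound the spectral mass
  outside them, and the factor \<open>card J + 1\<close> makes their sum at most
  \<open>\<epsilon>\<close>, also for empty \<open>J\<close>. \<open>C\<close> occurs only in the
  residuals.\<close>

definition almost_diagonal :: "('a::chilbert_space \<rightharpoonup> 'a) \<Rightarrow> 'a \<Rightarrow> real \<Rightarrow> ('a \<Rightarrow> 'a) set"
  where "almost_diagonal A \<phi> \<epsilon> = {C \<in> sa_hilbert_schmidt. \<exists>J f s. finite J \<and> 0 < s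
      \<and> real (card J) * s < \<epsilon> \<and>
    (\<forall>a\<in>J. f a \<in> dom A) \<and> norm (\<phi> - (\<Sum>a\<in>J. f a)) < \<epsilon> \<and>
    (\<forall>a\<in>J. \<forall>b\<in>J. a \<noteq> b \<longrightarrow> 2 * s \<le> \<bar>a - b\<bar>) \<and>
    (\<forall>a\<in>J. norm (f a) < \<epsilon> \<or> (\<forall>E\<in>ess_spectrum A. s \<le> \<bar>E - a\<bar>)) \<and>
    (\<forall>a\<in>J. real (card J + 1) * norm (the (A (f a)) + C (f a) - complex_of_real a *\<^sub>C f a) < s * \<epsilon>)}"

text \<open>With \<open>J\<close>, \<open>f\<close> and \<open>s\<close> kept fixed, only finitely
  many strict inequalities involve \<open>C\<close>, and each is continuous in it.\<close>

lemma openin_almost_diagonal: "openin hs_topology (almost_diagonal A \<phi> \<epsilon> :: ('a::chilbert_space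
    \<Rightarrow> 'a) set)"
proof -
  interpret Metric_space "sa_hilbert_schmidt :: ('a \<Rightarrow> 'a) set" hs_dist by (rule Metric_space_hs)
  show ?thesis
    unfolding hs_topology_def openin_mtopology
  proof (intro conjI allI impI)
    show "almost_diagonal A \<phi> \<epsilon> \<subseteq> sa_hilbert_schmidt" unfolding almost_diagonal_def by blast
    fix C assume "C \<in> almost_diagonal A \<phi> \<epsilon>"
    then obtain J f s where C: "C \<in> sa_hilbert_schmidt" and J: "finite J"
      and rest: "0 < s" "real (card J) * s < \<epsilon>" "\<forall>a\<in>J. f a \<in> dom A" "norm (\<phi> - (\<Sum>a\<in>J. f a)) < \<epsilon>"
        "\<forall>a\<in>J. \<forall>b\<in>J. a \<noteq> b \<longrightarrow> 2 * s \<le> \<bar>a - b\<bar>"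
        "\<forall>a\<in>J. norm (f a) < \<epsilon> \<or> (\<forall>E\<in>ess_spectrum A. s \<le> \<bar>E - a\<bar>)"
      and d: "\<And>a. a \<in> J \<Longrightarrow> real (card J + 1) * norm (the (A (f a))
          + C (f a) - complex_of_real a *\<^sub>C f a) < s * \<epsilon>"
      unfolding almost_diagonal_def by blast
    let ?n = "\<lambda>C a. norm (the (A (f a)) + C (f a) - complex_of_real a *\<^sub>C f a)"
    have "\<forall>a\<in>J. \<forall>\<^sub>F r in at_right 0. real (card J + 1) * (?n C a + r * norm (f a)) < s * \<epsilon>"
    proof
      fix a assume "a \<in> J"
      have "((\<lambda>r. real (card J + 1) * (?n C a + r * norm (f a))) \<longlongrightarrow> real (card J + 1) * (?n C a
          + 0 * norm (f a))) (at_right 0)"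
        by (intro tendsto_intros)
      then show "\<forall>\<^sub>F r in at_right 0. real (card J + 1) * (?n C a + r * norm (f a)) < s * \<epsilon>"
        using d[OF \<open>a \<in> J\<close>] by (intro order_tendstoD) auto
    qed
    then have "\<forall>\<^sub>F r in at_right 0. (\<forall>a\<in>J. real (card J + 1) * (?n C a + r * norm (f a))
        < s * \<epsilon>) \<and> 0 < r"
      using J by (intro eventually_conj eventually_ball_finite) (simp_all
          add: eventually_at_right_less)
    then obtain r where r: "r > 0" "\<And>a. a \<in> J \<Longrightarrow> real (card J + 1) * (?n C a + r * norm (f a))
        < s * \<epsilon>"
      using eventually_happens'[OF trivial_limit_at_right_real[of 0]] by blast
    have "mball C r \<subseteq> almost_diagonal A \<phi> \<epsilon>"
    proof
      fix C' assume "C' \<in> mball C r"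
      then have C': "C' \<in> sa_hilbert_schmidt" "hs_dist C C' < r" by auto
      have "real (card J + 1) * ?n C' a < s * \<epsilon>" if a: "a \<in> J" for a
      proof -
        have "the (A (f a)) + C' (f a) - complex_of_real a *\<^sub>C f a
            = (the (A (f a)) + C (f a) - complex_of_real a *\<^sub>C f a) - (C (f a) - C' (f a))" by simp
        then have "?n C' a \<le> ?n C a + norm (C (f a) - C' (f a))" by (metis norm_triangle_ineq4)
        also have "norm (C (f a) - C' (f a)) \<le> hs_dist C C' * norm (f a)"
          by (rule norm_diff_le_hs_dist[OF C C'(1)])
        also have "\<dots> \<le> r * norm (f a)" using C'(2) by (intro mult_right_mono) auto
        finally have "real (card J + 1) * ?n C' a \<le> real (card J + 1) * (?n C a + r * norm (f a))"
          by (intro mult_left_mono) auto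
        then show ?thesis using r(2)[OF a] by linarith
      qed
      then show "C' \<in> almost_diagonal A \<phi> \<epsilon>"
        unfolding almost_diagonal_def using C'(1) J rest by blast
    qed
    then show "\<exists>r>0. mball C r \<subseteq> almost_diagonal A \<phi> \<epsilon>" using r(1) by blast
  qed
qed

text \<open>An approximate diagonalization of \<open>A + C0\<close> is corrected to an exact one by
  a small \<open>C1\<close>. The bad labels are already spread out, since \<open>A + C0\<close> and
  \<open>A\<close> have the same essential spectrum.\<close>

lemma almost_diagonal_dense:
  fixes A :: "'a::chilbert_space \<rightharpoonup> 'a"
  assumes A: "self_adjoint A" and C0: "C0 \<in> sa_hilbert_schmidt" and \<epsilon>: "\<epsilon> > 0" and \<delta>: "\<delta> > 0"
  shows "\<exists>C\<in>almost_diagonal A \<phi> \<epsilon>. hs_dist C0 C < \<delta>"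
proof -
  interpret B: self_adjoint_operator "perturb A C0"
    by unfold_locales (rule self_adjoint_perturb[OF A C0])
  have DB: "B.D = dom A" unfolding B.D_def by (auto simp: perturb_def)
  have opB: "B.op x = the (A x) + C0 x" if "x \<in> dom A" for x
    using that unfolding B.op_def by (auto simp: perturb_def)
  \<comment> \<open>Chosen so that the bound \<open>2 * sqrt \<sigma>\<close> for the correction
    equals \<open>\<delta>\<close>.\<close>
  define \<sigma> where "\<sigma> = (\<delta> / 2)\<^sup>2"
  have "\<sigma> > 0" using \<delta> by (simp add: \<sigma>_def)
  from B.approx_diag_spread[OF \<epsilon> this, of \<phi>]
  obtain J w c where ad: "B.approx_diag \<phi> \<epsilon> \<sigma> J w c"
    and good: "\<And>b. b \<in> J \<Longrightarrow> cmod (c b) < \<epsilon> \<or> b \<notin> ess_spectrum A"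
    unfolding ess_spectrum_perturb[OF C0] by blast
  have J: "finite J" and wD: "\<And>b. b \<in> J \<Longrightarrow> w b \<in> B.D"
    and on: "\<And>b b'. b \<in> J \<Longrightarrow> b' \<in> J \<Longrightarrow> cinner (w b) (w b') = (if b = b' then 1 else 0)"
    and \<phi>: "norm (\<phi> - (\<Sum>b\<in>J. c b *\<^sub>C w b)) < \<epsilon>"
    and \<sigma>: "(\<Sum>b\<in>J. (norm (B.op (w b) - complex_of_real b *\<^sub>C w b))\<^sup>2) < \<sigma>"
    using ad unfolding B.approx_diag_def by auto
  obtain C1 where C1: "C1 \<in> sa_hilbert_schmidt"
      "hs_norm C1 \<le> 2 * sqrt (\<Sum>b\<in>J. (norm (B.op (w b) - complex_of_real b *\<^sub>C w b))\<^sup>2)"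
      "\<And>b. b \<in> J \<Longrightarrow> C1 (w b) = - (B.op (w b) - complex_of_real b *\<^sub>C w b)"
    using B.perturb_to_eigenvectors[OF J wD on] by blast
  define C where "C x = C0 x + C1 x" for x
  have CI: "C \<in> sa_hilbert_schmidt" using sa_hs_add[OF C0 C1(1)] by (simp add: C_def[abs_def])
  have "hs_norm C1 < 2 * sqrt \<sigma>" using C1(2) real_sqrt_less_mono[OF \<sigma>] by linarith
  also have "\<dots> = \<delta>" using \<delta> by (simp add: \<sigma>_def)
  finally have dist: "hs_dist C0 C < \<delta>" by (simp add: hs_dist_def hs_norm_def C_def)
  define f where "f b = c b *\<^sub>C w b" for b
  have nf: "norm (f b) = cmod (c b)" if "b \<in> J" for b
  proof -
    have "(norm (w b))\<^sup>2 = 1" using on[OF that that] by (simp add: norm_sq_cinner)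
    then have "norm (w b) = 1" by (simp add: power2_eq_1_iff)
      (metis norm_ge_zero not_one_le_zero neg_0_le_iff_le)
    then show ?thesis by (simp add: f_def)
  qed
  have fD: "f b \<in> dom A" if "b \<in> J" for b using B.D_scale[OF wD[OF that]] DB by (simp add: f_def)
  have eig: "the (A (f b)) + C (f b) - complex_of_real b *\<^sub>C f b = 0" if b: "b \<in> J" for b
  proof -
    have "the (A (f b)) + C0 (f b) = c b *\<^sub>C B.op (w b)"
      using opB[OF fD[OF b]] B.op_scale[OF wD[OF b], of "c b"] by (simp add: f_def)
    moreover have "C1 (f b) = c b *\<^sub>C - (B.op (w b) - complex_of_real b *\<^sub>C w b)"
      unfolding f_def clinear_scaleC[OF sa_hs_clinear[OF C1(1)]] C1(3)[OF b] ..
    ultimately have "the (A (f b)) + C (f b) = complex_of_real b *\<^sub>C f b"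
      by (simp add: C_def add.assoc[symmetric] f_def cvec.scale_right_diff_distrib mult.commute)
    then show ?thesis by simp
  qed
  \<comment> \<open>The residuals are exactly 0, so \<open>s\<close> is subject only to finitely
    many positive upper bounds and can be chosen last.\<close>
  have ev1: "\<forall>\<^sub>F s in at_right 0. real (card J) * s < \<epsilon>"
  proof (rule order_tendstoD)
    show "((\<lambda>s. real (card J) * s) \<longlongrightarrow> real (card J) * 0) (at_right 0)" by (intro tendsto_intros)
  qed (use \<epsilon> in simp)
  have small: "\<forall>\<^sub>F s in at_right 0. 2 * s \<le> r" if "r > 0" for r :: real
    unfolding eventually_at_right_field by (rule exI[of _ "r / 2"]) (use that in auto)
  have ev2: "\<forall>\<^sub>F s in at_right 0. \<forall>a\<in>J. \<forall>b\<in>J. a \<noteq> b \<longrightarrow> 2 * s \<le> \<bar>a - b\<bar>"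
  proof (intro eventually_ball_finite[OF J] ballI)
    fix a b :: real
    show "\<forall>\<^sub>F s in at_right 0. a \<noteq> b \<longrightarrow> 2 * s \<le> \<bar>a - b\<bar>"
      by (cases "a = b") (auto intro: small)
  qed
  have ev3: "\<forall>\<^sub>F s in at_right 0. \<forall>a\<in>J. norm (f a) < \<epsilon> \<or> (\<forall>E\<in>ess_spectrum A. s \<le> \<bar>E - a\<bar>)"
  proof (intro eventually_ball_finite[OF J] ballI)
    fix a assume a: "a \<in> J"
    show "\<forall>\<^sub>F s in at_right 0. norm (f a) < \<epsilon> \<or> (\<forall>E\<in>ess_spectrum A. s \<le> \<bar>E - a\<bar>)"
    proof (cases "norm (f a) < \<epsilon>")
      case False
      then have "a \<notin> ess_spectrum A" using good[OF a] nf[OF a] by simp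
      then obtain s0 where s0: "s0 > 0" "\<And>E. E \<in> ess_spectrum A \<Longrightarrow> s0 \<le> \<bar>E - a\<bar>"
        using ess_spectrum_closed by blast
      show ?thesis
        using small[OF s0(1)] by eventually_elim (use s0 in fastforce)
    qed simp
  qed
  have "\<forall>\<^sub>F s in at_right 0. (real (card J) * s < \<epsilon> \<and> (\<forall>a\<in>J. \<forall>b\<in>J. a \<noteq> b \<longrightarrow> 2 * s \<le> \<bar>a - b\<bar>)) \<and>
      (\<forall>a\<in>J. norm (f a) < \<epsilon> \<or> (\<forall>E\<in>ess_spectrum A. s \<le> \<bar>E - a\<bar>)) \<and> 0 < s"
    by (intro eventually_conj ev1 ev2 ev3 eventually_at_right_less)
  then obtain s where s: "real (card J) * s < \<epsilon>" "\<forall>a\<in>J. \<forall>b\<in>J. a \<noteq> b \<longrightarrow> 2 * s \<le> \<bar>a - b\<bar>"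
      "\<forall>a\<in>J. norm (f a) < \<epsilon> \<or> (\<forall>E\<in>ess_spectrum A. s \<le> \<bar>E - a\<bar>)" "0 < s"
    using eventually_happens'[OF trivial_limit_at_right_real[of 0]] by blast
  have "\<forall>a\<in>J. real (card J + 1) * norm (the (A (f a)) + C (f a) - complex_of_real a *\<^sub>C f a)
      < s * \<epsilon>"
    using eig s(4) \<epsilon> by simp
  moreover have "\<forall>a\<in>J. f a \<in> dom A" using fD by blast
  moreover have "norm (\<phi> - (\<Sum>a\<in>J. f a)) < \<epsilon>" using \<phi> by (simp add: f_def)
  ultimately have "C \<in> almost_diagonal A \<phi> \<epsilon>"
    unfolding almost_diagonal_def using CI J s by blast
  then show ?thesis using dist by blast
qed

section \<open>Spectral consequences of almost diagonality\<close>

context self_adjoint_operator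
begin

text \<open>A Chebyshev estimate: on \<open>M\<close> the function \<open>1 / (x - a)\<close> is
  bounded by \<open>1 / s\<close>, and applied to the residual it returns the part of
  \<open>\<psi>\<close> over \<open>M\<close>.\<close>

lemma proj_away:
  assumes M: "M \<in> sets borel" "\<And>x. x \<in> M \<Longrightarrow> s \<le> \<bar>x - a\<bar>" and s: "s > 0" and \<psi>: "\<psi> \<in> D"
  shows "norm (proj M \<psi>) \<le> norm (op \<psi> - complex_of_real a *\<^sub>C \<psi>) / s"
proof -
  define f where "f = (\<lambda>x. (x - a) / max (s\<^sup>2) ((x - a)\<^sup>2))"
  have f: "\<exists>T. fc (\<lambda>x. complex_of_real (f x)) T" "\<bar>f x\<bar> \<le> 1 / s" "s \<le> \<bar>x - a\<bar> \<Longrightarrow> (x - a) * f x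
      = 1" for x
    unfolding f_def by (rule clipped_inverse[OF s]; assumption?)+
  obtain Q where Q: "fc (\<lambda>x. complex_of_real (f x)) Q" using f(1) by blast
  define g where "g x = complex_of_real (f x) * indicator M x" for x
  define T where "T \<psi> = Q (proj M \<psi>)" for \<psi>
  have T: "fc g T" unfolding g_def T_def by (rule fc_mult[OF Q fc_proj[OF M(1)]])
  have "indicator M x + complex_of_real a * g x = g x * complex_of_real x" for x
  proof (cases "x \<in> M")
    case True
    then have "complex_of_real ((x - a) * f x) = 1" using f(3)[OF M(2)] by simp
    then show ?thesis using True by (simp add: g_def algebra_simps)
  qed (simp add: g_def)
  then have "fc (\<lambda>x. g x * complex_of_real x) (\<lambda>\<psi>. proj M \<psi> + complex_of_real a *\<^sub>C T \<psi>)"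
    using fc_add[OF fc_proj[OF M(1)] fc_scale[OF T, of "complex_of_real a"]] by simp
  from fc_op[OF T this \<psi>] have "proj M \<psi> = T (op \<psi> - complex_of_real a *\<^sub>C \<psi>)"
    by (simp add: clinear_diff[OF fc_clinear[OF T]] clinear_scaleC[OF fc_clinear[OF T]] eq_diff_eq)
  also have "norm \<dots> \<le> 1 / s * norm (op \<psi> - complex_of_real a *\<^sub>C \<psi>)"
  proof (rule fc_norm_le[OF T])
    show "cmod (g x) \<le> 1 / s" for x
      using f(2)[of x] s by (cases "x \<in> M") (auto simp: g_def)
  qed
  finally show ?thesis by simp
qed

lemma norm_proj_le: "M \<in> sets borel \<Longrightarrow> norm (proj M \<psi>) \<le> norm \<psi>"
  using fc_norm_le[OF fc_proj, of M 1 \<psi>] by (simp add: indicator_def)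

text \<open>The data of \<open>almost_diagonal\<close> for a fixed \<open>C\<close>, which is
  absorbed into \<open>op\<close>; \<open>S\<close> stands for the essential spectrum of the
  unperturbed operator.\<close>

context
  fixes \<phi> :: 'a and \<epsilon> s :: real and J :: "real set" and f :: "real \<Rightarrow> 'a" and S :: "real set"
  assumes J: "finite J" and s: "0 < s" and card_s: "real (card J) * s < \<epsilon>"
    and fD: "\<And>a. a \<in> J \<Longrightarrow> f a \<in> D"
    and \<phi>: "norm (\<phi> - (\<Sum>a\<in>J. f a)) < \<epsilon>"
    and sep: "\<And>a b. a \<in> J \<Longrightarrow> b \<in> J \<Longrightarrow> a \<noteq> b \<Longrightarrow> 2 * s \<le> \<bar>a - b\<bar>"
    and S: "\<And>a E. a \<in> J \<Longrightarrow> norm (f a) < \<epsilon> \<or> (\<forall>E\<in>S. s \<le> \<bar>E - a\<bar>)"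
    and res: "\<And>a. a \<in> J \<Longrightarrow> real (card J + 1) * norm (op (f a) - complex_of_real a *\<^sub>C f a) < s * \<epsilon>"
begin

lemma sum_residuals: "(\<Sum>a\<in>J. norm (op (f a) - complex_of_real a *\<^sub>C f a) / s) \<le> \<epsilon>"
proof -
  have \<epsilon>: "\<epsilon> > 0" using \<phi> norm_ge_zero le_less_trans by blast
  have "(\<Sum>a\<in>J. norm (op (f a) - complex_of_real a *\<^sub>C f a) / s) \<le> (\<Sum>a\<in>J. \<epsilon> / real (card J + 1))"
  proof (rule sum_mono)
    fix a assume "a \<in> J"
    then show "norm (op (f a) - complex_of_real a *\<^sub>C f a) / s \<le> \<epsilon> / real (card J + 1)"
      using less_imp_le[OF res[of a]] s by (simp add: field_simps)
  qed
  also have "\<dots> \<le> \<epsilon>" using \<epsilon> by (simp add: field_simps)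
  finally show ?thesis .
qed

text \<open>By symmetry \<open>(E - a)\<close> times the overlap of \<open>f a\<close> with
  \<open>\<psi>\<close> is the overlap of the residual. One \<open>\<epsilon>\<close> pays for
  approximating \<open>\<phi>\<close>, one for the residuals of labels at distance at least
  \<open>s\<close> from \<open>E\<close>, and one for the single label that separation allows
  closer, whose vector is short because \<open>E\<close> is in \<open>S\<close>.\<close>

lemma eigenvector_overlap_le:
  assumes \<psi>: "\<psi> \<in> D" "op \<psi> = complex_of_real E *\<^sub>C \<psi>" and E: "E \<in> S"
  shows "cmod (cinner \<phi> \<psi>) \<le> 3 * \<epsilon> * norm \<psi>"
proof -
  have \<epsilon>: "\<epsilon> > 0" using \<phi> norm_ge_zero le_less_trans by blast
  have dist: "\<bar>E - a\<bar> * cmod (cinner (f a) \<psi>) \<le> norm (op (f a) - complex_of_real a *\<^sub>C f a) *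
      norm \<psi>" if a: "a \<in> J" for a
  proof -
    have "complex_of_real (E - a) * cinner (f a) \<psi> = cinner (op (f a) - complex_of_real a *\<^sub>C f
        a) \<psi>"
      using op_symmetric[OF fD[OF a] \<psi>(1)] by (simp add: \<psi>(2) cinner_simps algebra_simps)
    then have "\<bar>E - a\<bar> * cmod (cinner (f a) \<psi>) = cmod (cinner (op (f a) - complex_of_real a *\<^sub>C
        f a) \<psi>)"
      by (metis norm_mult norm_of_real)
    then show ?thesis using cinner_cauchy_schwarz by simp
  qed
  have each: "cmod (cinner (f a) \<psi>) \<le> norm (op (f a) - complex_of_real a *\<^sub>C f a) / s * norm \<psi>
      + (if \<bar>E - a\<bar> < s then \<epsilon> * norm \<psi> else 0)"
    if a: "a \<in> J" for a
  proof (cases "\<bar>E - a\<bar> < s")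
    case True
    then have "norm (f a) < \<epsilon>" using S[OF a] E by fastforce
    then have "cmod (cinner (f a) \<psi>) \<le> \<epsilon> * norm \<psi>"
      using cinner_cauchy_schwarz[of "f a" \<psi>] by (meson less_imp_le mult_right_mono norm_ge_zero
          order_trans)
    moreover have "0 \<le> norm (op (f a) - complex_of_real a *\<^sub>C f a) / s * norm \<psi>" using s by simp
    ultimately show ?thesis by (subst if_P[OF True]) linarith
  next
    case False
    then have "s * cmod (cinner (f a) \<psi>) \<le> \<bar>E - a\<bar> * cmod (cinner (f a) \<psi>)"
        by (intro mult_right_mono) auto
    with dist[OF a] have "s * cmod (cinner (f a) \<psi>) \<le> norm (op (f a) - complex_of_real a *\<^sub>C f
        a) * norm \<psi>" by linarith
    then show ?thesis using False s by (simp add: field_simps)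
  qed
  have near: "(\<Sum>a\<in>J. if \<bar>E - a\<bar> < s then \<epsilon> * norm \<psi> else 0) \<le> \<epsilon> * norm \<psi>"
  proof -
    have "card {a \<in> J. \<bar>E - a\<bar> < s} \<le> Suc 0"
    proof (subst card_le_Suc0_iff_eq)
      show "\<forall>a1\<in>{a \<in> J. \<bar>E - a\<bar> < s}. \<forall>a2\<in>{a \<in> J. \<bar>E - a\<bar> < s}. a1 = a2"
        using sep by fastforce
    qed (use J in simp)
    then have "real (card {a \<in> J. \<bar>E - a\<bar> < s}) * (\<epsilon> * norm \<psi>) \<le> 1 * (\<epsilon> * norm \<psi>)"
      using \<epsilon> by (intro mult_right_mono) auto
    then show ?thesis using J by (simp add: sum.If_cases Int_def)
  qed
  have "cinner \<phi> \<psi> = cinner (\<phi> - (\<Sum>a\<in>J. f a)) \<psi> + (\<Sum>a\<in>J. cinner (f a) \<psi>)"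
    by (simp add: cinner_diff_left cinner_sum_left)
  then have "cmod (cinner \<phi> \<psi>) \<le> cmod (cinner (\<phi> - (\<Sum>a\<in>J. f a)) \<psi>) + cmod (\<Sum>a\<in>J. cinner (f a) \<psi>)"
    by (metis norm_triangle_ineq)
  also have "cmod (cinner (\<phi> - (\<Sum>a\<in>J. f a)) \<psi>) \<le> \<epsilon> * norm \<psi>"
    using cinner_cauchy_schwarz less_imp_le[OF \<phi>] by (meson mult_right_mono norm_ge_zero
        order_trans)
  also have "cmod (\<Sum>a\<in>J. cinner (f a) \<psi>) \<le> (\<Sum>a\<in>J. norm (op (f a) - complex_of_real a *\<^sub>C f a) /
      s * norm \<psi> + (if \<bar>E - a\<bar> < s then \<epsilon> * norm \<psi> else 0))"
    by (rule sum_norm_le) (rule each)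
  also have "\<dots> = (\<Sum>a\<in>J. norm (op (f a) - complex_of_real a *\<^sub>C f a) / s) * norm \<psi>
      + (\<Sum>a\<in>J. if \<bar>E - a\<bar> < s then \<epsilon> * norm \<psi> else 0)"
    by (simp only: sum.distrib sum_distrib_right)
  also have "\<dots> \<le> \<epsilon> * norm \<psi> + \<epsilon> * norm \<psi>"
    by (intro add_mono near mult_right_mono sum_residuals) simp
  finally show ?thesis by simp
qed

text \<open>\<open>N\<close> is the union of the intervals of radius \<open>s\<close> about the
  labels. Outside it \<open>\<phi>\<close> keeps at most the approximation error and, by
  \<open>proj_away\<close>, the residuals divided by \<open>s\<close>.\<close>

lemma concentrated_on_small_set:
  "\<exists>N\<in>sets borel. emeasure lborel N \<le> ennreal (2 * \<epsilon>) \<and> norm (proj (- N) \<phi>) \<le> 2 * \<epsilon>"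
proof (intro bexI conjI)
  define N where "N = (\<Union>a\<in>J. {a - s..a + s})"
  show N: "N \<in> sets borel" unfolding N_def using J by (intro sets.finite_UN) auto
  have "emeasure lborel N \<le> (\<Sum>a\<in>J. emeasure lborel {a - s..a + s})"
    unfolding N_def using J by (intro emeasure_subadditive_finite) auto
  also have "\<dots> = (\<Sum>a\<in>J. ennreal (2 * s))" using s by (intro sum.cong) auto
  also have "\<dots> = ennreal (real (card J) * (2 * s))" using s
      by (simp add: ennreal_mult ennreal_of_nat_eq_real_of_nat)
  also have "\<dots> \<le> ennreal (2 * \<epsilon>)" using card_s by (intro ennreal_leI) linarith
  finally show "emeasure lborel N \<le> ennreal (2 * \<epsilon>)" .
  have cN: "- N \<in> sets borel" using N by simp
  have lin: "clinear (proj (- N))" by (rule clinear_proj[OF cN])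
  have "proj (- N) \<phi> = proj (- N) (\<phi> - (\<Sum>a\<in>J. f a)) + (\<Sum>a\<in>J. proj (- N) (f a))"
    by (simp add: clinear_diff[OF lin] clinear_sum[OF lin])
  then have "norm (proj (- N) \<phi>) \<le> norm (proj (- N) (\<phi> - (\<Sum>a\<in>J. f a)))
      + norm (\<Sum>a\<in>J. proj (- N) (f a))"
    by (metis norm_triangle_ineq)
  also have "norm (proj (- N) (\<phi> - (\<Sum>a\<in>J. f a))) \<le> \<epsilon>"
    using norm_proj_le[OF cN] less_imp_le[OF \<phi>] by (rule order_trans)
  also have "norm (\<Sum>a\<in>J. proj (- N) (f a)) \<le> (\<Sum>a\<in>J. norm (op (f a) - complex_of_real a *\<^sub>C f a)
      / s)"
  proof (rule sum_norm_le)
    fix a assume a: "a \<in> J"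
    have "s \<le> \<bar>x - a\<bar>" if "x \<in> - N" for x
      using that a by (fastforce simp: N_def)
    then show "norm (proj (- N) (f a)) \<le> norm (op (f a) - complex_of_real a *\<^sub>C f a) / s"
      by (intro proj_away cN s fD a)
  qed
  also have "\<dots> \<le> \<epsilon>" by (rule sum_residuals)
  finally show "norm (proj (- N) \<phi>) \<le> 2 * \<epsilon>" by simp
qed

end

text \<open>Borel-Cantelli with sets of size \<open>(1/2) ^ k\<close>: their limsup is Lebesgue null
  and carries the whole spectral measure.\<close>

lemma smeas_singular:
  assumes conc: "\<And>\<epsilon>. \<epsilon> > 0 \<Longrightarrow> \<exists>N\<in>sets borel. emeasure lborel N \<le> ennreal \<epsilon> \<and> norm (proj (- N) \<psi>) \<le> \<epsilon>"
  shows "\<exists>N\<in>null_sets lborel. emeasure (smeas \<psi>) (UNIV - N) = 0"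
proof -
  have "\<forall>k. \<exists>N\<in>sets borel. emeasure lborel N \<le> ennreal ((1/2) ^ k) \<and> norm (proj (- N) \<psi>)
      \<le> (1/2) ^ k"
    using conc by simp
  then obtain N where N: "\<And>k. N k \<in> sets borel" "\<And>k. emeasure lborel (N k) \<le> ennreal ((1/2) ^ k)"
    "\<And>k. norm (proj (- N k) \<psi>) \<le> (1/2) ^ k" by metis
  have "limsup N \<in> null_sets lborel"
  proof (rule borel_cantelli_limsup1)
    show "N k \<in> sets lborel" for k using N(1) by simp
    show "emeasure lborel (N k) < \<infinity>" for k using N(2)[of k] by (auto intro: le_less_trans)
    have le: "measure lborel (N k) \<le> (1/2) ^ k" for k
      using N(2)[of k] unfolding measure_def by (intro enn2real_leI) auto
    show "summable (\<lambda>k. measure lborel (N k))"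
    proof (rule summable_comparison_test'[where g = "\<lambda>k. (1/2) ^ k" and N = 0])
      show "summable (\<lambda>k. (1/2 :: real) ^ k)" by (rule summable_geometric) simp
      show "norm (measure lborel (N k)) \<le> (1/2) ^ k" for k using le[of k] by simp
    qed
  qed
  moreover have "emeasure (smeas \<psi>) (UNIV - limsup N) = 0"
  proof -
    \<comment> \<open>The complement consists of the points that are eventually outside
      \<open>N k\<close>. Each intersection has mass at most \<open>(1/4) ^ k\<close> for all
      \<open>k \<ge> m\<close>, hence mass 0.\<close>
    have "UNIV - limsup N = (\<Union>m. \<Inter>k\<in>{m..}. - N k)" by (auto simp: limsup_INF_SUP)
    moreover have "(\<Inter>k\<in>{m..}. - N k) \<in> null_sets (smeas \<psi>)" for m
    proof (rule null_setsI)
      have sets: "(\<Inter>k\<in>{m..}. - N k) \<in> sets borel"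
        by (intro sets.countable_INT'') (use N(1) in auto)
      then show "(\<Inter>k\<in>{m..}. - N k) \<in> sets (smeas \<psi>)" by (simp add: smeas.M_is_borel)
      have "emeasure (smeas \<psi>) (\<Inter>k\<in>{m..}. - N k) \<le> ennreal ((1/4) ^ k)" if "k \<ge> m" for k
      proof -
        have "emeasure (smeas \<psi>) (\<Inter>k\<in>{m..}. - N k) \<le> emeasure (smeas \<psi>) (- N k)"
          using N(1) that by (intro emeasure_mono) (auto simp: smeas.M_is_borel)
        also have "\<dots> = ennreal ((norm (proj (- N k) \<psi>))\<^sup>2)" using N(1)
            by (intro emeasure_smeas) simp
        also have "\<dots> \<le> ennreal (((1/2) ^ k)\<^sup>2)" using N(3) by (intro ennreal_leI power_mono) auto
        also have "((1/2) ^ k)\<^sup>2 = ((1/4) ^ k :: real)" 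
          by (subst power_mult[symmetric], subst mult.commute, subst power_mult)
              (simp add: power2_eq_square)
        finally show ?thesis .
      qed
      moreover have "(\<lambda>k. ennreal ((1/4) ^ k)) \<longlonglongrightarrow> ennreal 0"
        by (intro tendsto_ennrealI LIMSEQ_power_zero) simp
      ultimately have "emeasure (smeas \<psi>) (\<Inter>k\<in>{m..}. - N k) \<le> ennreal 0"
        by (intro LIMSEQ_le_const) auto
      then show "emeasure (smeas \<psi>) (\<Inter>k\<in>{m..}. - N k) = 0" by simp
    qed
    ultimately show ?thesis using null_sets_UN[of "\<lambda>m. \<Inter>k\<in>{m..}. - N k"]
        by (simp add: null_sets_def)
  qed
  ultimately show ?thesis by blast
qed

end

lemma purely_singular_continuousI:
  assumes "sets \<mu> = sets borel" "singular_continuous \<mu>"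
  shows "purely_singular_continuous \<mu>"
proof -
  have "lebesgue_decomposition \<mu> (null_measure borel) (null_measure borel) \<mu>"
    unfolding lebesgue_decomposition_def pure_point_def absolutely_continuous_def using assms
    by (auto simp: null_sets_def intro: exI[of _ "{}"])
  then show ?thesis unfolding purely_singular_continuous_def by fastforce
qed

text \<open>Eigenvectors whose eigenvalue lies in the essential spectrum are excluded by density
  of \<open>X\<close>, hence a vector orthogonal to the whole set below is orthogonal to all eigenvectors
  and its spectral measure has no atoms.\<close>

lemma almost_diagonal_imp_total:
  fixes A :: "'a::chilbert_space \<rightharpoonup> 'a"
  assumes A: "self_adjoint A" and X: "closure X = UNIV" and C: "C \<in> sa_hilbert_schmidt"
    and CO: "\<And>\<phi> \<epsilon>. \<phi> \<in> X \<Longrightarrow> \<epsilon> > 0 \<Longrightarrow> \<exists>\<epsilon>'>0. \<epsilon>' \<le> \<epsilon> \<and> C \<in> almost_diagonal A \<phi> \<epsilon>'"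
  shows "closure (cvec.span
        ({\<psi>. purely_singular_continuous (spectral_measure (perturb A C) \<psi>)} \<union>
         {\<psi>. \<exists>E\<in>disc_spectrum (perturb A C). perturb A C \<psi> = Some (E *\<^sub>C \<psi>)})) = UNIV"
    (is "closure (cvec.span (?P \<union> ?Q)) = UNIV")
proof (rule dense_subspaceI[OF cvec.subspace_span])
  interpret B: self_adjoint_operator "perturb A C"
    by unfold_locales (rule self_adjoint_perturb[OF A C])
  have DB: "B.D = dom A" unfolding B.D_def by (auto simp: perturb_def)
  have opB: "B.op x = the (A x) + C x" if "x \<in> dom A" for x
    using that unfolding B.op_def by (auto simp: perturb_def)
  \<comment> \<open>The alternative \<open>\<psi> = 0\<close> lets \<open>conc\<close>, which does
    not speak of \<open>\<psi>\<close>, be used with dummy values 0 later on.\<close>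
  have overlap: "cmod (cinner \<phi> \<psi>) \<le> 3 * \<epsilon> * norm \<psi>"
      and conc: "\<exists>N\<in>sets borel. emeasure lborel N \<le> ennreal (2 * \<epsilon>) \<and> norm (B.proj (- N) \<phi>) \<le> 2 * \<epsilon>"
    if CO: "C \<in> almost_diagonal A \<phi> \<epsilon>" and eig: "\<psi> \<in> B.D" "B.op \<psi>
        = complex_of_real E *\<^sub>C \<psi>" "E \<in> ess_spectrum A \<or> \<psi> = 0"
    for \<phi> \<psi> E \<epsilon>
  proof -
    obtain J f s where J: "finite J" "0 < s" "real (card J) * s < \<epsilon>" "\<forall>a\<in>J. f a \<in> dom A"
        "norm (\<phi> - (\<Sum>a\<in>J. f a)) < \<epsilon>" "\<forall>a\<in>J. \<forall>b\<in>J. a \<noteq> b \<longrightarrow> 2 * s \<le> \<bar>a - b\<bar>"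
        "\<forall>a\<in>J. norm (f a) < \<epsilon> \<or> (\<forall>E\<in>ess_spectrum A. s \<le> \<bar>E - a\<bar>)"
        "\<forall>a\<in>J. real (card J + 1) * norm (the (A (f a)) + C (f a) - complex_of_real a *\<^sub>C f a)
            < s * \<epsilon>"
      using CO unfolding almost_diagonal_def by blast
    note * = J(1-3) bspec[OF J(4)] J(5) mp[OF bspec[OF bspec[OF J(6)]]] bspec[OF J(7)] bspec[OF
        J(8)]
    have fD: "f a \<in> B.D" if "a \<in> J" for a using *(4) that DB by simp
    have res: "real (card J + 1) * norm (B.op (f a) - complex_of_real a *\<^sub>C f a) < s * \<epsilon>"
        if "a \<in> J" for a
      using *(8)[OF that] opB[OF *(4)[OF that]] by simp
    show "cmod (cinner \<phi> \<psi>) \<le> 3 * \<epsilon> * norm \<psi>"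
    proof (cases "\<psi> = 0")
      case False
      show ?thesis
        by (rule B.eigenvector_overlap_le[OF *(1-3) fD *(5,6,7) res eig(1,2)]) (use eig(3) False
            in auto)
    qed simp
    show "\<exists>N\<in>sets borel. emeasure lborel N \<le> ennreal (2 * \<epsilon>) \<and> norm (B.proj (- N) \<phi>) \<le> 2 * \<epsilon>"
      by (rule B.concentrated_on_small_set[OF *(1-3) fD *(5,6,7) res])
  qed
  have eig_disc: "E \<in> disc_spectrum (perturb A C)" if eig: "perturb A C \<psi>
      = Some (E *\<^sub>C \<psi>)" and nz: "\<psi> \<noteq> 0" for E \<psi>
  proof -
    have E: "E = complex_of_real (Re E)" by (rule B.eigenvalue_real[OF eig nz])
    then have \<psi>: "\<psi> \<in> B.D" "B.op \<psi> = complex_of_real (Re E) *\<^sub>C \<psi>" using eig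
        by (auto simp: B.A_eq_Some_iff)
    have "Re E \<notin> ess_spectrum A"
    proof
      assume ess: "Re E \<in> ess_spectrum A"
      have "cinner \<phi> \<psi> = 0" if \<phi>: "\<phi> \<in> X" for \<phi>
      proof (rule ccontr)
        assume "cinner \<phi> \<psi> \<noteq> 0"
        \<comment> \<open>The divisor 6 is twice the 3 of the overlap estimate, so the overlap will
          be at most half of itself.\<close>
        then have pos: "cmod (cinner \<phi> \<psi>) / (6 * norm \<psi>) > 0" using nz by simp
        obtain \<epsilon> where \<epsilon>: "\<epsilon> > 0" "\<epsilon> \<le> cmod (cinner \<phi> \<psi>) / (6 * norm \<psi>)" "C \<in> almost_diagonal A \<phi> \<epsilon>"
          using CO[OF \<phi> pos] by blast
        have "cmod (cinner \<phi> \<psi>) \<le> 3 * \<epsilon> * norm \<psi>" using overlap[OF \<epsilon>(3) \<psi>] ess by blast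
        moreover have "\<epsilon> * (6 * norm \<psi>) \<le> cmod (cinner \<phi> \<psi>)" using \<epsilon>(2) nz
            by (simp add: field_simps)
        moreover have "\<epsilon> * (6 * norm \<psi>) = 2 * (3 * \<epsilon> * norm \<psi>)" by simp
        ultimately have "cmod (cinner \<phi> \<psi>) \<le> 0" by linarith
        then show False using \<open>cinner \<phi> \<psi> \<noteq> 0\<close> by simp
      qed
      then have "\<psi> = 0" by (rule orth_dense_imp_zero[OF X])
      with nz show False by simp
    qed
    then have "complex_of_real (Re E) \<in> disc_spectrum (perturb A C)"
      using eig nz E by (intro B.disc_spectrum_if_not_ess[of \<psi>]) (auto
          simp: ess_spectrum_perturb[OF C])
    with E show ?thesis by simp
  qed
  have conc_all: "\<exists>N\<in>sets borel. emeasure lborel N \<le> ennreal \<epsilon> \<and> norm (B.proj (- N) \<psi>) \<le> \<epsilon>"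
      if \<epsilon>: "\<epsilon> > 0" for \<epsilon> \<psi>
  proof -
    obtain \<phi> where \<phi>: "\<phi> \<in> X" "dist \<phi> \<psi> < \<epsilon> / 2"
      using X closure_approachable[of \<psi> X] half_gt_zero[OF \<epsilon>] by blast
    \<comment> \<open>With \<open>\<epsilon>' \<le> \<epsilon> / 4\<close> the bounds for
      \<open>\<phi>\<close> are at most \<open>\<epsilon> / 2\<close>; the other half pays for
      replacing \<open>\<psi>\<close> by \<open>\<phi>\<close>.\<close>
    obtain \<epsilon>' where \<epsilon>': "\<epsilon>' > 0" "\<epsilon>' \<le> \<epsilon> / 4" "C \<in> almost_diagonal A \<phi> \<epsilon>'"
        using CO[OF \<phi>(1), of "\<epsilon> / 4"] \<epsilon> by auto
    obtain N where N: "N \<in> sets borel" "emeasure lborel N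
        \<le> ennreal (2 * \<epsilon>')" "norm (B.proj (- N) \<phi>) \<le> 2 * \<epsilon>'"
      using conc[OF \<epsilon>'(3), of 0 0] by auto
    have cN: "- N \<in> sets borel" using N(1) by simp
    have "B.proj (- N) \<psi> = B.proj (- N) \<phi> + B.proj (- N) (\<psi> - \<phi>)"
      by (simp add: clinear_diff[OF B.clinear_proj[OF cN]])
    then have "norm (B.proj (- N) \<psi>) \<le> norm (B.proj (- N) \<phi>) + norm (B.proj (- N) (\<psi> - \<phi>))"
      by (metis norm_triangle_ineq)
    also have "norm (B.proj (- N) (\<psi> - \<phi>)) \<le> norm (\<psi> - \<phi>)" by (rule B.norm_proj_le[OF cN])
    finally have "norm (B.proj (- N) \<psi>) \<le> \<epsilon>"
      using N(3) \<epsilon>'(2) \<phi>(2) by (simp add: dist_norm norm_minus_commute)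
    moreover have "emeasure lborel N \<le> ennreal \<epsilon>"
      using N(2) \<epsilon>' \<epsilon> by (auto intro: order_trans ennreal_leI)
    ultimately show ?thesis using N(1) by blast
  qed
  fix \<psi> assume orth: "\<And>y. y \<in> cvec.span (?P \<union> ?Q) \<Longrightarrow> cinner y \<psi> = 0"
  have "emeasure (B.smeas \<psi>) {E} = 0" for E
  proof (rule B.smeas_no_atom)
    fix \<phi> assume \<phi>: "perturb A C \<phi> = Some (complex_of_real E *\<^sub>C \<phi>)"
    show "cinner \<phi> \<psi> = 0"
    proof (cases "\<phi> = 0")
      case False
      then have "\<phi> \<in> ?Q" using \<phi> eig_disc by blast
      then show ?thesis by (intro orth cvec.span_base) blast
    qed simp
  qed
  then have "singular_continuous (B.smeas \<psi>)"
    unfolding singular_continuous_def using B.smeas_singular[OF conc_all] by blast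
  then have "\<psi> \<in> ?P"
    by (simp add: B.spectral_measure_eq_smeas purely_singular_continuousI B.smeas.M_is_borel)
  then have "cinner \<psi> \<psi> = 0" by (intro orth cvec.span_base) blast
  then show "\<psi> = 0" by simp
qed

theorem theorem4:
  fixes A :: "'a::chilbert_space \<rightharpoonup> 'a"
  assumes "separable_space (euclidean :: 'a topology)"
    and "self_adjoint A"
  shows "\<exists>G. gdelta_in hs_topology G \<and> hs_topology closure_of G = topspace hs_topology \<and>
    (\<forall>C\<in>G. closure (cvec.span
        ({\<psi>. purely_singular_continuous (spectral_measure (perturb A C) \<psi>)} \<union>
         {\<psi>. \<exists>E\<in>disc_spectrum (perturb A C). perturb A C \<psi> = Some (E *\<^sub>C \<psi>)})) = UNIV)"
proof -
  interpret Metric_space "sa_hilbert_schmidt :: ('a \<Rightarrow> 'a) set" hs_dist by (rule Metric_space_hs)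
  have top: "topspace (hs_topology :: ('a \<Rightarrow> 'a) topology) = sa_hilbert_schmidt"
      by (simp add: hs_topology_def)
  \<comment> \<open>Separability supplies a countable dense set of test vectors, so countably many
    open dense conditions are imposed and Baire's theorem applies.\<close>
  obtain X :: "'a set" where X: "countable X" "closure X = UNIV"
    using assms(1) unfolding separable_space_def by auto
  define \<G> where "\<G> = (\<lambda>(\<phi>, k). almost_diagonal A \<phi> (inverse (real (Suc k)))) ` (X \<times> UNIV)"
  have ne: "X \<noteq> {}" using X(2) by auto
  have count: "countable \<G>" unfolding \<G>_def using X(1) by simp
  have op: "openin hs_topology U" if "U \<in> \<G>" for U
    using that openin_almost_diagonal unfolding \<G>_def by auto
  have dense: "mtopology closure_of U = sa_hilbert_schmidt" if UG: "U \<in> \<G>" for U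
  proof -
    obtain \<phi> k where U: "U = almost_diagonal A \<phi> (inverse (real (Suc k)))" using UG
        unfolding \<G>_def by auto
    have "\<exists>C\<in>U. C \<in> mball C0 r" if C0: "C0 \<in> sa_hilbert_schmidt" and r: "r > 0" for C0 r
    proof -
      obtain C where "C \<in> U" "hs_dist C0 C < r"
        using almost_diagonal_dense[OF assms(2) C0 _ r, of "inverse (real (Suc k))" \<phi>] U by auto
      moreover then have "C \<in> sa_hilbert_schmidt" unfolding U almost_diagonal_def by blast
      ultimately show ?thesis using C0 by (auto simp: in_mball)
    qed
    then show ?thesis unfolding metric_closure_of by blast
  qed
  have "gdelta_in hs_topology (\<Inter>\<G>)"
    by (rule gdelta_in_Inter[OF count]) (use ne op open_imp_gdelta_in in \<open>auto simp: \<G>_def\<close>)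
  moreover have "hs_topology closure_of (\<Inter>\<G>) = topspace hs_topology"
    unfolding top unfolding hs_topology_def
    by (rule metric_Baire_category[OF mcomplete_hs count]) (use op dense
        in \<open>simp add: hs_topology_def\<close>)
  moreover have "closure (cvec.span
        ({\<psi>. purely_singular_continuous (spectral_measure (perturb A C) \<psi>)} \<union>
         {\<psi>. \<exists>E\<in>disc_spectrum (perturb A C). perturb A C \<psi> = Some (E *\<^sub>C \<psi>)})) = UNIV"
    if C: "C \<in> \<Inter>\<G>" for C
  proof (rule almost_diagonal_imp_total[OF assms(2) X(2)])
    have CU: "C \<in> almost_diagonal A \<phi> (inverse (real (Suc k)))" if "\<phi> \<in> X" for \<phi> k
      using C that unfolding \<G>_def by auto
    then show "C \<in> sa_hilbert_schmidt" using ne unfolding almost_diagonal_def by blast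
    show "\<exists>\<epsilon>'>0. \<epsilon>' \<le> \<epsilon> \<and> C \<in> almost_diagonal A \<phi> \<epsilon>'" if \<phi>: "\<phi> \<in> X" and \<epsilon>: "\<epsilon> > 0" for \<phi> \<epsilon>
    proof -
      obtain k where "inverse (real (Suc k)) < \<epsilon>" using reals_Archimedean[OF \<epsilon>] by blast
      then show ?thesis using CU[OF \<phi>, of k] by (intro exI[of _ "inverse (real (Suc k))"]) auto
    qed
  qed
  ultimately show ?thesis by blast
qed

end
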